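(* Let $1\le m\le n-1$ be integers, let $E\subset\mathbb{R}^n$ be a non-empty Borel set (assumed to be bounded in (ii) and (iii)) and let $0\le s\le m$. Then (i) $\dim_{\rm H}\{V\in G(n,m):\dim_{\rm H}\pi_VE<\dim_{\rm H}^sE\}\le m(n-m)-(m-s)$, (ii) $\dim_{\rm H}\{V\in G(n,m):\underline{\dim}_{\rm B}\,\pi_VE<\underline{\dim}_{\rm B}^sE\}\le m(n-m)-(m-s)$, (iii) $\dim_{\rm H}\{V\in G(n,m):\overline{\dim}_{\rm B}\,\pi_VE<\overline{\dim}_{\rm B}^sE\}\le m(n-m)-(m-s)$, (iv) $\dim_{\rm H}\{V\in G(n,m):\dim_{\rm P}\pi_VE<\dim_{\rm P}^sE\}\le m(n-m)-(m-s)$.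
   Context: $G(n,m)$ is the Grassmannian of $m$-dimensional linear subspaces of $\mathbb{R}^n$, a manifold of dimension $m(n-m)$, equipped with a natural locally $m(n-m)$-dimensional metric (e.g. $d(V,W)=\|\pi_V-\pi_W\|$ in operator norm), with respect to which Hausdorff dimension of subsets of $G(n,m)$ is taken; $\pi_V:\mathbb{R}^n\to V$ is orthogonal projection. $\dim_{\rm H}$ is Hausdorff dimension (with $\dim_{\rm H}\emptyset=0$). Box dimensions: for non-empty bounded $E$, $N_r(E)$ is the minimum number of sets of diameter $r$ that can cover $E$; $\underline{\dim}_{\rm B}E=\liminf_{r\to0}\frac{\log N_r(E)}{-\log r}$ and $\overline{\dim}_{\rm B}E=\limsup_{r\to0}\frac{\log N_r(E)}{-\log r}$. Packing dimension: $\dim_{\rm P}E=\inf\{\sup_{i}\overline{\dim}_{\rm B}E_i: E\subset\bigcup_{i=1}^\infty E_i\}$, where the infimum is over countable covers by non-empty bounded (equivalently, compact) sets $E_i$. Dimension profiles: for $s>0$, $r>0$ let $\phi_r^s(x)=\min\{1,(r/|x|)^s\}$ for $x\in\mathbb{R}^n$ (equal to $1$ at $x=0$); for $s=0$ put $\phi_r^0\equiv1$. For non-empty compact $E$ let $\mathcal{M}(E)$ be the set of Borel probability measures supported by $E$, and define the capacity $C_r^s(E)$ by $\frac1{C_r^s(E)}=\inf_{\mu\in\mathcal{M}(E)}\int\int\phi_r^s(x-y)\,d\mu(x)\,d\mu(y)$. For non-empty bounded $E$, $C_r^s(E)$ is defined as the capacity of the closure of $E$. Then $\underline{\dim}_{\rm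 B}^sE=\liminf_{r\to0}\frac{\log C_r^s(E)}{-\log r}$, $\overline{\dim}_{\rm B}^sE=\limsup_{r\to0}\frac{\log C_r^s(E)}{-\log r}$, and for arbitrary non-empty $E\subset\mathbb{R}^n$, $\dim_{\rm P}^sE=\inf\{\sup_i\overline{\dim}_{\rm B}^sE_i:E\subset\bigcup_{i=1}^\infty E_i,\ \text{each }E_i\text{ non-empty and compact}\}$. (So all of these profiles are $0$ when $s=0$.) Also $\dim_{\rm H}^sE:=\min\{s,\dim_{\rm H}E\}$. *)

theory Defs
  imports "HOL-Probability.Probability"
begin

section \<open>Hausdorff dimension\<close>

text \<open>
  The distance function \<open>d\<close> is an explicit argument: it is \<open>dist\<close> for subsets of Euclidean
  space, and \<open>grassmann_dist\<close> (below) for sets of subspaces.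
  All dimensions take values in the extended reals.
\<close>

definition ediameter :: "('a \<Rightarrow> 'a \<Rightarrow> real) \<Rightarrow> 'a set \<Rightarrow> ennreal" where
  "ediameter d U = (SUP x\<in>U. SUP y\<in>U. ennreal (d x y))"

text \<open>
  \<open>diam_powr d s U\<close> is the \<open>s\<close>-th power of the diameter of \<open>U\<close>, for \<open>U\<close> of finite diameter.
  The usual conventions \<open>0\<^sup>0 = 1\<close> for nonempty \<open>U\<close> and value \<open>0\<close> for empty \<open>U\<close> are made explicit,
  since \<open>0 powr 0 = 0\<close>; with them the \<open>0\<close>-dimensional Hausdorff measure is the counting measure.
\<close>

definition diam_powr :: "('a \<Rightarrow> 'a \<Rightarrow> real) \<Rightarrow> real \<Rightarrow> 'a set \<Rightarrow> ennreal" where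
  "diam_powr d s U =
     (if U = {} then 0 else if s = 0 then 1 else ennreal (enn2real (ediameter d U) powr s))"

definition hausdorff_premeasure ::
    "('a \<Rightarrow> 'a \<Rightarrow> real) \<Rightarrow> real \<Rightarrow> real \<Rightarrow> 'a set \<Rightarrow> ennreal" where
  "hausdorff_premeasure d s \<delta> A =
     (INF U\<in>{U :: nat \<Rightarrow> 'a set. A \<subseteq> (\<Union>i. U i) \<and> (\<forall>i. ediameter d (U i) \<le> ennreal \<delta>)}.
        \<Sum>i. diam_powr d s (U i))"

definition hausdorff_measure :: "('a \<Rightarrow> 'a \<Rightarrow> real) \<Rightarrow> real \<Rightarrow> 'a set \<Rightarrow> ennreal" where
  "hausdorff_measure d s A = (SUP \<delta>\<in>{0<..}. hausdorff_premeasure d s \<delta> A)"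

definition hausdorff_dim :: "('a \<Rightarrow> 'a \<Rightarrow> real) \<Rightarrow> 'a set \<Rightarrow> ereal" where
  "hausdorff_dim d A = (INF s\<in>{s. 0 \<le> s \<and> hausdorff_measure d s A = 0}. ereal s)"


section \<open>Box and packing dimensions\<close>

definition covering_number :: "real \<Rightarrow> 'a::euclidean_space set \<Rightarrow> nat" where
  "covering_number r E =
     (LEAST k. \<exists>\<C>. finite \<C> \<and> card \<C> = k \<and> (\<forall>U\<in>\<C>. bounded U \<and> diameter U = r) \<and> E \<subseteq> \<Union>\<C>)"

definition lower_box_dim :: "'a::euclidean_space set \<Rightarrow> ereal" where
  "lower_box_dim E = Liminf (at_right 0) (\<lambda>r. ereal (ln (real (covering_number r E)) / - ln r))"

definition upper_box_dim :: "'a::euclidean_space set \<Rightarrow> ereal" where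
  "upper_box_dim E = Limsup (at_right 0) (\<lambda>r. ereal (ln (real (covering_number r E)) / - ln r))"

definition packing_dim :: "'a::euclidean_space set \<Rightarrow> ereal" where
  "packing_dim E =
     (INF F\<in>{F :: nat \<Rightarrow> 'a set. E \<subseteq> (\<Union>i. F i) \<and> (\<forall>i. F i \<noteq> {} \<and> bounded (F i))}.
        SUP i. upper_box_dim (F i))"


section \<open>Capacities and dimension profiles\<close>

definition profile_kernel :: "real \<Rightarrow> real \<Rightarrow> 'a::euclidean_space \<Rightarrow> real" where
  "profile_kernel s r x = (if s = 0 \<or> x = 0 then 1 else min 1 ((r / norm x) powr s))"

definition prob_measures_on :: "'a::euclidean_space set \<Rightarrow> 'a measure set" where
  "prob_measures_on K = {\<mu>. sets \<mu> = sets borel \<and> prob_space \<mu> \<and> emeasure \<mu> (- K) = 0}"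

text \<open>
  For compact \<open>E\<close> the closure is redundant; for bounded \<open>E\<close> the capacity is by definition that
  of the closure.
\<close>

definition profile_capacity :: "real \<Rightarrow> real \<Rightarrow> 'a::euclidean_space set \<Rightarrow> real" where
  "profile_capacity s r E =
     1 / (INF \<mu>\<in>prob_measures_on (closure E). \<integral>y. (\<integral>x. profile_kernel s r (x - y) \<partial>\<mu>) \<partial>\<mu>)"

definition lower_box_profile :: "real \<Rightarrow> 'a::euclidean_space set \<Rightarrow> ereal" where
  "lower_box_profile s E = Liminf (at_right 0) (\<lambda>r. ereal (ln (profile_capacity s r E) / - ln r))"

definition upper_box_profile :: "real \<Rightarrow> 'a::euclidean_space set \<Rightarrow> ereal" where
  "upper_box_profile s E = Limsup (at_right 0) (\<lambda>r. ereal (ln (profile_capacity s r E) / - ln r))"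

definition packing_profile :: "real \<Rightarrow> 'a::euclidean_space set \<Rightarrow> ereal" where
  "packing_profile s E =
     (INF F\<in>{F :: nat \<Rightarrow> 'a set. E \<subseteq> (\<Union>i. F i) \<and> (\<forall>i. F i \<noteq> {} \<and> compact (F i))}.
        SUP i. upper_box_profile s (F i))"

definition hausdorff_profile :: "real \<Rightarrow> 'a::euclidean_space set \<Rightarrow> ereal" where
  "hausdorff_profile s E = min (ereal s) (hausdorff_dim dist E)"


section \<open>Orthogonal projections and the Grassmannian\<close>

definition orth_proj :: "'a::euclidean_space set \<Rightarrow> 'a \<Rightarrow> 'a" where
  "orth_proj V x = (THE y. y \<in> V \<and> x - y \<in> V\<^sup>\<bottom>)"

definition grassmannian :: "nat \<Rightarrow> 'a::euclidean_space set set" where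
  "grassmannian m = {V. subspace V \<and> dim V = m}"

definition grassmann_dist :: "'a::euclidean_space set \<Rightarrow> 'a set \<Rightarrow> real" where
  "grassmann_dist V W = onorm (\<lambda>x. orth_proj V x - orth_proj W x)"

lemma orth_proj_unique:
  assumes "subspace V" "y \<in> V" "x - y \<in> V\<^sup>\<bottom>"
  shows "orth_proj V x = y"
  unfolding orth_proj_def
proof (rule the_equality)
  fix z assume z: "z \<in> V \<and> x - z \<in> V\<^sup>\<bottom>"
  have "z - y \<in> V" using assms z by (simp add: subspace_diff)
  moreover have "(x - y) - (x - z) \<in> V\<^sup>\<bottom>"
    using subspace_diff[OF subspace_orthogonal_comp assms(3)] z by blast
  ultimately have "orthogonal (z - y) (z - y)" by (simp add: orthogonal_comp_def)
  then show "z = y" by (simp add: orthogonal_self)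
qed (use assms in auto)

lemma orth_proj_works:
  assumes "subspace V"
  shows "orth_proj V x \<in> V" and "x - orth_proj V x \<in> V\<^sup>\<bottom>"
proof -
  have "x \<in> V + V\<^sup>\<bottom>" using subspace_sum_orthogonal_comp[OF assms] by simp
  then obtain y z where "x = y + z" "y \<in> V" "z \<in> V\<^sup>\<bottom>" by (rule set_plus_elim)
  then have y: "y \<in> V" "x - y \<in> V\<^sup>\<bottom>" by auto
  then show "orth_proj V x \<in> V" "x - orth_proj V x \<in> V\<^sup>\<bottom>"
    using orth_proj_unique[OF assms y] by auto
qed

lemma linear_orth_proj:
  assumes V: "subspace V"
  shows "linear (orth_proj V)"
proof (rule linearI)
  fix x y
  show "orth_proj V (x + y) = orth_proj V x + orth_proj V y"
  proof (rule orth_proj_unique[OF V])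
    have "(x - orth_proj V x) + (y - orth_proj V y) \<in> V\<^sup>\<bottom>"
      by (intro subspace_add subspace_orthogonal_comp orth_proj_works V)
    then show "x + y - (orth_proj V x + orth_proj V y) \<in> V\<^sup>\<bottom>" by (simp add: algebra_simps)
  qed (intro subspace_add V orth_proj_works)
next
  fix c :: real and x
  show "orth_proj V (c *\<^sub>R x) = c *\<^sub>R orth_proj V x"
  proof (rule orth_proj_unique[OF V])
    have "c *\<^sub>R (x - orth_proj V x) \<in> V\<^sup>\<bottom>"
      by (intro subspace_scale subspace_orthogonal_comp orth_proj_works V)
    then show "c *\<^sub>R x - c *\<^sub>R orth_proj V x \<in> V\<^sup>\<bottom>" by (simp add: algebra_simps)
  qed (intro subspace_scale V orth_proj_works)
qed

lemma orth_proj_fixed_iff: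
  assumes V: "subspace V"
  shows "orth_proj V x = x \<longleftrightarrow> x \<in> V"
proof
  assume "orth_proj V x = x"
  with orth_proj_works(1)[OF V, of x] show "x \<in> V" by simp
next
  assume "x \<in> V"
  then show "orth_proj V x = x"
    by (rule orth_proj_unique[OF V]) (simp add: subspace_0 subspace_orthogonal_comp)
qed

text \<open>\<open>grassmann_dist\<close> is a metric on \<open>grassmannian m\<close>.\<close>

lemma bounded_linear_orth_proj_diff:
  assumes "V \<in> grassmannian m" "W \<in> grassmannian m"
  shows "bounded_linear (\<lambda>x. orth_proj V x - orth_proj W x)"
  using assms by (auto simp: grassmannian_def linear_conv_bounded_linear[symmetric]
      intro!: linear_compose_sub linear_orth_proj)

lemma grassmann_dist_nonneg:
  assumes "V \<in> grassmannian m" "W \<in> grassmannian m"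
  shows "0 \<le> grassmann_dist V W"
  unfolding grassmann_dist_def by (rule onorm_pos_le[OF bounded_linear_orth_proj_diff[OF assms]])

lemma grassmann_dist_commute: "grassmann_dist V W = grassmann_dist W V"
  unfolding grassmann_dist_def onorm_def by (simp add: norm_minus_commute)

lemma grassmann_dist_eq_0_iff:
  assumes "V \<in> grassmannian m" "W \<in> grassmannian m"
  shows "grassmann_dist V W = 0 \<longleftrightarrow> V = W"
proof -
  have "grassmann_dist V W = 0 \<longleftrightarrow> (\<forall>x. orth_proj V x = orth_proj W x)"
    unfolding grassmann_dist_def onorm_eq_0[OF bounded_linear_orth_proj_diff[OF assms]] by simp
  also have "\<dots> \<longleftrightarrow> V = W"
  proof
    assume eq: "\<forall>x. orth_proj V x = orth_proj W x"
    have "x \<in> V \<longleftrightarrow> x \<in> W" for x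
      using assms eq orth_proj_fixed_iff[of V x] orth_proj_fixed_iff[of W x]
      by (simp add: grassmannian_def)
    then show "V = W" by blast
  qed simp
  finally show ?thesis .
qed

lemma grassmann_dist_triangle:
  assumes "U \<in> grassmannian m" "V \<in> grassmannian m" "W \<in> grassmannian m"
  shows "grassmann_dist U W \<le> grassmann_dist U V + grassmann_dist V W"
  using onorm_triangle[OF bounded_linear_orth_proj_diff[of U m V]
      bounded_linear_orth_proj_diff[of V m W]] assms
  unfolding grassmann_dist_def by simp

end

(* All four parts use Hausdorff contents instead of measures.  On the Grassmannian and on R^n take
   nested families of cells of size 2^-k (labels of frames, dyadic cubes).  A set A of m-planes
   carries finitely many point masses whose total is at least the t-dimensional content of A and
   which give every cell of level j mass at most 2^(-jt), t = m(n-m) - (m-s).  The planes V with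
   |pi_V z| <= r meet about (r/|z|)^(-(m(n-m)-m)) cells of size r/|z|, so their total mass is at most
   a constant times (r/|z|)^s, that is, times the kernel phi_r^s(z).

   Box dimensions: if pi_V E is covered by N sets of diameter r, then every probability measure mu on
   the closure of E gives mass at least 1/N to the pairs with |pi_V(x-y)| <= r.  Summing over the
   point masses, the content of the set of such V is at most a constant times N times the energy of mu,
   so it is at most a constant times N / C_r^s(E).  For r = 2^-k and N = 2^(-k eps) C_r^s(E) this is
   summable, and the exceptional set lies in a countable union of limsup sets of this kind; the content
   of these is 0.

   Packing dimension: write E as the image of a closed set T in R^n x N^N and remove from T the open
   sets with image of small profile.  A cover of pi_V E by sets of small upper box dimension then
   contains, by Baire's theorem, the projection of the image of a basic open piece of T.  So the
   exceptional set is covered by those of the upper box dimension for countably many pieces.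

   Hausdorff dimension: by the increasing sets lemma for net contents (strong subadditivity), E
   contains a compact set K of positive content, and K carries consistent masses w_k on the dyadic
   cubes of level k with energy O(2^(-kq')).  If pi_V K has zero q-dimensional content, q < q', a finite
   cover of small content has a level k whose cubes carry a definite part of the mass of K, and V lies
   in a limsup set as before. *)

theory Submission
  imports Defs
begin

section \<open>Net contents\<close>

text \<open>The exceptional sets come with no evident measurability, so they are measured by a
  content that is countably subadditive on all sets. At a positive exponent a null content forces a
  null measure, because a cell that is not small already costs too much; this is what leads back to
  \<open>hausdorff_dim\<close>. Cells have to be nested exactly, not just up to constants: the
  increasing sets lemma and the splitting of mass both use that two cells with a common point are
  comparable. Hence labels are floors of 2^k times real coordinates. On the Grassmannian these
  coordinates are the entries of a reduced basis, chosen without any continuity in the subspace. A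
  finite tree of cells suffices for the point masses: for |z| <= 2^p the ratio 2^-k / |z| is at
  least 2^-(k+p), so no level beyond k + p is inspected. Thus no limit measure is formed, and
  averages over subspaces are finite sums. Near-orthogonality to z costs each of the m frame vectors
  one degree of freedom, which leaves m(n-m-1); the power s of the kernel makes up the rest of
  t.\<close>

definition cell :: "(nat \<Rightarrow> 'a \<Rightarrow> 'l) \<Rightarrow> nat \<times> 'l \<Rightarrow> 'a set" where
  "cell lab u = {x. lab (fst u) x = snd u}"

text \<open>A weighted counting measure on pairs (level, label), so that the cost of a cover is an
  \<open>emeasure\<close>: additivity and continuity from below come for free, the latter for the
  increasing sets lemma.\<close>

definition cell_measure :: "real \<Rightarrow> (nat \<times> 'l) measure" where
  "cell_measure t = density (count_space UNIV) (\<lambda>u. ennreal ((1/2) powr (t * real (fst u))))"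

text \<open>Level 0 is the coarsest scale and no finer mesh is imposed, so this is a content in the
  sense of Hausdorff content, not a measure. A cover by uncountably many labels has infinite
  cost.\<close>

definition net_content :: "(nat \<Rightarrow> 'a \<Rightarrow> 'l) \<Rightarrow> real \<Rightarrow> 'a set \<Rightarrow> ennreal" where
  "net_content lab t A = (INF \<U>\<in>{\<U>. A \<subseteq> (\<Union>u\<in>\<U>. cell lab u)}. emeasure (cell_measure t) \<U>)"

lemma mem_cell_iff: "x \<in> cell lab u \<longleftrightarrow> lab (fst u) x = snd u"
  by (simp add: cell_def)

lemma sets_cell_measure [simp]: "sets (cell_measure t) = UNIV"
  and space_cell_measure [simp]: "space (cell_measure t) = UNIV"
  by (auto simp: cell_measure_def)

lemma emeasure_cell_measure_eq:
  "emeasure (cell_measure t) \<U> = (\<integral>\<^sup>+u. ennreal ((1/2) powr (t * real (fst u))) \<partial>count_space \<U>)"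
  unfolding cell_measure_def by (subst emeasure_density) (auto simp: nn_integral_count_space_indicator)

lemma emeasure_cell_measure_singleton:
  "emeasure (cell_measure t) {u} = ennreal ((1/2) powr (t * real (fst u)))"
  unfolding cell_measure_def by (subst emeasure_density) (auto simp: nn_integral_count_space_indicator[symmetric])

lemma emeasure_cell_measure_ge:
  "u \<in> \<U> \<Longrightarrow> ennreal ((1/2) powr (t * real (fst u))) \<le> emeasure (cell_measure t) \<U>"
  using emeasure_mono[of "{u}" \<U> "cell_measure t"] by (simp add: emeasure_cell_measure_singleton)

lemma emeasure_cell_measure_finite:
  "finite \<U> \<Longrightarrow> emeasure (cell_measure t) \<U> = ennreal (\<Sum>u\<in>\<U>. (1/2) powr (t * real (fst u)))"
  by (subst emeasure_eq_sum_singleton) (auto simp: emeasure_cell_measure_singleton sum_ennreal)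

lemma net_content_le: "A \<subseteq> (\<Union>u\<in>\<U>. cell lab u) \<Longrightarrow> net_content lab t A \<le> emeasure (cell_measure t) \<U>"
  unfolding net_content_def by (rule INF_lower) simp

lemma net_content_lessE:
  assumes "net_content lab t A < c"
  obtains \<U> where "A \<subseteq> (\<Union>u\<in>\<U>. cell lab u)" "emeasure (cell_measure t) \<U> < c"
  using assms unfolding net_content_def INF_less_iff by auto

lemma net_content_geI:
  assumes "\<And>\<U>. A \<subseteq> (\<Union>u\<in>\<U>. cell lab u) \<Longrightarrow> c \<le> emeasure (cell_measure t) \<U>"
  shows "c \<le> net_content lab t A"
  unfolding net_content_def by (rule INF_greatest) (use assms in auto)

lemma net_content_mono: "A \<subseteq> B \<Longrightarrow> net_content lab t A \<le> net_content lab t B"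
  by (rule net_content_geI) (meson net_content_le order_trans)

lemma net_content_empty [simp]: "net_content lab t {} = 0"
  using net_content_le[of "{}" lab "{}" t] by simp

lemma net_content_cell_le: "A \<subseteq> cell lab u \<Longrightarrow> net_content lab t A \<le> ennreal ((1/2) powr (t * real (fst u)))"
  using net_content_le[of A lab "{u}" t] by (simp add: emeasure_cell_measure_singleton)

lemma net_content_near_cover:
  assumes "net_content lab t A < \<infinity>" "0 < e"
  obtains \<U> where "A \<subseteq> (\<Union>u\<in>\<U>. cell lab u)" "emeasure (cell_measure t) \<U> \<le> net_content lab t A + ennreal e"
proof -
  have "net_content lab t A < net_content lab t A + ennreal e"
    using assms by (simp add: ennreal_less_zero_iff)
  then show ?thesis using that by (meson net_content_lessE less_imp_le)
qed

lemma net_content_UN_le: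
  fixes A :: "nat \<Rightarrow> 'a set"
  shows "net_content lab t (\<Union>i. A i) \<le> (\<Sum>i. net_content lab t (A i))"
proof (cases "\<forall>i. net_content lab t (A i) < \<infinity>")
  case True
  show ?thesis
  proof (rule ennreal_le_epsilon)
    fix e :: real assume e: "0 < e"
    have "\<exists>\<U>. A i \<subseteq> (\<Union>u\<in>\<U>. cell lab u) \<and>
        emeasure (cell_measure t) \<U> \<le> net_content lab t (A i) + ennreal (e * (1/2)^Suc i)" for i
      using net_content_near_cover[of lab t "A i" "e * (1/2)^Suc i"] True e by (metis divide_pos_pos mult_pos_pos zero_less_one zero_less_numeral zero_less_power)
    then obtain \<U> where U: "\<And>i. A i \<subseteq> (\<Union>u\<in>\<U> i. cell lab u)"
        "\<And>i. emeasure (cell_measure t) (\<U> i) \<le> net_content lab t (A i) + ennreal (e * (1/2)^Suc i)"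
      by metis
    have "net_content lab t (\<Union>i. A i) \<le> emeasure (cell_measure t) (\<Union>i. \<U> i)"
      by (rule net_content_le) (use U(1) in fastforce)
    also have "\<dots> \<le> (\<Sum>i. emeasure (cell_measure t) (\<U> i))"
      by (rule emeasure_subadditive_countably) auto
    also have "\<dots> \<le> (\<Sum>i. net_content lab t (A i) + ennreal (e * (1/2)^Suc i))"
      by (rule suminf_le) (use U(2) in auto)
    also have "\<dots> = (\<Sum>i. net_content lab t (A i)) + (\<Sum>i. ennreal (e * (1/2)^Suc i))"
      by (rule suminf_add[symmetric]) auto
    also have "(\<Sum>i. ennreal (e * (1/2)^Suc i)) = ennreal e"
      using power_half_series e
      by (intro suminf_ennreal_eq) (auto dest: sums_mult[of _ _ e])
    finally show "net_content lab t (\<Union>i. A i) \<le> (\<Sum>i. net_content lab t (A i)) + ennreal e" .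
  qed
next
  case False
  then obtain i where "net_content lab t (A i) = \<infinity>" by (metis infinity_ennreal_def less_top)
  moreover have "net_content lab t (A i) \<le> (\<Sum>i. net_content lab t (A i))"
    using sum_le_suminf[of "\<lambda>i. net_content lab t (A i)" "{i}"] by auto
  ultimately show ?thesis by (simp add: top_unique)
qed

lemma net_content_UN_eq_0:
  assumes "countable I" "\<And>i. i \<in> I \<Longrightarrow> net_content lab t (A i) = 0"
  shows "net_content lab t (\<Union>i\<in>I. A i) = 0"
proof (cases "I = {}")
  case False
  have "(\<Union>i\<in>I. A i) = (\<Union>k. A (from_nat_into I k))"
    using assms(1) False by (metis UN_extend_simps(10) range_from_nat_into)
  moreover have "net_content lab t (A (from_nat_into I k)) = 0" for k
    using assms(2) False by (simp add: from_nat_into)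
  ultimately show ?thesis using net_content_UN_le[of lab t "\<lambda>k. A (from_nat_into I k)"] by simp
qed simp

lemma net_content_Un_le: "net_content lab t (A \<union> B) \<le> net_content lab t A + net_content lab t B"
proof (rule ennreal_le_epsilon)
  fix e :: real assume e: "0 < e" and "net_content lab t A + net_content lab t B < top"
  then have fin: "net_content lab t A < \<infinity>" "net_content lab t B < \<infinity>" by (auto simp: ennreal_add_less_top)
  obtain \<U> where U: "A \<subseteq> (\<Union>u\<in>\<U>. cell lab u)" "emeasure (cell_measure t) \<U> \<le> net_content lab t A + ennreal (e/2)"
    using net_content_near_cover[OF fin(1), of "e/2"] e by auto
  obtain \<V> where V: "B \<subseteq> (\<Union>u\<in>\<V>. cell lab u)" "emeasure (cell_measure t) \<V> \<le> net_content lab t B + ennreal (e/2)"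
    using net_content_near_cover[OF fin(2), of "e/2"] e by auto
  have "net_content lab t (A \<union> B) \<le> emeasure (cell_measure t) (\<U> \<union> \<V>)"
    by (rule net_content_le) (use U V in auto)
  also have "\<dots> \<le> emeasure (cell_measure t) \<U> + emeasure (cell_measure t) \<V>"
    by (rule emeasure_subadditive) auto
  also have "\<dots> \<le> (net_content lab t A + ennreal (e/2)) + (net_content lab t B + ennreal (e/2))"
    by (intro add_mono U V)
  also have "\<dots> = net_content lab t A + net_content lab t B + ennreal e"
    using e by (simp add: ac_simps flip: ennreal_plus)
  finally show "net_content lab t (A \<union> B) \<le> net_content lab t A + net_content lab t B + ennreal e" .
qed

lemma net_content_finite_UN_le:
  "finite I \<Longrightarrow> net_content lab t (\<Union>i\<in>I. A i) \<le> (\<Sum>i\<in>I. net_content lab t (A i))"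
proof (induction I rule: finite_induct)
  case (insert i I)
  have "net_content lab t (\<Union>j\<in>insert i I. A j) \<le> net_content lab t (A i) + net_content lab t (\<Union>j\<in>I. A j)"
    using net_content_Un_le[of lab t "A i" "\<Union>j\<in>I. A j"] by simp
  also have "\<dots> \<le> net_content lab t (A i) + (\<Sum>j\<in>I. net_content lab t (A j))"
    using insert.IH by (rule add_left_mono)
  finally show ?case using insert.hyps by simp
qed simp

text \<open>Borel-Cantelli for contents: the limsup set lies in every tail union, whose content is
  at most a tail of a convergent series.\<close>

lemma net_content_limsup_eq_0:
  assumes bound: "\<And>k. net_content lab t (A k) \<le> ennreal (e k)" and e: "summable e" "\<And>k. 0 \<le> e k"
  shows "net_content lab t {x. \<exists>\<^sub>F k in sequentially. x \<in> A k} = 0"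
proof -
  have *: "net_content lab t {x. \<exists>\<^sub>F k in sequentially. x \<in> A k} \<le> ennreal (\<Sum>k. e (k + N))" for N
  proof -
    have "{x. \<exists>\<^sub>F k in sequentially. x \<in> A k} \<subseteq> (\<Union>k. A (k + N))"
    proof
      fix x assume "x \<in> {x. \<exists>\<^sub>F k in sequentially. x \<in> A k}"
      then obtain k where "k \<ge> N" "x \<in> A k" by (auto simp: frequently_sequentially)
      then show "x \<in> (\<Union>k. A (k + N))" by (metis UN_iff UNIV_I le_add_diff_inverse2)
    qed
    then have "net_content lab t {x. \<exists>\<^sub>F k in sequentially. x \<in> A k} \<le> (\<Sum>k. net_content lab t (A (k + N)))"
      using net_content_mono net_content_UN_le[of lab t "\<lambda>k. A (k + N)"] order_trans by blast
    also have "\<dots> \<le> (\<Sum>k. ennreal (e (k + N)))"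
      by (rule suminf_le) (use bound in auto)
    also have "\<dots> = ennreal (\<Sum>k. e (k + N))"
      using e by (intro suminf_ennreal2) (auto simp: summable_iff_shift)
    finally show ?thesis .
  qed
  have "(\<lambda>N. ennreal (\<Sum>k. e (k + N))) \<longlonglongrightarrow> ennreal 0"
    by (intro tendsto_ennrealI suminf_exist_split2 e(1))
  from LIMSEQ_le_const[OF this, of "net_content lab t {x. \<exists>\<^sub>F k in sequentially. x \<in> A k}"] *
  show ?thesis by simp
qed

section \<open>Trees of nested cells, strong subadditivity and Frostman masses\<close>

locale nested_labels =
  fixes lab :: "nat \<Rightarrow> 'a \<Rightarrow> 'l" and par :: "'l \<Rightarrow> 'l"
  assumes lab_par: "lab k x = par (lab (Suc k) x)"
begin

text \<open>Ancestry is a relation between labels, obtained by iterating \<open>par\<close>, and not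
  inclusion of cells: different labels may have equal cells, for example empty ones.\<close>

definition anc :: "nat \<times> 'l \<Rightarrow> nat \<times> 'l \<Rightarrow> bool" where
  "anc u v \<longleftrightarrow> fst u \<le> fst v \<and> snd u = (par ^^ (fst v - fst u)) (snd v)"

definition maxima :: "(nat \<times> 'l) set \<Rightarrow> (nat \<times> 'l) set" where
  "maxima \<U> = {u \<in> \<U>. \<forall>v\<in>\<U>. anc v u \<longrightarrow> v = u}"

lemma lab_funpow: "j \<le> k \<Longrightarrow> lab j x = (par ^^ (k - j)) (lab k x)"
proof (induction "k - j" arbitrary: k)
  case (Suc d)
  then obtain k' where k: "k = Suc k'" "j \<le> k'" by (cases k) auto
  then have "lab j x = (par ^^ (k' - j)) (lab k' x)" using Suc by auto
  also have "\<dots> = (par ^^ (k - j)) (lab k x)"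
    using k lab_par[of k' x] by (simp add: Suc_diff_le funpow_swap1)
  finally show ?case .
qed auto

lemma anc_refl [simp]: "anc u u"
  by (simp add: anc_def)

lemma anc_trans: "anc u v \<Longrightarrow> anc v w \<Longrightarrow> anc u w"
  unfolding anc_def using funpow_add[of "fst v - fst u" "fst w - fst v" par] by auto

lemma cells_comparable: "x \<in> cell lab u \<Longrightarrow> x \<in> cell lab v \<Longrightarrow> anc u v \<or> anc v u"
  unfolding anc_def mem_cell_iff using lab_funpow nle_le by metis

lemma cell_anc_mono: "anc u v \<Longrightarrow> cell lab v \<subseteq> cell lab u"
  unfolding anc_def using lab_funpow by (auto simp: mem_cell_iff)

text \<open>A proper ancestor has a strictly smaller level, so climbing inside the family stops at a
  maximal label.\<close>

lemma anc_maxima: "u \<in> \<U> \<Longrightarrow> \<exists>v\<in>maxima \<U>. anc v u"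
proof (induction "fst u" arbitrary: u rule: less_induct)
  case less
  show ?case
  proof (cases "u \<in> maxima \<U>")
    case True
    then show ?thesis using anc_refl by blast
  next
    case False
    then obtain v where v: "v \<in> \<U>" "anc v u" "v \<noteq> u" using less.prems by (auto simp: maxima_def)
    then have "fst v < fst u" unfolding anc_def by (metis diff_self_eq_0 funpow_0 le_neq_implies_less prod_eqI)
    then show ?thesis using less.hyps v anc_trans by blast
  qed
qed

lemma UN_maxima: "(\<Union>u\<in>maxima \<U>. cell lab u) = (\<Union>u\<in>\<U>. cell lab u)"
proof
  show "(\<Union>u\<in>maxima \<U>. cell lab u) \<subseteq> (\<Union>u\<in>\<U>. cell lab u)" by (auto simp: maxima_def)
  show "(\<Union>u\<in>\<U>. cell lab u) \<subseteq> (\<Union>u\<in>maxima \<U>. cell lab u)"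
  proof
    fix x assume "x \<in> (\<Union>u\<in>\<U>. cell lab u)"
    then obtain u where u: "u \<in> \<U>" "x \<in> cell lab u" by blast
    obtain v where "v \<in> maxima \<U>" "anc v u" using anc_maxima[OF u(1)] by blast
    with cell_anc_mono u(2) show "x \<in> (\<Union>u\<in>maxima \<U>. cell lab u)" by blast
  qed
qed

text \<open>The cells of \<open>\<W> \<union> \<U>\<close> that are discarded in passing to \<open>maxima\<close> still cover \<open>A\<close>.\<close>

lemma net_content_strong_subadditive:
  assumes "A \<subseteq> (\<Union>u\<in>\<W>. cell lab u)" "A \<subseteq> (\<Union>u\<in>\<U>. cell lab u)"
  shows "emeasure (cell_measure t) (maxima (\<W> \<union> \<U>)) + net_content lab t A
    \<le> emeasure (cell_measure t) \<W> + emeasure (cell_measure t) \<U>"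
proof -
  let ?\<nu> = "emeasure (cell_measure t :: (nat \<times> 'l) measure)"
  define \<U>1 where "\<U>1 = {u\<in>\<U>. \<exists>v\<in>\<W>. anc v u}"
  \<comment> \<open>The condition \<open>u \<noteq> v\<close> breaks the tie for a maximal cell that
    belongs to both families: it is kept once and discarded once.\<close>
  define \<W>1 where "\<W>1 = {v\<in>\<W>. \<exists>u\<in>\<U>. anc u v \<and> u \<noteq> v}"
  have "?\<nu> (maxima (\<W> \<union> \<U>)) \<le> ?\<nu> ((\<W> - \<W>1) \<union> (\<U> - \<U>1))"
    by (intro emeasure_mono) (auto simp: maxima_def \<U>1_def \<W>1_def)
  also have "\<dots> \<le> ?\<nu> (\<W> - \<W>1) + ?\<nu> (\<U> - \<U>1)"
    by (rule emeasure_subadditive) auto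
  finally have 1: "?\<nu> (maxima (\<W> \<union> \<U>)) \<le> ?\<nu> (\<W> - \<W>1) + ?\<nu> (\<U> - \<U>1)" .
  have "net_content lab t A \<le> ?\<nu> (\<W>1 \<union> \<U>1)"
  proof (rule net_content_le, rule subsetI)
    fix x assume "x \<in> A"
    then obtain u v where "u \<in> \<U>" "x \<in> cell lab u" "v \<in> \<W>" "x \<in> cell lab v" using assms by blast
    then show "x \<in> (\<Union>u\<in>\<W>1 \<union> \<U>1. cell lab u)"
      using cells_comparable[of x u v] unfolding \<U>1_def \<W>1_def by fastforce
  qed
  also have "\<dots> \<le> ?\<nu> \<W>1 + ?\<nu> \<U>1"
    by (rule emeasure_subadditive) auto
  finally have 2: "net_content lab t A \<le> ?\<nu> \<W>1 + ?\<nu> \<U>1" .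
  have "\<W>1 \<subseteq> \<W>" "\<U>1 \<subseteq> \<U>" by (auto simp: \<U>1_def \<W>1_def)
  then have "?\<nu> \<W> = ?\<nu> \<W>1 + ?\<nu> (\<W> - \<W>1)" "?\<nu> \<U> = ?\<nu> \<U>1 + ?\<nu> (\<U> - \<U>1)"
    by (auto simp: plus_emeasure Un_absorb1)
  then show ?thesis using add_mono[OF 1 2] by (simp add: ac_simps)
qed

text \<open>Near-optimal covers of the sets A i are merged one after the other, keeping only the
  coarsest cells. By strong subadditivity each merge adds no more than the increase in content and
  the error of the new cover, so the errors sum to at most e. The coarsest cells of all covers
  together stay in the merged families from some stage on, and continuity from below bounds their
  cost.\<close>

lemma net_content_incseq_le:
  assumes "incseq A" and c: "\<And>i. net_content lab t (A i) \<le> c"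
  shows "net_content lab t (\<Union>i. A i) \<le> c"
proof (rule ennreal_le_epsilon)
  fix e :: real assume e: "0 < e" and "c < top"
  let ?\<nu> = "emeasure (cell_measure t :: (nat \<times> 'l) measure)"
  have fin: "net_content lab t (A i) < \<infinity>" for i
    using c[of i] \<open>c < top\<close> by (simp add: le_less_trans)
  have "\<exists>\<U>. A i \<subseteq> (\<Union>u\<in>\<U>. cell lab u) \<and> ?\<nu> \<U> \<le> net_content lab t (A i) + ennreal (e * (1/2)^Suc i)" for i
    using net_content_near_cover[OF fin, of "e * (1/2)^Suc i" i] e by (metis divide_pos_pos mult_pos_pos zero_less_one zero_less_numeral zero_less_power)
  then obtain \<U> where U: "\<And>i. A i \<subseteq> (\<Union>u\<in>\<U> i. cell lab u)"
      "\<And>i. ?\<nu> (\<U> i) \<le> net_content lab t (A i) + ennreal (e * (1/2)^Suc i)"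
    by metis
  define \<W> where "\<W> = rec_nat (\<U> 0) (\<lambda>i W. maxima (W \<union> \<U> (Suc i)))"
  have W0: "\<W> 0 = \<U> 0" and WS: "\<And>i. \<W> (Suc i) = maxima (\<W> i \<union> \<U> (Suc i))"
    by (simp_all add: \<W>_def)
  have cov: "A i \<subseteq> (\<Union>u\<in>\<W> i. cell lab u)" for i
    by (cases i) (use U(1) in \<open>fastforce simp: W0 WS UN_maxima\<close>)+
  have bound: "?\<nu> (\<W> i) \<le> net_content lab t (A i) + ennreal (\<Sum>j\<le>i. e * (1/2)^Suc j)" for i
  proof (induction i)
    case 0
    then show ?case using U(2)[of 0] by (simp add: W0)
  next
    case (Suc i)
    have sub: "A i \<subseteq> A (Suc i)" using \<open>incseq A\<close> by (simp add: incseq_SucD)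
    \<comment> \<open>Both merged families cover A i. Its content appears on both sides below and,
      being finite, is cancelled at the end.\<close>
    have "net_content lab t (A i) + ?\<nu> (\<W> (Suc i)) \<le> ?\<nu> (\<W> i) + ?\<nu> (\<U> (Suc i))"
      unfolding WS using net_content_strong_subadditive[OF cov[of i], of "\<U> (Suc i)" t] U(1)[of "Suc i"] sub
      by (auto simp: ac_simps)
    also have "\<dots> \<le> (net_content lab t (A i) + ennreal (\<Sum>j\<le>i. e * (1/2)^Suc j))
        + (net_content lab t (A (Suc i)) + ennreal (e * (1/2)^Suc (Suc i)))"
      by (intro add_mono Suc U(2))
    also have "\<dots> = net_content lab t (A i)
        + (net_content lab t (A (Suc i)) + ennreal (\<Sum>j\<le>Suc i. e * (1/2)^Suc j))"
      using e by (simp add: ac_simps sum_nonneg flip: ennreal_plus)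
    finally show ?case
      using fin[of i] unfolding ennreal_add_left_cancel_le by auto
  qed
  have le: "?\<nu> (\<W> i) \<le> c + ennreal e" for i
  proof -
    have "(\<Sum>j\<le>i. e * (1/2)^Suc j) \<le> e"
    proof -
      have "(\<Sum>j\<in>{..i}. (1/2::real)^Suc j) \<le> 1"
        using sum_le_suminf[OF sums_summable[OF power_half_series], of "{..i}"] sums_unique[OF power_half_series]
        by auto
      then show ?thesis using e mult_left_le[of "\<Sum>j\<in>{..i}. (1/2::real)^Suc j" e] by (simp only: sum_distrib_left)
    qed
    then show ?thesis using bound[of i] c[of i]
      by (meson add_mono ennreal_leI order_trans)
  qed
  define \<V> where "\<V> = maxima (\<Union>i. \<U> i)"
  have Wsub: "\<W> i \<subseteq> (\<Union>i. \<U> i)" for i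
    by (induction i) (auto simp: W0 WS maxima_def)
  \<comment> \<open>A globally coarsest cell that enters at stage i is never swallowed by a later
    merge.\<close>
  have ev: "u \<in> \<W> (i + d)" if "u \<in> \<V>" "u \<in> \<U> i" for u i d
  proof (induction d)
    case 0
    show ?case
    proof (cases i)
      case (Suc j)
      then show ?thesis using that Wsub[of j] unfolding WS maxima_def \<V>_def by (auto simp: WS maxima_def)
    qed (use that W0 in auto)
  next
    case (Suc d)
    then show ?case using that Wsub[of "i + d"] unfolding maxima_def \<V>_def by (auto simp: WS maxima_def)
  qed
  \<comment> \<open>The sets B j increase with j, lie in the bounded families \<open>\<W> j\<close>,
    and exhaust \<open>\<V>\<close>.\<close>
  define B where "B j = {u. \<forall>i\<ge>j. u \<in> \<W> i}" for j
  have "\<V> \<subseteq> (\<Union>j. B j)"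
  proof
    fix u assume u: "u \<in> \<V>"
    then obtain i where "u \<in> \<U> i" by (auto simp: \<V>_def maxima_def)
    then have "u \<in> B i" unfolding B_def using ev[OF u] by (auto simp: le_iff_add)
    then show "u \<in> (\<Union>j. B j)" by blast
  qed
  moreover have "(\<Union>i. A i) \<subseteq> (\<Union>u\<in>\<V>. cell lab u)"
    unfolding \<V>_def UN_maxima using U(1) by blast
  ultimately have "net_content lab t (\<Union>i. A i) \<le> ?\<nu> (\<Union>j. B j)"
    using net_content_le[of "\<Union>i. A i" lab \<V> t] emeasure_mono[of \<V> "\<Union>j. B j" "cell_measure t"]
    by (auto intro: order_trans)
  also have "\<dots> = (SUP j. ?\<nu> (B j))"
    by (rule SUP_emeasure_incseq[symmetric]) (auto simp: incseq_def B_def)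
  also have "\<dots> \<le> c + ennreal e"
  proof (rule SUP_least)
    fix j
    have "?\<nu> (B j) \<le> ?\<nu> (\<W> j)" by (rule emeasure_mono) (auto simp: B_def)
    then show "?\<nu> (B j) \<le> c + ennreal e" using le[of j] by order
  qed
  finally show "net_content lab t (\<Union>i. A i) \<le> c + ennreal e" .
qed

text \<open>Frostman masses: the content of \<open>A\<close> is distributed down the tree of cells, each cell
  passing its mass to its children in proportion to the content of \<open>A\<close> inside them.\<close>

primrec mass :: "real \<Rightarrow> 'a set \<Rightarrow> nat \<Rightarrow> 'l \<Rightarrow> real" where
  "mass t A 0 l = enn2real (net_content lab t (A \<inter> cell lab (0, l)))"
| "mass t A (Suc k) l = mass t A k (par l) * enn2real (net_content lab t (A \<inter> cell lab (Suc k, l)))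
     / (\<Sum>l'\<in>{l'\<in>lab (Suc k) ` A. par l' = par l}. enn2real (net_content lab t (A \<inter> cell lab (Suc k, l'))))"

lemma net_content_cell_finite: "net_content lab t (A \<inter> cell lab u) < top"
  using net_content_cell_le[of "A \<inter> cell lab u" lab u t] by (simp add: le_less_trans)

lemma enn2real_net_content_cell_le:
  "enn2real (net_content lab t (A \<inter> cell lab u)) \<le> (1/2) powr (t * real (fst u))"
  using enn2real_mono[OF net_content_cell_le[of "A \<inter> cell lab u" lab u t]] by simp

lemma net_content_cell_children:
  assumes "finite (lab (Suc k) ` A)"
  shows "enn2real (net_content lab t (A \<inter> cell lab (k, l)))
    \<le> (\<Sum>l'\<in>{l'\<in>lab (Suc k) ` A. par l' = l}. enn2real (net_content lab t (A \<inter> cell lab (Suc k, l'))))"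
proof -
  let ?C = "{l'\<in>lab (Suc k) ` A. par l' = l}"
  have fin: "finite ?C" using assms by simp
  have "A \<inter> cell lab (k, l) \<subseteq> (\<Union>l'\<in>?C. A \<inter> cell lab (Suc k, l'))"
    using lab_par[of k] by (auto simp: mem_cell_iff)
  then have "net_content lab t (A \<inter> cell lab (k, l)) \<le> (\<Sum>l'\<in>?C. net_content lab t (A \<inter> cell lab (Suc k, l')))"
    using net_content_finite_UN_le[OF fin] net_content_mono order_trans by blast
  then have "enn2real (net_content lab t (A \<inter> cell lab (k, l)))
      \<le> enn2real (\<Sum>l'\<in>?C. net_content lab t (A \<inter> cell lab (Suc k, l')))"
    by (rule enn2real_mono) (simp add: fin net_content_cell_finite)
  also have "\<dots> = (\<Sum>l'\<in>?C. enn2real (net_content lab t (A \<inter> cell lab (Suc k, l'))))"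
    by (subst enn2real_sum) (simp_all add: net_content_cell_finite o_def)
  finally show ?thesis .
qed

lemma mass_nonneg: "0 \<le> mass t A k l"
  by (induction k arbitrary: l) (auto intro!: divide_nonneg_nonneg sum_nonneg)

text \<open>The parent's mass is at most its content, which is at most the sum of the contents of
  its children; so every child receives at most its own content.\<close>

lemma mass_le_net_content:
  assumes fin: "\<And>k. finite (lab k ` A)"
  shows "mass t A k l \<le> enn2real (net_content lab t (A \<inter> cell lab (k, l)))"
proof (induction k arbitrary: l)
  case (Suc k)
  let ?S = "\<Sum>l'\<in>{l'\<in>lab (Suc k) ` A. par l' = par l}. enn2real (net_content lab t (A \<inter> cell lab (Suc k, l')))"
  let ?c = "enn2real (net_content lab t (A \<inter> cell lab (Suc k, l)))"
  have "mass t A k (par l) \<le> ?S"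
    using Suc[of "par l"] net_content_cell_children[OF fin, where t=t and k=k and l="par l"] by linarith
  then have "mass t A k (par l) * ?c / ?S \<le> ?S * ?c / ?S"
    by (intro divide_right_mono mult_right_mono sum_nonneg) auto
  also have "\<dots> \<le> ?c" by simp
  finally have "mass t A k (par l) * ?c / ?S \<le> ?c" .
  then show ?case by simp
qed simp

lemma mass_le:
  assumes "\<And>k. finite (lab k ` A)"
  shows "mass t A k l \<le> (1/2) powr (t * real k)"
  using mass_le_net_content[OF assms, where t=t and k=k and l=l] enn2real_net_content_cell_le[of t A "(k, l)"] by simp

lemma mass_children:
  assumes fin: "\<And>k. finite (lab k ` A)"
  shows "(\<Sum>l'\<in>{l'\<in>lab (Suc k) ` A. par l' = l}. mass t A (Suc k) l') = mass t A k l"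
proof -
  let ?C = "{l'\<in>lab (Suc k) ` A. par l' = l}"
  let ?c = "\<lambda>l'. enn2real (net_content lab t (A \<inter> cell lab (Suc k, l')))"
  have "(\<Sum>l'\<in>?C. mass t A (Suc k) l') = (\<Sum>l'\<in>?C. mass t A k l * ?c l' / (\<Sum>l'\<in>?C. ?c l'))"
    by (rule sum.cong) auto
  also have "\<dots> = mass t A k l * (\<Sum>l'\<in>?C. ?c l') / (\<Sum>l'\<in>?C. ?c l')"
    by (simp add: sum_distrib_left sum_divide_distrib)
  also have "\<dots> = mass t A k l"
  \<comment> \<open>When all children have content 0, division by zero yields 0 on the left; the
    parent's mass is then 0 as well, since it is at most the sum of those contents.\<close>
  proof (cases "(\<Sum>l'\<in>?C. ?c l') = 0")
    case True
    then have "mass t A k l = 0"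
      using mass_le_net_content[OF fin, where t=t and k=k and l=l] net_content_cell_children[OF fin, where t=t and k=k and l=l]
        mass_nonneg[of t A k l] by linarith
    then show ?thesis by simp
  qed simp
  finally show ?thesis .
qed

text \<open>Consistency of the masses across levels. P may contain labels that no point of A
  carries, hence the intersection on the right.\<close>

lemma mass_descendants:
  assumes fin: "\<And>k. finite (lab k ` A)" and "j \<le> k"
  shows "(\<Sum>l\<in>{l\<in>lab k ` A. (par ^^ (k - j)) l \<in> P}. mass t A k l) = (\<Sum>l\<in>P \<inter> lab j ` A. mass t A j l)"
  using \<open>j \<le> k\<close>
proof (induction rule: dec_induct)
  case base
  show ?case by (rule sum.cong) auto
next
  case (step k)
  let ?D = "{l\<in>lab k ` A. (par ^^ (k - j)) l \<in> P}"
  let ?D' = "{l\<in>lab (Suc k) ` A. (par ^^ (Suc k - j)) l \<in> P}"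
  have "(\<Sum>l\<in>?D. mass t A k l) = (\<Sum>l\<in>?D. \<Sum>l'\<in>{l'\<in>lab (Suc k) ` A. par l' = l}. mass t A (Suc k) l')"
    using mass_children[OF fin] by simp
  also have "\<dots> = (\<Sum>l\<in>?D. \<Sum>l'\<in>{l'\<in>?D'. par l' = l}. mass t A (Suc k) l')"
    using step.hyps by (intro sum.cong) (auto simp: Suc_diff_le funpow_swap1)
  also have "\<dots> = (\<Sum>l'\<in>?D'. mass t A (Suc k) l')"
  proof (rule sum.group)
    show "finite ?D'" "finite ?D" using fin by auto
    show "par ` ?D' \<subseteq> ?D" using step.hyps lab_par[of k] by (auto simp: Suc_diff_le funpow_swap1)
  qed
  finally show ?case using step.IH by simp
qed

lemma mass_total:
  assumes fin: "\<And>k. finite (lab k ` A)"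
  shows "net_content lab t A \<le> ennreal (\<Sum>l\<in>lab 0 ` A. mass t A 0 l)"
proof -
  have "A \<subseteq> (\<Union>l\<in>lab 0 ` A. A \<inter> cell lab (0, l))" by (auto simp: mem_cell_iff)
  then have "net_content lab t A \<le> (\<Sum>l\<in>lab 0 ` A. net_content lab t (A \<inter> cell lab (0, l)))"
    using net_content_finite_UN_le[OF fin] net_content_mono order_trans by blast
  also have "\<dots> = ennreal (\<Sum>l\<in>lab 0 ` A. mass t A 0 l)"
    by (simp add: net_content_cell_finite flip: sum_ennreal)
  finally show ?thesis .
qed

text \<open>The masses of level K are placed at one point of A in each occupied cell. By consistency
  every cell of a coarser level then carries exactly its own mass, which gives all bounds up to
  level K at once.\<close>

lemma discrete_frostman:
  assumes fin: "\<And>k. finite (lab k ` A)"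
  shows "\<exists>F \<tau>. finite F \<and> F \<subseteq> A \<and> (\<forall>x. 0 \<le> \<tau> x) \<and> net_content lab t A \<le> ennreal (\<Sum>x\<in>F. \<tau> x)
    \<and> (\<forall>j\<le>K. \<forall>l. (\<Sum>x\<in>{x\<in>F. lab j x = l}. \<tau> x) \<le> (1/2) powr (t * real j))"
proof -
  define p where "p l = (SOME x. x \<in> A \<and> lab K x = l)" for l
  have p: "p l \<in> A" "lab K (p l) = l" if "l \<in> lab K ` A" for l
    using someI_ex[of "\<lambda>x. x \<in> A \<and> lab K x = l"] that unfolding p_def by auto
  define F where "F = p ` (lab K ` A)"
  define \<tau> where "\<tau> x = mass t A K (lab K x)" for x
  have inj: "inj_on p (lab K ` A)" by (metis inj_onI p(2))
  have sum: "(\<Sum>x\<in>{x\<in>F. lab j x \<in> P}. \<tau> x) = (\<Sum>l\<in>P \<inter> lab j ` A. mass t A j l)" if "j \<le> K" for j P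
  proof -
    have anc: "(par ^^ (K - j)) l = lab j (p l)" if "l \<in> lab K ` A" for l
      using lab_funpow[OF \<open>j \<le> K\<close>, of "p l"] p[OF that] by simp
    have "{x\<in>F. lab j x \<in> P} = p ` {l\<in>lab K ` A. (par ^^ (K - j)) l \<in> P}"
      using anc unfolding F_def by auto
    also have "(\<Sum>x\<in>\<dots>. \<tau> x) = (\<Sum>l\<in>{l\<in>lab K ` A. (par ^^ (K - j)) l \<in> P}. mass t A K l)"
    proof (subst sum.reindex)
      show "inj_on p {l \<in> lab K ` A. (par ^^ (K - j)) l \<in> P}" using inj by (rule inj_on_subset) auto
      show "sum (\<tau> \<circ> p) {l \<in> lab K ` A. (par ^^ (K - j)) l \<in> P} =
          sum (mass t A K) {l \<in> lab K ` A. (par ^^ (K - j)) l \<in> P}"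
        by (rule sum.cong) (auto simp: \<tau>_def p(2))
    qed
    finally show ?thesis using mass_descendants[OF fin that] by simp
  qed
  show ?thesis
  proof (intro exI[of _ F] exI[of _ \<tau>] conjI allI impI)
    show "finite F" "F \<subseteq> A" using fin p unfolding F_def by auto
    show "0 \<le> \<tau> x" for x by (simp add: \<tau>_def mass_nonneg)
    have "(\<Sum>x\<in>F. \<tau> x) = (\<Sum>l\<in>lab 0 ` A. mass t A 0 l)" using sum[of 0 UNIV] by simp
    then show "net_content lab t A \<le> ennreal (\<Sum>x\<in>F. \<tau> x)" using mass_total[OF fin] by simp
    fix j l assume j: "j \<le> K"
    have "(\<Sum>x\<in>{x\<in>F. lab j x = l}. \<tau> x) = (\<Sum>l\<in>{l} \<inter> lab j ` A. mass t A j l)" using sum[OF j, of "{l}"] by simp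
    also have "\<dots> \<le> (\<Sum>l\<in>{l}. mass t A j l)"
      by (rule sum_mono2) (auto simp: mass_nonneg)
    also have "\<dots> \<le> (1/2) powr (t * real j)" using mass_le[OF fin] by simp
    finally show "(\<Sum>x\<in>{x\<in>F. lab j x = l}. \<tau> x) \<le> (1/2) powr (t * real j)" .
  qed
qed

end

section \<open>Null content forces null Hausdorff measure\<close>

lemma half_powr_eq: "((1/2)::real) powr (t * real k) = ((1/2)^k) powr t"
  by (simp add: powr_powr mult.commute flip: powr_realpow)

lemma dyadic_scale:
  fixes x :: real
  assumes "0 < x" "x \<le> 1"
  obtains k where "x \<le> (1/2)^k" "(1/2)^k < 2 * x"
proof -
  obtain N where N: "(1/2::real)^N < x" using real_arch_pow_inv[OF assms(1), of "1/2"] by auto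
  define K where "K = (LEAST N. (1/2::real)^N < x)"
  have K: "(1/2::real)^K < x" unfolding K_def using N by (rule LeastI)
  then have "K \<noteq> 0" using assms by (intro notI) simp
  then obtain k where k: "K = Suc k" by (cases K) auto
  have "\<not> (1/2::real)^k < x" using not_less_Least[of k "\<lambda>N. (1/2::real)^N < x"] k K_def by simp
  then show ?thesis using that[of k] K k by simp
qed

lemma ediameter_le:
  assumes "\<And>x y. x \<in> U \<Longrightarrow> y \<in> U \<Longrightarrow> d x y \<le> c"
  shows "ediameter d U \<le> ennreal c"
  unfolding ediameter_def by (intro SUP_least ennreal_leI assms)

lemma diam_powr_le:
  assumes "ediameter d U \<le> ennreal c" "0 \<le> c" "0 < t"
  shows "diam_powr d t U \<le> ennreal (c powr t)"
proof -
  have "enn2real (ediameter d U) \<le> c"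
    using enn2real_mono[OF assms(1)] assms(2) by simp
  then show ?thesis using assms unfolding diam_powr_def by (auto intro!: ennreal_leI powr_mono2)
qed

lemma ediameter_empty [simp]: "ediameter d {} = 0"
  by (simp add: ediameter_def bot_ennreal)

text \<open>In a cover of small total cost each single cell is cheap, hence of high level and small
  diameter. So the mesh condition in the Hausdorff measure is met automatically.\<close>

lemma hausdorff_measure_eq_0_of_net_content:
  fixes lab :: "nat \<Rightarrow> 'a \<Rightarrow> 'l::countable"
  assumes null: "net_content lab t S = 0" and t: "0 < t"
    and diam: "\<And>k x y. x \<in> S \<Longrightarrow> y \<in> S \<Longrightarrow> lab k x = lab k y \<Longrightarrow> d x y \<le> C * (1/2)^k"
  shows "hausdorff_measure d t S = 0"
proof -
  define D where "D = max C 1"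
  have D: "D > 0" "C \<le> D" by (auto simp: D_def)
  have diam: "d x y \<le> D * (1/2)^k" if "x \<in> S" "y \<in> S" "lab k x = lab k y" for k x y
    using diam[OF that] D by (meson mult_right_mono order_trans zero_le_divide_1_iff zero_le_numeral zero_le_power)
  have "hausdorff_premeasure d t \<delta> S \<le> 0 + ennreal \<epsilon>" if "0 < \<delta>" "0 < \<epsilon>" for \<delta> \<epsilon> :: real
  proof -
    \<comment> \<open>The first bound makes the final sum at most \<open>\<epsilon>\<close>; the
      second forces every cell of the cover to have diameter at most \<open>\<delta>\<close> on
      S.\<close>
    define \<eta> where "\<eta> = min (\<epsilon> / D powr t) ((\<delta> / D) powr t)"
    have \<eta>: "\<eta> > 0" using that D by (auto simp: \<eta>_def)
    then have "net_content lab t S < ennreal \<eta>" using null by simp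
    then obtain \<U> where U: "S \<subseteq> (\<Union>u\<in>\<U>. cell lab u)" "emeasure (cell_measure t) \<U> < ennreal \<eta>"
      by (rule net_content_lessE)
    have small: "D * (1/2)^fst u \<le> \<delta>" if "u \<in> \<U>" for u
    proof -
      have "ennreal ((1/2) powr (t * real (fst u))) < ennreal \<eta>"
        using emeasure_cell_measure_ge[OF that, of t] U(2) by order
      then have "((1/2)^fst u) powr t < \<eta>" by (simp add: ennreal_less_iff half_powr_eq)
      then have "((1/2)^fst u) powr t < (\<delta> / D) powr t" by (simp add: \<eta>_def)
      then have "(1/2)^fst u < \<delta> / D"
        using powr_mono2[of t "\<delta>/D" "(1/2)^fst u"] t D \<open>0 < \<delta>\<close> by (meson divide_pos_pos less_imp_le not_less)
      then show ?thesis using D by (simp add: field_simps)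
    qed
    define V where "V i = (if i \<in> to_nat ` \<U> then S \<inter> cell lab (from_nat i) else {})" for i
    have ed: "ediameter d (V (to_nat u)) \<le> ennreal (D * (1/2)^fst u)" if "u \<in> \<U>" for u
      using that diam by (intro ediameter_le) (auto simp: V_def mem_cell_iff split: if_splits)
    have "S \<subseteq> (\<Union>i. V i)"
    proof
      fix x assume "x \<in> S"
      then obtain u where "u \<in> \<U>" "x \<in> cell lab u" using U by blast
      then have "x \<in> V (to_nat u)" using \<open>x \<in> S\<close> by (auto simp: V_def)
      then show "x \<in> (\<Union>i. V i)" by blast
    qed
    moreover have "ediameter d (V i) \<le> ennreal \<delta>" for i
    proof (cases "i \<in> to_nat ` \<U>")
      case True
      then obtain u where "u \<in> \<U>" "i = to_nat u" by blast
      then show ?thesis using ed small by (meson ennreal_leI order_trans)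
    qed (simp add: V_def)
    ultimately have "hausdorff_premeasure d t \<delta> S \<le> (\<Sum>i. diam_powr d t (V i))"
      unfolding hausdorff_premeasure_def by (intro INF_lower) simp
    also have "\<dots> = (\<integral>\<^sup>+i. diam_powr d t (V i) \<partial>count_space UNIV)"
      by (rule nn_integral_count_space_nat[symmetric])
    also have "\<dots> = (\<integral>\<^sup>+i. diam_powr d t (V i) \<partial>count_space (to_nat ` \<U>))"
      by (rule nn_integral_count_space_eq) (auto simp: V_def diam_powr_def)
    also have "\<dots> = (\<integral>\<^sup>+u. diam_powr d t (V (to_nat u)) \<partial>count_space \<U>)"
      by (rule nn_integral_bij_count_space[symmetric]) (auto simp: bij_betw_def inj_on_def)
    also have "\<dots> \<le> (\<integral>\<^sup>+u. ennreal (D powr t) * ennreal ((1/2) powr (t * real (fst u))) \<partial>count_space \<U>)"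
    proof (rule nn_integral_mono)
      fix u assume "u \<in> space (count_space \<U>)"
      then have "diam_powr d t (V (to_nat u)) \<le> ennreal ((D * (1/2)^fst u) powr t)"
        using ed D t by (intro diam_powr_le) auto
      also have "(D * (1/2)^fst u) powr t = D powr t * (1/2) powr (t * real (fst u))"
        using D by (simp add: powr_mult half_powr_eq)
      finally show "diam_powr d t (V (to_nat u)) \<le> ennreal (D powr t) * ennreal ((1/2) powr (t * real (fst u)))"
        by (simp add: ennreal_mult)
    qed
    also have "\<dots> = ennreal (D powr t) * (\<integral>\<^sup>+u. ennreal ((1/2) powr (t * real (fst u))) \<partial>count_space \<U>)"
      by (rule nn_integral_cmult) simp
    also have "(\<integral>\<^sup>+u. ennreal ((1/2) powr (t * real (fst u))) \<partial>count_space \<U>) = emeasure (cell_measure t) \<U>"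
      by (rule emeasure_cell_measure_eq[symmetric])
    also have "ennreal (D powr t) * emeasure (cell_measure t) \<U> \<le> ennreal (D powr t) * ennreal \<eta>"
      using U(2) by (intro mult_left_mono) auto
    also have "\<dots> = ennreal (D powr t * \<eta>)" by (simp add: ennreal_mult \<eta> less_imp_le)
    also have "\<dots> \<le> ennreal \<epsilon>"
      using D by (intro ennreal_leI) (simp add: \<eta>_def min_def field_simps)
    finally show ?thesis by simp
  qed
  then have "hausdorff_premeasure d t \<delta> S \<le> 0" if "0 < \<delta>" for \<delta>
    using that ennreal_le_epsilon[of 0 "hausdorff_premeasure d t \<delta> S"] by blast
  then show ?thesis unfolding hausdorff_measure_def
    by (metis (no_types, lifting) SUP_least greaterThan_iff le_zero_eq)
qed

lemma hausdorff_dim_le: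
  assumes "0 \<le> t" "hausdorff_measure d t S = 0"
  shows "hausdorff_dim d S \<le> ereal t"
  unfolding hausdorff_dim_def by (rule INF_lower) (use assms in auto)

section \<open>Dyadic cubes of Euclidean space\<close>

definition dyadic :: "nat \<Rightarrow> real ^ 'n \<Rightarrow> 'n \<Rightarrow> int" where
  "dyadic k x i = \<lfloor>2^k * x $ i\<rfloor>"

lemma floor_half: "\<lfloor>2^k * (b::real)\<rfloor> = \<lfloor>2^Suc k * b\<rfloor> div 2"
proof -
  have "\<lfloor>2^Suc k * b / of_int 2\<rfloor> = \<lfloor>2^Suc k * b\<rfloor> div 2" by (rule floor_divide_real_eq_div) simp
  then show ?thesis by simp
qed

interpretation dyadic: nested_labels dyadic "\<lambda>l i. l i div 2"
  by unfold_locales (auto simp: dyadic_def fun_eq_iff floor_half)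

lemma net_content_dyadic_box:
  fixes U :: "(real ^ 'n) set"
  assumes "\<And>x i. x \<in> U \<Longrightarrow> a i \<le> dyadic k x i \<and> dyadic k x i \<le> a i + int p"
  shows "net_content dyadic t U \<le> ennreal (real ((p+1) ^ CARD('n)) * (1/2) powr (t * real k))"
proof -
  let ?L = "PiE UNIV (\<lambda>i. {a i..a i + int p})"
  have fin: "finite ?L" by (intro finite_PiE) auto
  have "U \<subseteq> (\<Union>u\<in>{k} \<times> ?L. cell dyadic u)"
    using assms by (auto simp: mem_cell_iff PiE_iff)
  then have "net_content dyadic t U \<le> emeasure (cell_measure t) ({k} \<times> ?L)" by (rule net_content_le)
  also have "\<dots> = ennreal (\<Sum>u\<in>{k} \<times> ?L. (1/2) powr (t * real (fst u)))"
    by (rule emeasure_cell_measure_finite) (use fin in auto)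
  also have "(\<Sum>u\<in>{k} \<times> ?L. (1/2) powr (t * real (fst u))) = (\<Sum>u\<in>{k} \<times> ?L. (1/2) powr (t * real k))"
    by (rule sum.cong) auto
  also have "\<dots> = real (card ?L) * (1/2) powr (t * real k)"
    by (simp add: card_cartesian_product_singleton)
  also have "card ?L = (p+1) ^ CARD('n)"
    by (subst card_PiE) (auto simp: nat_add_distrib)
  finally show ?thesis by simp
qed

lemma dyadic_close:
  fixes x y :: "real ^ 'n"
  assumes "dist x y \<le> (1/2)^k"
  shows "\<bar>dyadic k x i - dyadic k y i\<bar> \<le> 1"
proof -
  have "\<bar>x $ i - y $ i\<bar> \<le> (1/2)^k"
    using component_le_norm_cart[of "x - y" i] assms by (simp add: dist_norm)
  then have "2^k * \<bar>x $ i - y $ i\<bar> \<le> 2^k * (1/2)^k" by (rule mult_left_mono) simp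
  then have "\<bar>2^k * x $ i - 2^k * y $ i\<bar> \<le> 1"
    by (simp add: abs_mult power_one_over flip: right_diff_distrib)
  then show ?thesis unfolding dyadic_def by linarith
qed

lemma dyadic_eq_dist:
  fixes x y :: "real ^ 'n"
  assumes "\<And>i. \<bar>2^k * x $ i - 2^k * y $ i\<bar> \<le> c"
  shows "norm (x - y) \<le> real CARD('n) * c * (1/2)^k"
proof -
  have "\<bar>(x - y) $ i\<bar> \<le> c * (1/2)^k" for i
  proof -
    have "2^k * \<bar>(x - y) $ i\<bar> \<le> c" using assms[of i] by (simp add: abs_mult flip: right_diff_distrib)
    then show ?thesis by (simp add: field_simps power_one_over)
  qed
  then have "(\<Sum>i\<in>UNIV. \<bar>(x - y) $ i\<bar>) \<le> (\<Sum>i\<in>(UNIV::'n set). c * (1/2)^k)" by (rule sum_mono)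
  then show ?thesis using norm_le_l1_cart[of "x - y"] by simp
qed

lemma finite_dyadic_bounded:
  fixes A :: "(real ^ 'n) set"
  assumes "bounded A"
  shows "finite (dyadic k ` A)"
proof -
  obtain B where B: "\<And>x. x \<in> A \<Longrightarrow> norm x \<le> B" using assms by (auto simp: bounded_iff)
  have "dyadic k ` A \<subseteq> PiE UNIV (\<lambda>i. {\<lfloor>- (2^k * B)\<rfloor>..\<lfloor>2^k * B\<rfloor>})"
  proof
    fix l assume "l \<in> dyadic k ` A"
    then obtain x where x: "x \<in> A" "l = dyadic k x" by blast
    have "\<bar>x $ i\<bar> \<le> B" for i using component_le_norm_cart[of x i] B[OF x(1)] by linarith
    then have "2^k * (- B) \<le> 2^k * x $ i" "2^k * x $ i \<le> 2^k * B" for i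
      by (intro mult_left_mono; simp add: abs_le_iff minus_le_iff)+
    then show "l \<in> PiE UNIV (\<lambda>i. {\<lfloor>- (2^k * B)\<rfloor>..\<lfloor>2^k * B\<rfloor>})"
      unfolding x(2) by (auto simp: dyadic_def intro!: floor_mono)
  qed
  then show ?thesis by (rule finite_subset) (intro finite_PiE; simp)
qed

text \<open>A set of diameter at most 2^-k meets at most 3^n cubes of level k. With 2^-k within a
  factor 2 of the diameter, this replaces arbitrary covers by cubes at bounded cost.\<close>

lemma net_content_dyadic_eq_0_of_hausdorff_measure:
  fixes S :: "(real ^ 'n) set"
  assumes null: "hausdorff_measure dist t S = 0" and t: "0 \<le> t"
  shows "net_content dyadic t S = 0"
proof -
  let ?c = "real (3 ^ CARD('n))"
  have "net_content dyadic t S \<le> 0 + ennreal \<epsilon>" if "0 < \<epsilon>" for \<epsilon> :: real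
  proof -
    define \<eta> where "\<eta> = \<epsilon> / (?c * (2 powr t + 1))"
    have \<eta>: "\<eta> > 0" using that by (auto simp: \<eta>_def intro!: divide_pos_pos mult_pos_pos add_pos_pos)
    \<comment> \<open>Mesh 1 is the right choice, because it guarantees that a suitable level k >= 0
      exists for each set of the cover.\<close>
    have "hausdorff_premeasure dist t 1 S \<le> hausdorff_measure dist t S"
      unfolding hausdorff_measure_def by (rule SUP_upper) simp
    then have "hausdorff_premeasure dist t 1 S < ennreal \<eta>" using null \<eta> by simp
    then obtain U where U: "S \<subseteq> (\<Union>i. U i)" "\<And>i. ediameter dist (U i) \<le> ennreal 1"
        "(\<Sum>i. diam_powr dist t (U i)) < ennreal \<eta>"
      unfolding hausdorff_premeasure_def INF_less_iff by auto
    \<comment> \<open>The summable extra term pays for sets of diameter 0: for t > 0 their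
      \<open>diam_powr\<close> is 0, whereas every cube around them has positive cost.\<close>
    have *: "net_content dyadic t (U i) \<le> ennreal ?c * (ennreal (2 powr t) * diam_powr dist t (U i) + ennreal (\<eta> * (1/2)^Suc i))"
      for i
    proof (cases "U i = {}")
      case False
      define D where "D = enn2real (ediameter dist (U i))"
      have D: "ediameter dist (U i) = ennreal D" "0 \<le> D" "D \<le> 1"
        using le_less_trans[OF U(2)[of i], of top] enn2real_mono[OF U(2)[of i]] unfolding D_def
        by auto
      obtain k where k: "D \<le> (1/2)^k" "(1/2) powr (t * real k) \<le> 2 powr t * (if t = 0 then 1 else D powr t) + \<eta> * (1/2)^Suc i"
      proof (cases "t = 0")
        case True
        then show ?thesis using that[of 0] D \<eta> by simp
      next
        case False
        show ?thesis
        proof (cases "D = 0")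
          case True
          have "\<eta> * (1/2)^Suc i > 0" using \<eta> by simp
          moreover have "(1/2) powr t < (1::real)"
            using powr_less_mono2[of t "1/2" 1] False t by simp
          ultimately obtain k where "((1/2) powr t)^k < \<eta> * (1/2)^Suc i"
            using real_arch_pow_inv by blast
          moreover have "((1/2::real) powr t)^k = (1/2) powr (t * real k)"
            by (simp add: powr_powr flip: powr_realpow)
          ultimately show ?thesis using that[of k] True False by simp
        next
          case D0: False
          obtain k where k: "D \<le> (1/2)^k" "(1/2)^k < 2 * D" using dyadic_scale[of D] D D0 by auto
          have "(1/2) powr (t * real k) \<le> (2 * D) powr t"
            unfolding half_powr_eq using k t D by (intro powr_mono2) auto
          also have "\<dots> = 2 powr t * D powr t" using D by (simp add: powr_mult)
          finally show ?thesis using that[of k] k False \<eta> by (simp add: add_increasing2)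
        qed
      qed
      have diam: "dist x y \<le> (1/2)^k" if "x \<in> U i" "y \<in> U i" for x y
      proof -
        have "ennreal (dist x y) \<le> ediameter dist (U i)"
          unfolding ediameter_def by (rule SUP_upper2[OF that(1)], rule SUP_upper2[OF that(2)]) simp
        then show ?thesis using D k by (simp add: ennreal_le_iff)
      qed
      obtain x0 where x0: "x0 \<in> U i" using False by blast
      have "net_content dyadic t (U i) \<le> ennreal (real ((2+1) ^ CARD('n)) * (1/2) powr (t * real k))"
      proof (rule net_content_dyadic_box[where a = "\<lambda>i. dyadic k x0 i - 1"])
        fix x j assume "x \<in> U i"
        from dyadic_close[OF diam[OF this x0], of j]
        show "dyadic k x0 j - 1 \<le> dyadic k x j \<and> dyadic k x j \<le> dyadic k x0 j - 1 + int 2" by linarith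
      qed
      also have "\<dots> \<le> ennreal (?c * (2 powr t * (if t = 0 then 1 else D powr t) + \<eta> * (1/2)^Suc i))"
        using k(2) by (intro ennreal_leI) (auto intro!: mult_left_mono)
      also have "\<dots> = ennreal ?c * (ennreal (2 powr t) * diam_powr dist t (U i) + ennreal (\<eta> * (1/2)^Suc i))"
        using False \<eta> unfolding diam_powr_def D_def[symmetric]
        by (simp add: ennreal_mult ennreal_plus)
      finally show ?thesis .
    qed auto
    have half: "(\<Sum>i. ennreal (\<eta> * (1/2)^Suc i)) = ennreal \<eta>"
      using power_half_series \<eta> by (intro suminf_ennreal_eq) (auto dest: sums_mult[of _ _ \<eta>])
    have "net_content dyadic t S \<le> (\<Sum>i. net_content dyadic t (U i))"
      using net_content_mono[OF U(1)] net_content_UN_le order_trans by blast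
    also have "\<dots> \<le> (\<Sum>i. ennreal ?c * (ennreal (2 powr t) * diam_powr dist t (U i) + ennreal (\<eta> * (1/2)^Suc i)))"
      by (rule suminf_le) (use * in auto)
    also have "\<dots> = ennreal ?c * (\<Sum>i. ennreal (2 powr t) * diam_powr dist t (U i) + ennreal (\<eta> * (1/2)^Suc i))"
      by (rule ennreal_suminf_cmult)
    also have "(\<Sum>i. ennreal (2 powr t) * diam_powr dist t (U i) + ennreal (\<eta> * (1/2)^Suc i))
        = ennreal (2 powr t) * (\<Sum>i. diam_powr dist t (U i)) + ennreal \<eta>"
      unfolding half[symmetric] ennreal_suminf_cmult[symmetric] by (rule suminf_add[symmetric]) auto
    also have "\<dots> \<le> ennreal (2 powr t) * ennreal \<eta> + ennreal \<eta>"
      using U(3) by (intro add_mono mult_left_mono) auto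
    also have "\<dots> = ennreal ((2 powr t + 1) * \<eta>)"
      using \<eta> by (simp add: ennreal_mult ennreal_plus distrib_right)
    also have "ennreal ?c * ennreal ((2 powr t + 1) * \<eta>) = ennreal (?c * ((2 powr t + 1) * \<eta>))"
      using \<eta> by (simp add: ennreal_mult)
    also have "?c * ((2 powr t + 1) * \<eta>) = \<epsilon>"
      using add_pos_pos[of "2 powr t" 1] by (simp add: \<eta>_def)
    finally show ?thesis by (simp add: mult_left_mono)
  qed
  then show ?thesis using ennreal_le_epsilon[of 0 "net_content dyadic t S"] by auto
qed

section \<open>Frames and labels on the Grassmannian\<close>

lemma orth_proj_inner:
  assumes "subspace V" "v \<in> V"
  shows "v \<bullet> x = v \<bullet> orth_proj V x"
proof -
  have "orthogonal v (x - orth_proj V x)"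
    using orth_proj_works(2)[OF assms(1), of x] assms(2) by (auto simp: orthogonal_comp_def orthogonal_commute)
  then show ?thesis by (simp add: orthogonal_def inner_diff_right)
qed

lemma orth_proj_self_adjoint:
  assumes "subspace V"
  shows "orth_proj V x \<bullet> y = x \<bullet> orth_proj V y"
  using orth_proj_inner[OF assms, of "orth_proj V x" y] orth_proj_inner[OF assms, of "orth_proj V y" x]
    orth_proj_works(1)[OF assms] by (simp add: inner_commute)

lemma norm_minus_orth_proj_le:
  assumes "subspace V" "y \<in> V"
  shows "norm (x - orth_proj V x) \<le> norm (x - y)"
proof -
  have "orth_proj V x - y \<in> V" using assms orth_proj_works(1)[OF assms(1)] by (simp add: subspace_diff)
  then have "orthogonal (x - orth_proj V x) (orth_proj V x - y)"
    using orth_proj_works(2)[OF assms(1), of x] by (auto simp: orthogonal_comp_def orthogonal_commute)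
  from norm_add_Pythagorean[OF this]
  have "(norm (x - y))\<^sup>2 = (norm (x - orth_proj V x))\<^sup>2 + (norm (orth_proj V x - y))\<^sup>2" by simp
  then have "(norm (x - orth_proj V x))\<^sup>2 \<le> (norm (x - y))\<^sup>2" by simp
  then show ?thesis by (rule power2_le_imp_le) simp
qed

lemma norm_orth_proj_le:
  assumes "subspace V"
  shows "norm (orth_proj V x) \<le> norm x"
proof -
  have "(norm (orth_proj V x))\<^sup>2 = orth_proj V x \<bullet> x"
    using orth_proj_inner[OF assms orth_proj_works(1)[OF assms], of x x] by (simp add: power2_norm_eq_inner)
  also have "\<dots> \<le> norm (orth_proj V x) * norm x" by (rule norm_cauchy_schwarz)
  finally show ?thesis by (cases "orth_proj V x = 0") (auto simp: power2_eq_square)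
qed

text \<open>Write P and Q for the projections onto V and W. Then P - Q = (1 - Q)P - Q(1 - P). The
  first term is controlled by \<open>VW\<close>; the second is the adjoint of (1 - P)Q and is
  controlled by \<open>WV\<close>.\<close>

lemma grassmann_dist_le:
  fixes V W :: "'a::euclidean_space set"
  assumes V: "subspace V" and W: "subspace W"
    and VW: "\<And>x. x \<in> V \<Longrightarrow> norm (x - orth_proj W x) \<le> c * norm x"
    and WV: "\<And>x. x \<in> W \<Longrightarrow> norm (x - orth_proj V x) \<le> c * norm x"
    and c: "0 \<le> c"
  shows "grassmann_dist V W \<le> 2 * c"
  unfolding grassmann_dist_def
proof (rule onorm_le)
  fix x
  let ?y = "orth_proj W (x - orth_proj V x)"
  have lin: "linear (orth_proj W)" by (rule linear_orth_proj[OF W])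
  have "norm (orth_proj V x - orth_proj W (orth_proj V x)) \<le> c * norm (orth_proj V x)"
    by (intro VW orth_proj_works V)
  also have "\<dots> \<le> c * norm x" by (intro mult_left_mono norm_orth_proj_le V c)
  finally have 1: "norm (orth_proj V x - orth_proj W (orth_proj V x)) \<le> c * norm x" .
  have y: "?y \<in> W" by (rule orth_proj_works(1)[OF W])
  have "(norm ?y)\<^sup>2 = ?y \<bullet> (x - orth_proj V x)"
    using orth_proj_inner[OF W y, of "x - orth_proj V x"] by (simp add: power2_norm_eq_inner)
  also have "\<dots> = (?y - orth_proj V ?y) \<bullet> x"
    by (simp add: inner_diff_right inner_diff_left orth_proj_self_adjoint[OF V])
  also have "\<dots> \<le> norm (?y - orth_proj V ?y) * norm x" by (rule norm_cauchy_schwarz)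
  also have "\<dots> \<le> c * norm ?y * norm x" by (intro mult_right_mono WV y) simp
  finally have "norm ?y * norm ?y \<le> norm ?y * (c * norm x)" by (simp add: power2_eq_square mult_ac)
  then have 2: "norm ?y \<le> c * norm x"
    using c by (cases "?y = 0") (auto simp del: mult.left_commute)
  have "orth_proj V x - orth_proj W x = (orth_proj V x - orth_proj W (orth_proj V x)) - ?y"
    by (simp add: linear_diff[OF lin])
  also have "norm \<dots> \<le> c * norm x + c * norm x"
    using norm_triangle_ineq4 1 2 by (rule order_trans[OF _ add_mono])
  finally show "norm (orth_proj V x - orth_proj W x) \<le> 2 * c * norm x" by simp
qed

text \<open>The recursion follows one elimination step: the new vector has entries at most 1 + m B
  and the old ones at most B, where B is the bound in dimension m.\<close>

primrec frame_bound :: "nat \<Rightarrow> real" where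
  "frame_bound 0 = 1"
| "frame_bound (Suc m) = 1 + (real m + 1) * frame_bound m"

text \<open>A reduced basis with pivot coordinates I: restricted to I it is the identity matrix, so
  the coefficients of x are simply its coordinates in I. Padding by 0 outside I makes every frame a
  full array of the same shape, ready to be labelled.\<close>

definition is_frame :: "(real ^ 'n) set \<Rightarrow> 'n set \<Rightarrow> ('n \<Rightarrow> real ^ 'n) \<Rightarrow> bool" where
  "is_frame V I v \<longleftrightarrow> card I = dim V \<and> (\<forall>i. i \<notin> I \<longrightarrow> v i = 0)
    \<and> (\<forall>i\<in>I. v i \<in> V \<and> (\<forall>a\<in>I. v i $ a = of_bool (a = i)) \<and> (\<forall>j. \<bar>v i $ j\<bar> \<le> frame_bound (dim V)))
    \<and> (\<forall>x\<in>V. x = (\<Sum>i\<in>I. x $ i *\<^sub>R v i))"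

lemma frame_bound_ge_1: "1 \<le> frame_bound m"
  by (induction m) (auto intro!: add_increasing2 mult_nonneg_nonneg)

text \<open>Gaussian elimination with complete pivoting.\<close>

lemma is_frame_exists:
  assumes "subspace (V :: (real ^ 'n) set)"
  shows "\<exists>I v. is_frame V I v"
  using assms
proof (induction "dim V" arbitrary: V)
  case 0
  then have "V = {0}" using subspace_0 by (auto simp: dim_eq_0)
  then have "is_frame V {} (\<lambda>_. 0)" by (simp add: is_frame_def)
  then show ?case by blast
next
  case (Suc m)
  obtain v where v: "v \<in> V" "v \<noteq> 0" using Suc.hyps(2) by (metis dim_eq_0 nat.distinct(1) singletonI subsetI)
  \<comment> \<open>The pivot is a coordinate of largest modulus, so that the normalised vector u
    has all entries in [-1, 1].\<close>
  obtain i where i: "\<And>j. \<bar>v $ j\<bar> \<le> \<bar>v $ i\<bar>"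
  proof -
    have "Max (range (\<lambda>j. \<bar>v $ j\<bar>)) \<in> range (\<lambda>j. \<bar>v $ j\<bar>)" by (rule Max_in) auto
    then obtain i where "Max (range (\<lambda>j. \<bar>v $ j\<bar>)) = \<bar>v $ i\<bar>" by (metis imageE)
    moreover have "\<bar>v $ j\<bar> \<le> Max (range (\<lambda>j. \<bar>v $ j\<bar>))" for j by (rule Max_ge) auto
    ultimately show ?thesis using that by metis
  qed
  have vi: "v $ i \<noteq> 0" using v(2) i by (auto simp: vec_eq_iff)
  define u where "u = (1 / v $ i) *\<^sub>R v"
  have u: "u \<in> V" "u $ i = 1" "\<And>j. \<bar>u $ j\<bar> \<le> 1"
    using v vi i Suc.prems by (auto simp: u_def subspace_scale abs_mult divide_le_eq)
  define V' where "V' = {x\<in>V. x $ i = 0}"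
  have V': "subspace V'" using Suc.prems unfolding V'_def subspace_def by auto
  have V_span: "span (insert u V') = V"
  proof
    show "span (insert u V') \<subseteq> V" by (rule span_minimal) (use u Suc.prems in \<open>auto simp: V'_def\<close>)
    show "V \<subseteq> span (insert u V')"
    proof
      fix x assume x: "x \<in> V"
      have "x - x $ i *\<^sub>R u \<in> V'"
        using x u Suc.prems by (auto simp: V'_def subspace_diff subspace_scale)
      then have "x $ i *\<^sub>R u + (x - x $ i *\<^sub>R u) \<in> span (insert u V')"
        by (intro span_add span_scale) (auto intro: span_base)
      then show "x \<in> span (insert u V')" by simp
    qed
  qed
  have "u \<notin> V'" using u(2) by (simp add: V'_def)
  then have "u \<notin> span V'" using V' by (metis span_eq_iff)
  then have dimV: "dim V = Suc (dim V')"
    using dim_insert[of u V'] dim_span[of "insert u V'"] unfolding V_span by simp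
  then have m: "m = dim V'" using Suc.hyps(2) by simp
  then obtain I w where w: "is_frame V' I w" using Suc.hyps(1) V' by blast
  have wV: "w a \<in> V" "w a $ i = 0" if "a \<in> I" for a using w that by (auto simp: is_frame_def V'_def)
  have wI: "w a $ b = of_bool (b = a)" if "a \<in> I" "b \<in> I" for a b using w that by (auto simp: is_frame_def)
  have wB: "\<bar>w a $ j\<bar> \<le> frame_bound m" if "a \<in> I" for a j using w that m by (auto simp: is_frame_def)
  have card: "card I = m" using w m by (auto simp: is_frame_def)
  have iI: "i \<notin> I" using wI[of i i] wV[of i] by auto
  \<comment> \<open>Clearing the coordinates I in u. The old vectors w a lie in V' and so already
    vanish at the new pivot i.\<close>
  define z where "z = u - (\<Sum>a\<in>I. u $ a *\<^sub>R w a)"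
  have zV: "z \<in> V" unfolding z_def by (intro subspace_diff subspace_sum subspace_scale u wV Suc.prems) 
  have zi: "z $ i = 1" using u wV by (simp add: z_def)
  have za: "z $ a = 0" if "a \<in> I" for a
  proof -
    have "(\<Sum>b\<in>I. u $ b * w b $ a) = (\<Sum>b\<in>I. if b = a then u $ a else 0)"
      by (rule sum.cong) (use wI that in auto)
    then show ?thesis using that by (simp add: z_def)
  qed
  have zB: "\<bar>z $ j\<bar> \<le> 1 + real m * frame_bound m" for j
  proof -
    have "\<bar>\<Sum>a\<in>I. u $ a * w a $ j\<bar> \<le> (\<Sum>a\<in>I. frame_bound m)"
    proof (rule order_trans[OF sum_abs sum_mono])
      fix a assume "a \<in> I"
      then have "\<bar>u $ a\<bar> * \<bar>w a $ j\<bar> \<le> 1 * frame_bound m"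
        by (intro mult_mono u wB) auto
      then show "\<bar>u $ a * w a $ j\<bar> \<le> frame_bound m" by (simp add: abs_mult)
    qed
    then show ?thesis using u(3)[of j] by (simp add: z_def card)
  qed
  have "is_frame V (insert i I) (w(i := z))"
    unfolding is_frame_def
  proof (intro conjI allI impI ballI)
    show "card (insert i I) = dim V" using iI card dimV m by simp
  next
    fix a assume "a \<notin> insert i I"
    then show "(w(i := z)) a = 0" using w by (auto simp: is_frame_def)
  next
    fix a assume "a \<in> insert i I"
    then show "(w(i := z)) a \<in> V" using zV wV by auto
  next
    fix a b assume "a \<in> insert i I" "b \<in> insert i I"
    then show "(w(i := z)) a $ b = of_bool (b = a)" using zi za wV wI iI by auto
  next
    fix a j assume a: "a \<in> insert i I"
    have B: "frame_bound (dim V) = 1 + real m * frame_bound m + frame_bound m"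
      using m dimV by (simp add: distrib_right)
    have "0 \<le> real m * frame_bound m" using frame_bound_ge_1[of m] by simp
    then show "\<bar>(w(i := z)) a $ j\<bar> \<le> frame_bound (dim V)"
      using a zB[of j] wB[of a j] frame_bound_ge_1[of m] unfolding B by (auto intro: order_trans)
  next
    fix x assume x: "x \<in> V"
    let ?y = "x - x $ i *\<^sub>R z"
    have "?y \<in> V'" using x zV zi Suc.prems by (auto simp: V'_def subspace_diff subspace_scale)
    then have "?y = (\<Sum>a\<in>I. ?y $ a *\<^sub>R w a)" using w unfolding is_frame_def by blast
    also have "\<dots> = (\<Sum>a\<in>I. x $ a *\<^sub>R (w(i := z)) a)"
      by (rule sum.cong) (use za iI in auto)
    finally have "x = (\<Sum>a\<in>I. x $ a *\<^sub>R (w(i := z)) a) + x $ i *\<^sub>R z"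
      by (simp only: diff_eq_eq)
    also have "\<dots> = (\<Sum>a\<in>insert i I. x $ a *\<^sub>R (w(i := z)) a)"
      using iI by simp
    finally show "x = (\<Sum>a\<in>insert i I. x $ a *\<^sub>R (w(i := z)) a)" .
  qed
  then show ?case by blast
qed

definition frame_index :: "(real ^ 'n) set \<Rightarrow> 'n set" where
  "frame_index V = (SOME I. \<exists>v. is_frame V I v)"

definition frame :: "(real ^ 'n) set \<Rightarrow> 'n \<Rightarrow> real ^ 'n" where
  "frame V = (SOME v. is_frame V (frame_index V) v)"

text \<open>The frame may jump as V varies. What matters is that equal labels give close subspaces
  and that the labels near-orthogonal to a vector can be counted.\<close>

definition grass_label :: "nat \<Rightarrow> (real ^ 'n) set \<Rightarrow> 'n \<times> 'n \<Rightarrow> int" where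
  "grass_label k V = (\<lambda>(i, j). \<lfloor>2^k * frame V i $ j\<rfloor>)"

interpretation grass: nested_labels grass_label "\<lambda>l p. l p div 2"
  by unfold_locales (auto simp: grass_label_def fun_eq_iff floor_half)

lemma is_frame_frame:
  assumes "subspace V"
  shows "is_frame V (frame_index V) (frame V)"
proof -
  have "\<exists>v. is_frame V (frame_index V) v"
    unfolding frame_index_def using is_frame_exists[OF assms] by (rule someI_ex)
  then show ?thesis unfolding frame_def by (rule someI_ex)
qed

context
  fixes V :: "(real ^ 'n) set" and m :: nat
  assumes V: "V \<in> grassmannian m"
begin

lemma subspace_grass: "subspace V"
  using V by (simp add: grassmannian_def)

lemma card_frame_index: "card (frame_index V) = m"
  using is_frame_frame[OF subspace_grass] V by (simp add: is_frame_def grassmannian_def)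

lemma frame_notin: "i \<notin> frame_index V \<Longrightarrow> frame V i = 0"
  using is_frame_frame[OF subspace_grass] by (simp add: is_frame_def)

lemma frame_in: "frame V i \<in> V"
  using is_frame_frame[OF subspace_grass] frame_notin[of i] subspace_grass
  by (cases "i \<in> frame_index V") (auto simp: is_frame_def subspace_0)

lemma frame_delta: "i \<in> frame_index V \<Longrightarrow> a \<in> frame_index V \<Longrightarrow> frame V i $ a = of_bool (a = i)"
  using is_frame_frame[OF subspace_grass] by (simp add: is_frame_def)

lemma frame_le: "\<bar>frame V i $ j\<bar> \<le> frame_bound m"
  using is_frame_frame[OF subspace_grass] V frame_notin[of i] frame_bound_ge_1[of m]
  by (cases "i \<in> frame_index V") (auto simp: is_frame_def grassmannian_def)

lemma frame_expand: "x \<in> V \<Longrightarrow> x = (\<Sum>i\<in>frame_index V. x $ i *\<^sub>R frame V i)"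
  using is_frame_frame[OF subspace_grass] unfolding is_frame_def by blast

text \<open>The diagonal entry of the frame is 1 on the index set and 0 off it, so the label at any
  level determines the index set.\<close>

lemma mem_frame_index_iff: "i \<in> frame_index V \<longleftrightarrow> grass_label k V (i, i) \<noteq> 0"
  using frame_notin[of i] frame_delta[of i i]
  by (cases "i \<in> frame_index V") (simp_all add: grass_label_def)

lemma grass_label_bounds: "grass_label k V p \<in> {- \<lceil>2^k * frame_bound m\<rceil>..\<lceil>2^k * frame_bound m\<rceil>}"
proof (cases p)
  case (Pair i j)
  have "\<bar>2^k * frame V i $ j\<bar> \<le> 2^k * frame_bound m"
    using frame_le[of i j] by (simp add: abs_mult)
  then show ?thesis unfolding Pair grass_label_def by (auto; linarith)
qed

end

lemma finite_grass_label: "finite (grass_label k ` (grassmannian m :: (real ^ 'n) set set))"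
proof (rule finite_subset)
  show "grass_label k ` grassmannian m \<subseteq> PiE UNIV (\<lambda>_. {- \<lceil>2^k * frame_bound m\<rceil>..\<lceil>2^k * frame_bound m\<rceil>})"
    by (intro image_subsetI PiE_I grass_label_bounds) auto
qed (intro finite_PiE; simp)

text \<open>Equal labels give the same pivots and frame vectors within n 2^-k of each other. Using
  the coefficients of x in V with the frame of W yields a point of W within n^2 2^-k |x| of x; the
  factor 2 comes from \<open>grassmann_dist_le\<close>.\<close>

lemma grass_label_eq_dist:
  fixes V W :: "(real ^ 'n) set"
  assumes V: "V \<in> grassmannian m" and W: "W \<in> grassmannian m" and eq: "grass_label k V = grass_label k W"
  shows "grassmann_dist V W \<le> 2 * (real CARD('n))\<^sup>2 * (1/2)^k"
proof -
  let ?c = "(real CARD('n))\<^sup>2 * (1/2)^k"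
  have I: "frame_index V = frame_index W"
    using mem_frame_index_iff[OF V, where k=k] mem_frame_index_iff[OF W, where k=k] eq by auto
  have key: "norm (x - orth_proj W x) \<le> ?c * norm x"
    if "x \<in> V" "V \<in> grassmannian m" "W \<in> grassmannian m" "grass_label k V = grass_label k W" "frame_index V = frame_index W"
    for V W :: "(real ^ 'n) set" and x
  proof -
    let ?y = "\<Sum>i\<in>frame_index W. x $ i *\<^sub>R frame W i"
    have fd: "norm (frame V i - frame W i) \<le> real CARD('n) * 1 * (1/2)^k" for i
    proof (rule dyadic_eq_dist)
      fix j
      have "\<lfloor>2^k * frame V i $ j\<rfloor> = \<lfloor>2^k * frame W i $ j\<rfloor>"
        using fun_cong[OF that(4), of "(i, j)"] by (simp add: grass_label_def)
      then show "\<bar>2^k * frame V i $ j - 2^k * frame W i $ j\<bar> \<le> 1" by linarith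
    qed
    have "(\<Sum>i\<in>frame_index W. x $ i *\<^sub>R frame V i) = x"
      using frame_expand[OF that(2,1)] unfolding that(5) by (rule sym)
    then have "x - ?y = (\<Sum>i\<in>frame_index W. x $ i *\<^sub>R (frame V i - frame W i))"
      by (simp add: scaleR_diff_right sum_subtractf)
    also have "norm \<dots> \<le> (\<Sum>i\<in>frame_index W. norm x * (real CARD('n) * (1/2)^k))"
    proof (rule sum_norm_le)
      fix i
      show "norm (x $ i *\<^sub>R (frame V i - frame W i)) \<le> norm x * (real CARD('n) * (1/2)^k)"
        using fd[of i] component_le_norm_cart[of x i] by (simp add: mult_mono)
    qed
    also have "\<dots> \<le> (\<Sum>i\<in>(UNIV :: 'n set). norm x * (real CARD('n) * (1/2)^k))"
      by (rule sum_mono2) auto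
    also have "\<dots> = ?c * norm x" by (simp add: power2_eq_square)
    finally have "norm (x - ?y) \<le> ?c * norm x" .
    moreover have "?y \<in> W"
      using subspace_grass[OF that(3)] frame_in[OF that(3)] by (intro subspace_sum subspace_scale) auto
    ultimately show ?thesis
      using norm_minus_orth_proj_le[OF subspace_grass[OF that(3)], of ?y x] by linarith
  qed
  have "grassmann_dist V W \<le> 2 * ?c"
    by (rule grassmann_dist_le[OF subspace_grass[OF V] subspace_grass[OF W]
          key[OF _ V W eq I] key[OF _ W V eq[symmetric] I[symmetric]]]) simp_all
  then show ?thesis by simp
qed

section \<open>Counting labels of subspaces nearly orthogonal to a vector\<close>

lemma half_power_less:
  assumes "0 < (c::real)"
  obtains J where "\<And>j. J \<le> j \<Longrightarrow> (1/2)^j \<le> c"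
proof -
  obtain J where J: "(1/2::real)^J < c" using real_arch_pow_inv[of c "1/2"] assms by auto
  have "(1/2)^j \<le> c" if "J \<le> j" for j
    using power_decreasing[OF that, of "1/2::real"] J by linarith
  then show ?thesis using that by blast
qed

lemma frame_inner_le:
  fixes V :: "(real ^ 'n) set"
  assumes V: "V \<in> grassmannian m" and e: "norm (orth_proj V e) \<le> \<delta>"
  shows "\<bar>frame V i \<bullet> e\<bar> \<le> real CARD('n) * frame_bound m * \<delta>"
proof -
  have "norm (frame V i) \<le> (\<Sum>j\<in>UNIV. \<bar>frame V i $ j\<bar>)" by (rule norm_le_l1_cart)
  also have "\<dots> \<le> (\<Sum>j\<in>(UNIV::'n set). frame_bound m)" by (rule sum_mono) (rule frame_le[OF V])
  finally have nf: "norm (frame V i) \<le> real CARD('n) * frame_bound m" by simp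
  have "\<bar>frame V i \<bullet> e\<bar> \<le> norm (frame V i) * norm (orth_proj V e)"
    using orth_proj_inner[OF subspace_grass[OF V] frame_in[OF V], of i e]
      Cauchy_Schwarz_ineq2[of "frame V i" "orth_proj V e"] by simp
  also have "\<dots> \<le> real CARD('n) * frame_bound m * \<delta>"
    using nf e frame_bound_ge_1[of m] by (intro mult_mono) auto
  finally show ?thesis .
qed

lemma frame_inner_expand:
  fixes V :: "(real ^ 'n) set"
  assumes V: "V \<in> grassmannian m" and i: "i \<in> frame_index V"
  shows "frame V i \<bullet> e = e $ i + (\<Sum>j\<in>- frame_index V. frame V i $ j * e $ j)"
proof -
  have "frame V i \<bullet> e = (\<Sum>j\<in>UNIV. frame V i $ j * e $ j)" by (simp add: inner_vec_def)
  also have "\<dots> = (\<Sum>j\<in>frame_index V. frame V i $ j * e $ j) + (\<Sum>j\<in>- frame_index V. frame V i $ j * e $ j)"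
    by (subst sum.union_disjoint[symmetric]) auto
  also have "(\<Sum>j\<in>frame_index V. frame V i $ j * e $ j) = (\<Sum>j\<in>frame_index V. if j = i then e $ i else 0)"
    by (rule sum.cong) (use frame_delta[OF V i] in auto)
  finally show ?thesis using i by simp
qed

text \<open>If all coordinates outside the index set were below c, then
  \<open>frame_inner_expand\<close> would make those inside small as well, at most 2 n B c with B =
  \<open>frame_bound m\<close>. The value of c is chosen so that the l1 norm of e would be at most n
  * 2 n B c = 1/2, contradicting |e| = 1.\<close>

lemma exists_large_coordinate:
  fixes V :: "(real ^ 'n) set"
  assumes V: "V \<in> grassmannian m" and e: "norm e = 1" and \<delta>: "norm (orth_proj V e) \<le> \<delta>" "\<delta> \<le> c"
    and c: "c = 1 / (4 * (real CARD('n))\<^sup>2 * frame_bound m)"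
  shows "\<exists>j0\<in>- frame_index V. c \<le> \<bar>e $ j0\<bar>"
proof (rule ccontr)
  assume "\<not> ?thesis"
  then have small: "\<bar>e $ j\<bar> < c" if "j \<notin> frame_index V" for j using that by force
  let ?N = "real CARD('n)" and ?B = "frame_bound m"
  have B: "1 \<le> ?B" by (rule frame_bound_ge_1)
  have N: "1 \<le> ?N" by simp
  have cp: "0 < c" unfolding c using B N by (intro divide_pos_pos mult_pos_pos) auto
  have NB: "1 \<le> ?N * ?B" using mult_mono[OF N B] by simp
  have "\<bar>e $ j\<bar> \<le> 2 * (?N * ?B * c)" for j
  proof (cases "j \<in> frame_index V")
    case True
    have "\<bar>\<Sum>a\<in>- frame_index V. frame V j $ a * e $ a\<bar> \<le> (\<Sum>a\<in>- frame_index V. ?B * c)"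
    proof (rule order_trans[OF sum_abs sum_mono])
      fix a assume "a \<in> - frame_index V"
      then show "\<bar>frame V j $ a * e $ a\<bar> \<le> ?B * c"
        unfolding abs_mult using frame_le[OF V, of j a] small[of a] B by (intro mult_mono) auto
    qed
    also have "\<dots> \<le> (\<Sum>a\<in>(UNIV::'n set). ?B * c)" by (rule sum_mono2) (use B cp in auto)
    finally have "\<bar>\<Sum>a\<in>- frame_index V. frame V j $ a * e $ a\<bar> \<le> ?N * ?B * c" by simp
    moreover have "\<bar>frame V j \<bullet> e\<bar> \<le> ?N * ?B * c"
      using frame_inner_le[OF V order_trans[OF \<delta>], of j] by simp
    ultimately show ?thesis using frame_inner_expand[OF V True, of e] by linarith
  next
    case False
    have "c \<le> ?N * ?B * c" using NB cp mult_right_mono[OF NB, of c] by simp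
    then show ?thesis using small[OF False] cp by linarith
  qed
  then have "(\<Sum>j\<in>UNIV. \<bar>e $ j\<bar>) \<le> (\<Sum>j\<in>(UNIV::'n set). 2 * (?N * ?B * c))" by (rule sum_mono)
  also have "\<dots> = 2 * (?N\<^sup>2 * ?B * c)" by (simp add: power2_eq_square)
  also have "\<dots> = 1/2" using B N by (simp add: c field_simps)
  finally show False using norm_le_l1_cart[of e] e by simp
qed

text \<open>If \<open>V\<close> is nearly orthogonal to the unit vector \<open>e\<close>, then some coordinate \<open>j0\<close> outside the
  frame index set has \<open>\<bar>e\<^sub>j\<^sub>0\<bar>\<close> bounded below, and then the \<open>j0\<close>-th column of the frame is determined
  up to a bounded number of labels by the other columns: \<open>m\<close> degrees of freedom are lost.\<close>

lemma card_nearly_orthogonal_labels: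
  fixes e :: "real ^ 'n" and I :: "'n set"
  assumes c: "0 < c" and j0: "j0 \<notin> I" "c \<le> \<bar>e $ j0\<bar>" and e: "norm e = 1" and I: "card I = m"
    and S: "S \<subseteq> {V \<in> grassmannian m. norm (orth_proj V e) \<le> (1/2)^j \<and> frame_index V = I}"
    and M: "M = \<lceil>2^j * frame_bound m\<rceil>"
    and R: "R = \<lceil>real CARD('n) * (1 + frame_bound m) / c\<rceil> + 1"
  shows "card (grass_label j ` S)
    \<le> nat (2 * M + 1) ^ (m * (CARD('n) - m - 1)) * nat (2 * R + 1) ^ m"
proof -
  let ?N = "real CARD('n)" and ?B = "frame_bound m"
  define J where "J = - I - {j0}"
  \<comment> \<open>The predicted label at (i, j0): the equation 2^j (v . e) = 0 solved for the
    entry at j0, with the other entries replaced by their labels.\<close>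
  define base where "base f i = \<lfloor>- (2^j * e $ i + (\<Sum>a\<in>J. real_of_int (f (i, a)) * e $ a)) / e $ j0\<rfloor>" for f :: "'n \<times> 'n \<Rightarrow> int" and i
  \<comment> \<open>An encoding of labels: free entries on I x J, which has m(n-m-1) elements, and
    the deviation from the prediction in column j0, which takes boundedly many values.\<close>
  define \<Phi> where "\<Phi> L = (restrict L (I \<times> J), \<lambda>i\<in>I. L (i, j0) - base L i)" for L :: "'n \<times> 'n \<Rightarrow> int"
  let ?F = "PiE (I \<times> J) (\<lambda>_. {- M..M})" and ?G = "PiE I (\<lambda>_. {- R..R})"
  have SV: "V \<in> grassmannian m" "norm (orth_proj V e) \<le> (1/2)^j" "frame_index V = I" if "V \<in> S" for V
    using S that by auto
  have ej0: "e $ j0 \<noteq> 0" using c j0 by auto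
  \<comment> \<open>Near-orthogonality contributes n B and rounding the other entries at most n,
    where B = \<open>frame_bound m\<close>; division by |e_j0| >= c and a unit for the floors give
    R.\<close>
  have diff: "\<bar>grass_label j V (i, j0) - base (grass_label j V) i\<bar> \<le> R" if "V \<in> S" "i \<in> I" for V i
  proof -
    let ?v = "frame V i" and ?L = "grass_label j V"
    note V = SV[OF that(1)]
    have "?v \<bullet> e = e $ i + (\<Sum>a\<in>- I. ?v $ a * e $ a)"
      using frame_inner_expand[OF V(1), of i e] V(3) that(2) by simp
    also have "(\<Sum>a\<in>- I. ?v $ a * e $ a) = ?v $ j0 * e $ j0 + (\<Sum>a\<in>J. ?v $ a * e $ a)"
      unfolding J_def by (rule sum.remove) (use j0 in auto)
    finally have ve: "?v $ j0 * e $ j0 = ?v \<bullet> e - e $ i - (\<Sum>a\<in>J. ?v $ a * e $ a)" by simp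
    define X where "X = - (2^j * e $ i + (\<Sum>a\<in>J. real_of_int (?L (i, a)) * e $ a)) / e $ j0"
    have Xe: "X * e $ j0 = - (2^j * e $ i + (\<Sum>a\<in>J. real_of_int (?L (i, a)) * e $ a))"
      using ej0 by (simp add: X_def)
    have "(2^j * ?v $ j0 - X) * e $ j0 = 2^j * (?v $ j0 * e $ j0) - X * e $ j0"
      by (simp add: left_diff_distrib)
    also have "\<dots> = 2^j * (?v \<bullet> e) - (\<Sum>a\<in>J. (2^j * ?v $ a - real_of_int (?L (i, a))) * e $ a)"
      unfolding ve Xe by (simp add: algebra_simps sum_subtractf sum_distrib_left)
    also have "\<bar>\<dots>\<bar> \<le> \<bar>2^j * (?v \<bullet> e)\<bar> + \<bar>\<Sum>a\<in>J. (2^j * ?v $ a - real_of_int (?L (i, a))) * e $ a\<bar>" by simp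
    also have "\<bar>2^j * (?v \<bullet> e)\<bar> \<le> 2^j * (?N * ?B * (1/2)^j)"
      using frame_inner_le[OF V(1,2), of i] by (simp add: abs_mult)
    also have "\<dots> = ?N * ?B" by (simp add: power_one_over)
    also have "\<bar>\<Sum>a\<in>J. (2^j * ?v $ a - real_of_int (?L (i, a))) * e $ a\<bar> \<le> (\<Sum>a\<in>J. 1)"
    proof (rule order_trans[OF sum_abs sum_mono])
      fix a
      have "\<bar>2^j * ?v $ a - real_of_int (?L (i, a))\<bar> \<le> 1" unfolding grass_label_def by simp linarith
      moreover have "\<bar>e $ a\<bar> \<le> 1" using component_le_norm_cart[of e a] e by simp
      ultimately show "\<bar>(2^j * ?v $ a - real_of_int (?L (i, a))) * e $ a\<bar> \<le> 1"
        unfolding abs_mult using mult_mono[of "\<bar>2^j * ?v $ a - real_of_int (?L (i, a))\<bar>" 1 "\<bar>e $ a\<bar>" 1] by simp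
    qed
    also have "(\<Sum>a\<in>J. 1) \<le> ?N" using card_mono[of UNIV J] by simp
    finally have "\<bar>(2^j * ?v $ j0 - X) * e $ j0\<bar> \<le> ?N * (1 + ?B)"
      by (simp add: distrib_left)
    then have "\<bar>2^j * ?v $ j0 - X\<bar> * \<bar>e $ j0\<bar> \<le> ?N * (1 + ?B)"
      unfolding abs_mult .
    then have "\<bar>2^j * ?v $ j0 - X\<bar> * c \<le> ?N * (1 + ?B)"
      using mult_left_mono[OF j0(2), of "\<bar>2^j * ?v $ j0 - X\<bar>"] by linarith
    then have "\<bar>2^j * ?v $ j0 - X\<bar> \<le> ?N * (1 + ?B) / c" using c by (simp add: field_simps)
    moreover have "?L (i, j0) = \<lfloor>2^j * ?v $ j0\<rfloor>" "base ?L i = \<lfloor>X\<rfloor>"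
      by (simp_all add: grass_label_def base_def X_def)
    ultimately show ?thesis unfolding R by linarith
  qed
  have "inj_on \<Phi> (grass_label j ` S)"
  proof (rule inj_onI)
    fix L L' assume L: "L \<in> grass_label j ` S" "L' \<in> grass_label j ` S" and eq: "\<Phi> L = \<Phi> L'"
    obtain V where V: "V \<in> S" "L = grass_label j V" using L(1) by (rule imageE)
    obtain W where W: "W \<in> S" "L' = grass_label j W" using L(2) by (rule imageE)
    have r: "L (i, a) = L' (i, a)" if "i \<in> I" "a \<in> J" for i a
      using arg_cong[OF eq, of "\<lambda>q. fst q (i, a)"] that by (simp add: \<Phi>_def)
    have g: "L (i, j0) - base L i = L' (i, j0) - base L' i" if "i \<in> I" for i
      using arg_cong[OF eq, of "\<lambda>q. snd q i"] that by (simp add: \<Phi>_def)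
    have b: "base L i = base L' i" if "i \<in> I" for i
      unfolding base_def using r that by simp
    show "L = L'"
    proof
      fix p :: "'n \<times> 'n" obtain i a where p: "p = (i, a)" by (cases p)
      show "L p = L' p"
      proof (cases "i \<in> I")
        case False
        then show ?thesis using frame_notin[OF SV(1)[OF V(1)], of i] frame_notin[OF SV(1)[OF W(1)], of i]
            SV(3)[OF V(1)] SV(3)[OF W(1)] by (simp add: V W p grass_label_def)
      next
        case True
        consider "a \<in> I" | "a \<in> J" | "a = j0" unfolding J_def by blast
        then show ?thesis
        proof cases
          case 1
          then show ?thesis using frame_delta[OF SV(1)[OF V(1)], of i a] frame_delta[OF SV(1)[OF W(1)], of i a]
              SV(3)[OF V(1)] SV(3)[OF W(1)] True by (simp add: V W p grass_label_def)
        next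
          case 2
          then show ?thesis using r True p by simp
        next
          case 3
          then show ?thesis using g[OF True] b[OF True] p by simp
        qed
      qed
    qed
  qed
  moreover have "\<Phi> ` grass_label j ` S \<subseteq> ?F \<times> ?G"
  proof (intro image_subsetI)
    fix L assume "L \<in> grass_label j ` S"
    then obtain V where V: "V \<in> S" and L: "L = grass_label j V" by (rule imageE)
    have "grass_label j V p \<in> {- M..M}" for p using grass_label_bounds[OF SV(1)[OF V], of j p] by (simp add: M)
    moreover have "grass_label j V (i, j0) - base (grass_label j V) i \<in> {- R..R}" if "i \<in> I" for i
      using diff[OF V that] by (simp add: abs_le_iff)
    ultimately show "\<Phi> L \<in> ?F \<times> ?G"
      unfolding \<Phi>_def L by (auto simp: PiE_iff)
  qed
  moreover have "finite (?F \<times> ?G)" by (intro finite_cartesian_product finite_PiE) auto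
  ultimately have "card (grass_label j ` S) \<le> card (?F \<times> ?G)" by (rule card_inj_on_le)
  also have "\<dots> = card ?F * card ?G" by (rule card_cartesian_product)
  also have "card ?F = nat (2 * M + 1) ^ card (I \<times> J)"
    by (subst card_PiE) (auto simp: algebra_simps)
  also have "card ?G = nat (2 * R + 1) ^ m"
    by (subst card_PiE) (auto simp: I algebra_simps)
  also have "card J = CARD('n) - m - 1"
    unfolding J_def Compl_eq_Diff_UNIV using j0(1) I by (simp add: card_Diff_subset)
  then have "card (I \<times> J) = m * (CARD('n) - m - 1)" by (simp add: card_cartesian_product I)
  finally show ?thesis .
qed

text \<open>For the finitely many levels with 2^-j > c no large coordinate is guaranteed, and all
  labels are counted into the constant. At the other levels the subspaces are split by index set and
  large coordinate.\<close>

lemma card_nearly_orthogonal: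
  obtains C where "0 < C" "\<And>(e::real ^ 'n) j. norm e = 1 \<Longrightarrow>
      real (card (grass_label j ` {V \<in> grassmannian m. norm (orth_proj V e) \<le> (1/2)^j}))
      \<le> C * 2 ^ (j * (m * (CARD('n) - m - 1)))"
proof -
  let ?B = "frame_bound m" and ?d = "m * (CARD('n) - m - 1)"
  let ?S = "\<lambda>(e::real^'n) j. {V \<in> grassmannian m. norm (orth_proj V e) \<le> (1/2)^j}"
  define c where "c = 1 / (4 * (real CARD('n))\<^sup>2 * ?B)"
  define R where "R = \<lceil>real CARD('n) * (1 + ?B) / c\<rceil> + 1"
  have B: "1 \<le> ?B" by (rule frame_bound_ge_1)
  have c: "0 < c" unfolding c_def using B by (intro divide_pos_pos mult_pos_pos) auto
  obtain J where J: "\<And>j. J \<le> j \<Longrightarrow> (1/2)^j \<le> c" using half_power_less[OF c] by blast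
  define C1 where "C1 = (\<Sum>j<J. real (card (grass_label j ` (grassmannian m :: (real^'n) set set))))"
  \<comment> \<open>The 5 comes from 2M + 1 <= 2 (2^j B + 1) + 1 <= 5 * 2^j B, valid because 2^j B
    >= 1 for B = \<open>frame_bound m\<close>.\<close>
  define C2 where "C2 = real (card (UNIV :: ('n set \<times> 'n) set)) * ((5 * ?B) ^ ?d * real (nat (2 * R + 1)) ^ m)"
  define C where "C = C1 + C2 + 1"
  have C12: "0 \<le> C1" "0 \<le> C2" using B by (auto simp: C1_def C2_def intro!: sum_nonneg)
  have "real (card (grass_label j ` ?S e j)) \<le> C * 2 ^ (j * ?d)" if e: "norm e = 1" for e j
  proof (cases "j < J")
    case True
    have "real (card (grass_label j ` ?S e j)) \<le> real (card (grass_label j ` (grassmannian m :: (real^'n) set set)))"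
      by (intro of_nat_mono card_mono finite_grass_label) auto
    also have "\<dots> \<le> C1" unfolding C1_def by (rule member_le_sum) (use True in auto)
    also have "\<dots> \<le> C * 1" using C12 by (simp add: C_def)
    also have "\<dots> \<le> C * 2 ^ (j * ?d)" using C12 by (intro mult_left_mono) (auto simp: C_def)
    finally show ?thesis .
  next
    case False
    define M where "M = \<lceil>2^j * ?B\<rceil>"
    define T where "T p = {V \<in> ?S e j. frame_index V = fst p \<and> snd p \<notin> fst p \<and> c \<le> \<bar>e $ snd p\<bar>}" for p :: "'n set \<times> 'n"
    have cardT: "card (grass_label j ` T p) \<le> nat (2 * M + 1) ^ ?d * nat (2 * R + 1) ^ m" for p
    proof (cases "T p = {}")
      case False
      then obtain V where V: "V \<in> grassmannian m" "frame_index V = fst p" "snd p \<notin> fst p" "c \<le> \<bar>e $ snd p\<bar>"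
        unfolding T_def by blast
      then have "card (fst p) = m" "snd p \<notin> fst p" "c \<le> \<bar>e $ snd p\<bar>"
        using card_frame_index[OF V(1)] by auto
      then show ?thesis
        using c e by (intro card_nearly_orthogonal_labels[OF _ _ _ _ _ _ M_def R_def]) (auto simp: T_def)
    qed simp
    have "?S e j \<subseteq> (\<Union>p. T p)"
    proof
      fix V assume V: "V \<in> ?S e j"
      then have "\<exists>j0\<in>- frame_index V. c \<le> \<bar>e $ j0\<bar>"
        using exists_large_coordinate[OF _ e _ J c_def] False by auto
      then obtain j0 where "j0 \<in> - frame_index V" "c \<le> \<bar>e $ j0\<bar>" by blast
      then have "V \<in> T (frame_index V, j0)" using V by (simp add: T_def)
      then show "V \<in> (\<Union>p. T p)" by blast
    qed
    then have "grass_label j ` ?S e j \<subseteq> (\<Union>p. grass_label j ` T p)" by blast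
    moreover have "finite (grass_label j ` T p)" for p
      by (rule finite_subset[OF _ finite_grass_label[of j m]]) (auto simp: T_def)
    ultimately have "card (grass_label j ` ?S e j) \<le> card (\<Union>p. grass_label j ` T p)"
      by (intro card_mono) auto
    also have "\<dots> \<le> (\<Sum>p\<in>UNIV. card (grass_label j ` T p))" by (rule card_UN_le) simp
    also have "\<dots> \<le> (\<Sum>p\<in>(UNIV :: ('n set \<times> 'n) set). nat (2 * M + 1) ^ ?d * nat (2 * R + 1) ^ m)"
      by (rule sum_mono) (rule cardT)
    finally have "card (grass_label j ` ?S e j) \<le> card (UNIV :: ('n set \<times> 'n) set) * (nat (2 * M + 1) ^ ?d * nat (2 * R + 1) ^ m)"
      by simp
    then have "real (card (grass_label j ` ?S e j))
        \<le> real (card (UNIV :: ('n set \<times> 'n) set)) * (real (nat (2 * M + 1)) ^ ?d * real (nat (2 * R + 1)) ^ m)"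
      unfolding of_nat_le_iff[symmetric, where 'a=real] of_nat_mult of_nat_power .
    also have "\<dots> \<le> real (card (UNIV :: ('n set \<times> 'n) set)) * ((5 * ?B * 2^j) ^ ?d * real (nat (2 * R + 1)) ^ m)"
    proof (intro mult_left_mono mult_right_mono power_mono)
      have "1 \<le> 2^j * ?B" using mult_mono[of 1 "2^j" 1 ?B] B by simp
      moreover from this have "0 \<le> M" "real_of_int M \<le> 2^j * ?B + 1" unfolding M_def by linarith+
      then have "real (nat (2 * M + 1)) \<le> 2 * (2^j * ?B + 1) + 1" by simp
      moreover have "y \<le> 5 * x" if "1 \<le> x" "y \<le> 2 * (x + 1) + 1" for x y :: real using that by simp
      ultimately have "real (nat (2 * M + 1)) \<le> 5 * (2^j * ?B)" by blast
      then show "real (nat (2 * M + 1)) \<le> 5 * ?B * 2^j" by (simp only: mult_ac)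
    qed auto
    also have "\<dots> = C2 * 2 ^ (j * ?d)" unfolding C2_def power_mult power_mult_distrib by simp
    also have "\<dots> \<le> C * 2 ^ (j * ?d)" using C12 by (intro mult_right_mono) (auto simp: C_def)
    finally show ?thesis .
  qed
  moreover have "0 < C" using C12 by (simp add: C_def)
  ultimately show ?thesis using that by blast
qed

section \<open>Point masses on the Grassmannian with kernel bounds\<close>

lemma profile_kernel_nonneg: "0 \<le> r \<Longrightarrow> 0 \<le> profile_kernel s r z"
  by (simp add: profile_kernel_def)

text \<open>This replaces integration against a Frostman measure on the Grassmannian.\<close>

lemma grassmannian_frostman:
  fixes s L :: real and m p :: nat
  assumes s: "0 < s" and L: "1 \<le> L" and t: "t = real (m * (CARD('n) - m - 1)) + s"
  obtains C where "0 < C"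
    "\<And>k A. A \<subseteq> (grassmannian m :: (real ^ 'n) set set) \<Longrightarrow> \<exists>F \<tau>. finite F \<and> F \<subseteq> A \<and> (\<forall>V. 0 \<le> \<tau> V)
      \<and> net_content grass_label t A \<le> ennreal (\<Sum>V\<in>F. \<tau> V)
      \<and> (\<forall>z. norm z \<le> 2^p \<longrightarrow>
            (\<Sum>V\<in>{V\<in>F. norm (orth_proj V z) \<le> L * (1/2)^k}. \<tau> V) \<le> C * profile_kernel s ((1/2)^k) z)"
proof -
  let ?G = "grassmannian m :: (real ^ 'n) set set"
  let ?d = "m * (CARD('n) - m - 1)"
  obtain C0 where C0: "0 < C0" "\<And>(e::real ^ 'n) j. norm e = 1 \<Longrightarrow>
      real (card (grass_label j ` {V \<in> ?G. norm (orth_proj V e) \<le> (1/2)^j})) \<le> C0 * 2 ^ (j * ?d)"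
    using card_nearly_orthogonal[where 'n='n and m=m] by blast
  define T0 where "T0 = real (card (grass_label 0 ` ?G))"
  define C where "C = T0 * L powr s + C0 * (2 * L) powr s + 1"
  have Cpos: "0 \<le> T0 * L powr s" "0 \<le> C0 * (2 * L) powr s" using C0 by (auto simp: T0_def)
  have "\<exists>F \<tau>. finite F \<and> F \<subseteq> A \<and> (\<forall>V. 0 \<le> \<tau> V)
      \<and> net_content grass_label t A \<le> ennreal (\<Sum>V\<in>F. \<tau> V)
      \<and> (\<forall>z. norm z \<le> 2^p \<longrightarrow>
            (\<Sum>V\<in>{V\<in>F. norm (orth_proj V z) \<le> L * (1/2)^k}. \<tau> V) \<le> C * profile_kernel s ((1/2)^k) z)"
    if A: "A \<subseteq> ?G" for k A
  proof -
    have fin: "finite (grass_label j ` A)" for j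
      by (rule finite_subset[OF image_mono[OF A] finite_grass_label])
    \<comment> \<open>Level k + p is deep enough: the threshold x below is at least 2^-(k+p)
      whenever |z| <= 2^p.\<close>
    obtain F \<tau> where F: "finite F" "F \<subseteq> A" "\<And>V. 0 \<le> \<tau> V" "net_content grass_label t A \<le> ennreal (\<Sum>V\<in>F. \<tau> V)"
        "\<And>j l. j \<le> k + p \<Longrightarrow> (\<Sum>V\<in>{V\<in>F. grass_label j V = l}. \<tau> V) \<le> (1/2) powr (t * real j)"
      using grass.discrete_frostman[OF fin, where t=t and K="k+p"] by blast
    have sum_le: "(\<Sum>V\<in>{V\<in>F. V \<in> S}. \<tau> V) \<le> real (card (grass_label j ` S)) * (1/2) powr (t * real j)"
      if "j \<le> k + p" "S \<subseteq> ?G" for j S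
    proof -
      have finS: "finite (grass_label j ` S)" by (rule finite_subset[OF image_mono[OF that(2)] finite_grass_label])
      have "(\<Sum>V\<in>{V\<in>F. V \<in> S}. \<tau> V) = (\<Sum>l\<in>grass_label j ` S. \<Sum>V\<in>{V\<in>{V\<in>F. V \<in> S}. grass_label j V = l}. \<tau> V)"
        by (rule sum.group[symmetric]) (use F finS in auto)
      also have "\<dots> \<le> (\<Sum>l\<in>grass_label j ` S. (1/2) powr (t * real j))"
      proof (rule sum_mono)
        fix l
        have "(\<Sum>V\<in>{V\<in>{V\<in>F. V \<in> S}. grass_label j V = l}. \<tau> V) \<le> (\<Sum>V\<in>{V\<in>F. grass_label j V = l}. \<tau> V)"
          by (rule sum_mono2) (use F in auto)
        also have "\<dots> \<le> (1/2) powr (t * real j)" by (rule F(5)[OF that(1)])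
        finally show "(\<Sum>V\<in>{V\<in>{V\<in>F. V \<in> S}. grass_label j V = l}. \<tau> V) \<le> (1/2) powr (t * real j)" .
      qed
      finally show ?thesis by simp
    qed
    have "(\<Sum>V\<in>{V\<in>F. norm (orth_proj V z) \<le> L * (1/2)^k}. \<tau> V) \<le> C * profile_kernel s ((1/2)^k) z"
      if z: "norm z \<le> 2^p" for z
    proof (cases "z = 0 \<or> norm z \<le> L * (1/2)^k")
      case True
      have "(\<Sum>V\<in>{V\<in>F. norm (orth_proj V z) \<le> L * (1/2)^k}. \<tau> V) \<le> (\<Sum>V\<in>{V\<in>F. V \<in> ?G}. \<tau> V)"
        by (rule sum_mono2) (use F A in auto)
      also have "\<dots> \<le> T0" using sum_le[of 0 ?G] by (simp add: T0_def)
      finally have 1: "(\<Sum>V\<in>{V\<in>F. norm (orth_proj V z) \<le> L * (1/2)^k}. \<tau> V) \<le> T0" .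
      \<comment> \<open>For z this short every subspace may be counted, so the sum is only bounded
        by the total mass T0; the kernel is at least L^-s there, whence the summand T0 L^s of
        C.\<close>
      have "(1/L) powr s \<le> profile_kernel s ((1/2)^k) z"
      proof (cases "z = 0")
        case True
        then show ?thesis using L s powr_mono2[of s "1/L" 1] by (simp add: profile_kernel_def)
      next
        case False
        then have "1 / L \<le> (1/2)^k / norm z" using True L by (simp add: field_simps)
        then have "(1/L) powr s \<le> ((1/2)^k / norm z) powr s" using L s by (intro powr_mono2) auto
        moreover have "(1/L) powr s \<le> 1" using L s powr_mono2[of s "1/L" 1] by simp
        ultimately show ?thesis using False s by (simp add: profile_kernel_def)
      qed
      then have "C * (1/L) powr s \<le> C * profile_kernel s ((1/2)^k) z"
        using Cpos by (intro mult_left_mono) (auto simp: C_def)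
      moreover have "T0 = T0 * L powr s * (1/L) powr s" using L by (simp add: powr_divide)
      moreover have "T0 * L powr s * (1/L) powr s \<le> C * (1/L) powr s"
        using Cpos by (intro mult_right_mono) (auto simp: C_def)
      ultimately show ?thesis using 1 by linarith
    next
      case False
      then have z0: "0 < norm z" "L * (1/2)^k < norm z" by auto
      \<comment> \<open>The threshold after rescaling z to the unit vector e.\<close>
      define x where "x = L * (1/2)^k / norm z"
      have x: "0 < x" "x \<le> 1" using z0 L by (auto simp: x_def)
      obtain j where j: "x \<le> (1/2)^j" "(1/2)^j < 2 * x" using dyadic_scale[OF x] by blast
      have jK: "j \<le> k + p"
      proof (rule ccontr)
        assume "\<not> j \<le> k + p"
        then have "(1/2::real)^j < (1/2)^(k+p)" by (intro power_strict_decreasing) auto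
        also have "\<dots> = 1 * (1/2)^k / 2^p" by (simp add: power_add power_one_over)
        also have "\<dots> \<le> x" unfolding x_def using L z z0 by (intro frac_le mult_right_mono) auto
        finally show False using j by simp
      qed
      define e where "e = (1 / norm z) *\<^sub>R z"
      have e: "norm e = 1" using z0 by (simp add: e_def)
      let ?S = "{V \<in> ?G. norm (orth_proj V e) \<le> (1/2)^j}"
      have pe: "norm (orth_proj V e) = norm (orth_proj V z) / norm z" if "V \<in> ?G" for V
        using linear_scale[OF linear_orth_proj[OF subspace_grass[OF that]]] by (simp add: e_def)
      have "norm (orth_proj V e) \<le> (1/2)^j" if "V \<in> F" "norm (orth_proj V z) \<le> L * (1/2)^k" for V
      proof -
        have "norm (orth_proj V e) \<le> x"
          unfolding x_def pe[OF subsetD[OF A subsetD[OF F(2) that(1)]]]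
          using that(2) by (rule divide_right_mono) simp
        then show ?thesis using j(1) by simp
      qed
      then have "{V\<in>F. norm (orth_proj V z) \<le> L * (1/2)^k} \<subseteq> {V\<in>F. V \<in> ?S}"
        using F(2) A by auto
      then have "(\<Sum>V\<in>{V\<in>F. norm (orth_proj V z) \<le> L * (1/2)^k}. \<tau> V) \<le> (\<Sum>V\<in>{V\<in>F. V \<in> ?S}. \<tau> V)"
        by (intro sum_mono2) (use F in auto)
      also have "\<dots> \<le> real (card (grass_label j ` ?S)) * (1/2) powr (t * real j)"
        by (rule sum_le[OF jK]) auto
      also have "\<dots> \<le> C0 * 2 ^ (j * ?d) * (1/2) powr (t * real j)"
        by (intro mult_right_mono C0 e) simp
      \<comment> \<open>With t = d + s for d = m(n-m-1), the count 2^(jd) cancels against the cell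
        mass 2^(-jt) and leaves 2^(-js).\<close>
      also have "\<dots> = C0 * ((1/2)^j) powr s"
      proof -
        have "t * real j = real (j * ?d) + s * real j"
          unfolding t distrib_right by simp
        then have "(1/2::real) powr (t * real j) = (1/2) powr (real (j * ?d)) * (1/2) powr (s * real j)"
          by (simp only: powr_add)
        also have "(1/2::real) powr (real (j * ?d)) = (1/2)^(j * ?d)" by (rule powr_realpow) simp
        finally show ?thesis by (simp add: half_powr_eq power_one_over)
      qed
      also have "\<dots> \<le> C0 * (2 * x) powr s"
        using C0 j s by (intro mult_left_mono powr_mono2) auto
      also have "2 * x = (2 * L) * ((1/2)^k / norm z)" by (simp add: x_def)
      also have "\<dots> powr s = (2 * L) powr s * ((1/2)^k / norm z) powr s"
        by (rule powr_mult)
      also have "C0 * ((2 * L) powr s * ((1/2)^k / norm z) powr s) \<le> C * ((1/2)^k / norm z) powr s"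
        unfolding mult.assoc[symmetric] by (rule mult_right_mono) (use Cpos in \<open>auto simp: C_def\<close>)
      also have "((1/2)^k / norm z) powr s = profile_kernel s ((1/2)^k) z"
      proof -
        have "(1/2)^k / norm z \<le> 1"
        proof -
          have "1 * (1/2)^k \<le> L * (1/2)^k" by (rule mult_right_mono[OF L]) simp
          also note z0(2)
          finally show ?thesis using z0 by (simp add: divide_le_eq)
        qed
        then have "((1/2)^k / norm z) powr s \<le> 1" using s powr_mono2[of s "(1/2)^k / norm z" 1] by simp
        then show ?thesis using s z0 by (simp add: profile_kernel_def)
      qed
      finally show ?thesis .
    qed
    then show ?thesis using F by (intro exI[of _ F] exI[of _ \<tau>]) simp
  qed
  moreover have "0 < C" using Cpos by (simp add: C_def)
  ultimately show ?thesis by (intro that[of C])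
qed

section \<open>Box dimensions\<close>

text \<open>Diameters are only bounded above and N is real, so that N can be a capacity times a
  power of 1/2.\<close>

definition covered_by :: "nat \<Rightarrow> real \<Rightarrow> 'a::euclidean_space set \<Rightarrow> bool" where
  "covered_by k N S \<longleftrightarrow> (\<exists>\<C>. finite \<C> \<and> real (card \<C>) \<le> N
     \<and> (\<forall>U\<in>\<C>. bounded U \<and> diameter U \<le> (1/2)^k) \<and> S \<subseteq> \<Union>\<C>)"

definition energy :: "real \<Rightarrow> real \<Rightarrow> 'a::euclidean_space measure \<Rightarrow> real" where
  "energy s r \<mu> = (\<integral>y. (\<integral>x. profile_kernel s r (x - y) \<partial>\<mu>) \<partial>\<mu>)"

lemma profile_kernel_measurable [measurable]: "profile_kernel s r \<in> borel_measurable borel"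
  unfolding profile_kernel_def by measurable

lemma profile_kernel_le_1: "profile_kernel s r x \<le> 1"
  by (simp add: profile_kernel_def)

lemma profile_kernel_mono:
  assumes "0 \<le> r" "r \<le> r'" "0 \<le> s"
  shows "profile_kernel s r x \<le> profile_kernel s r' x"
  using assms powr_mono2[of s "r / norm x" "r' / norm x"]
  by (auto simp: profile_kernel_def divide_right_mono min_def)

lemma profile_kernel_ge:
  assumes "0 < r" "norm x \<le> D" "0 < D" "0 \<le> s"
  shows "min 1 ((r / D) powr s) \<le> profile_kernel s r x"
proof (cases "s = 0 \<or> x = 0")
  case False
  then have "(r / D) powr s \<le> (r / norm x) powr s"
    using assms by (intro powr_mono2 divide_left_mono) auto
  then show ?thesis using False by (simp add: profile_kernel_def)
qed (simp add: profile_kernel_def)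

lemma orth_proj_measurable [measurable]:
  assumes "subspace (V :: 'a::euclidean_space set)"
  shows "orth_proj V \<in> borel_measurable borel"
  using linear_orth_proj[OF assms] by (intro borel_measurable_continuous_onI linear_continuous_on)
    (simp add: linear_conv_bounded_linear)

locale profile_measure = prob_space \<mu> for \<mu> :: "'a::euclidean_space measure" +
  assumes sets_mu [measurable_cong]: "sets \<mu> = sets borel"
begin

lemma space_mu [simp]: "space \<mu> = UNIV"
  using sets_eq_imp_space_eq[OF sets_mu] by simp

lemma prob_UNIV [simp]: "prob UNIV = 1"
  using prob_space by simp

lemma integrable_bounded:
  fixes f :: "'a \<Rightarrow> real"
  assumes [measurable]: "f \<in> borel_measurable borel" and "\<And>x. \<bar>f x\<bar> \<le> B"
  shows "integrable \<mu> f"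
  by (rule integrable_const_bound[of _ B]) (use assms in auto)

lemma
  fixes f :: "'a \<Rightarrow> 'a \<Rightarrow> real"
  assumes f [measurable]: "(\<lambda>(x, y). f x y) \<in> borel_measurable (borel \<Otimes>\<^sub>M borel)" and B: "\<And>x y. \<bar>f x y\<bar> \<le> B"
  shows integrable_inner: "integrable \<mu> (\<lambda>x. f x y)"
    and integrable_outer: "integrable \<mu> (\<lambda>y. \<integral>x. f x y \<partial>\<mu>)"
proof -
  show inner: "integrable \<mu> (\<lambda>x. f x y)" for y
    by (rule integrable_bounded[of _ B]) (use B in auto)
  show "integrable \<mu> (\<lambda>y. \<integral>x. f x y \<partial>\<mu>)"
  proof (rule integrable_bounded[of _ B])
    show "(\<lambda>y. \<integral>x. f x y \<partial>\<mu>) \<in> borel_measurable borel" by measurable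
    fix y
    have "\<bar>\<integral>x. f x y \<partial>\<mu>\<bar> \<le> (\<integral>x. \<bar>f x y\<bar> \<partial>\<mu>)" by (rule integral_abs_bound)
    also have "\<dots> \<le> (\<integral>x. B \<partial>\<mu>)" by (rule integral_mono) (use inner B in auto)
    finally show "\<bar>\<integral>x. f x y \<partial>\<mu>\<bar> \<le> B" by (simp add: prob_space)
  qed
qed

lemma kernel_pair_measurable: "(\<lambda>(x, y). profile_kernel s r (x - y :: 'a)) \<in> borel_measurable (borel \<Otimes>\<^sub>M borel)"
  by measurable

lemma energy_mono:
  assumes "0 \<le> r" "r \<le> r'" "0 \<le> s"
  shows "energy s r \<mu> \<le> energy s r' \<mu>"
  unfolding energy_def
  using assms
  by (intro integral_mono integrable_outer[where B=1] integrable_inner[where B=1] kernel_pair_measurable profile_kernel_mono)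
    (auto simp: profile_kernel_le_1 profile_kernel_nonneg abs_le_iff intro: order_trans[of _ 0])

end

lemma prob_measures_onD:
  assumes "\<mu> \<in> prob_measures_on K"
  shows "profile_measure \<mu>" "closed K \<Longrightarrow> AE x in \<mu>. x \<in> K"
proof -
  have \<mu>: "sets \<mu> = sets borel" "prob_space \<mu>" "emeasure \<mu> (- K) = 0"
    using assms by (auto simp: prob_measures_on_def)
  interpret prob_space \<mu> by fact
  show *: "profile_measure \<mu>" by unfold_locales (rule \<mu>(1))
  interpret profile_measure \<mu> by fact
  show "AE x in \<mu>. x \<in> K" if "closed K"
    using \<mu>(3) that by (intro AE_I[of _ _ "- K"]) (auto simp: \<mu>(1))
qed

lemma prob_measures_on_nonempty:
  assumes "x \<in> K" "closed K"
  shows "prob_measures_on K \<noteq> {}"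
proof -
  have "return borel x \<in> prob_measures_on K"
    using assms by (auto simp: prob_measures_on_def prob_space_return emeasure_return)
  then show ?thesis by blast
qed

text \<open>The preimages of the covering sets, made disjoint, split \<open>\<mu>\<close> into at
  most N parts. Two points of one part have projections at most 2^-k apart, and by Cauchy-Schwarz
  the squares of the masses of the parts add up to at least 1/N.\<close>

lemma covered_by_pair_integral:
  fixes V :: "'a::euclidean_space set"
  assumes \<mu>: "\<mu> \<in> prob_measures_on (closure E)" and V: "subspace V"
    and cov: "covered_by k N (orth_proj V ` E)" and N: "0 < N"
  shows "1 / N \<le> (\<integral>y. (\<integral>x. indicator {z. norm (orth_proj V z) \<le> (1/2)^k} (x - y) \<partial>\<mu>) \<partial>\<mu>)"
proof -
  interpret profile_measure \<mu> by (rule prob_measures_onD(1)[OF \<mu>])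
  note [measurable] = orth_proj_measurable[OF V]
  have bl: "bounded_linear (orth_proj V)" using linear_orth_proj[OF V] by (simp add: linear_conv_bounded_linear)
  obtain \<C> where C: "finite \<C>" "real (card \<C>) \<le> N" "\<And>U. U \<in> \<C> \<Longrightarrow> bounded U \<and> diameter U \<le> (1/2)^k"
      "orth_proj V ` E \<subseteq> \<Union>\<C>"
    using cov unfolding covered_by_def by blast
  obtain h where h: "\<C> = h ` {i::nat. i < card \<C>}" using finite_imp_nat_seg_image_inj_on[OF C(1)] C(1)
    by (metis card_image card_Collect_less_nat)
  define n where "n = card \<C>"
  \<comment> \<open>Closing the covering sets keeps their diameters, and the finitely many closed
    preimages then cover the closure of E, where \<open>\<mu>\<close> lives.\<close>
  define P where "P i = orth_proj V -` closure (h i)" for i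
  define D where "D = disjointed P"
  have clP: "closed (P i)" for i
    unfolding P_def by (intro closed_vimage closed_closure linear_continuous_on bl)
  have [measurable]: "P i \<in> sets borel" for i by (rule borel_closed[OF clP])
  have Dm [measurable]: "D i \<in> sets borel" for i
    unfolding D_def disjointed_def by measurable
  have "E \<subseteq> (\<Union>i\<in>{0..<n}. P i)"
  proof
    fix x assume "x \<in> E"
    then obtain U where "U \<in> \<C>" "orth_proj V x \<in> U" using C(4) by blast
    then obtain i where "i < n" "orth_proj V x \<in> h i" using h unfolding n_def by blast
    then show "x \<in> (\<Union>i\<in>{0..<n}. P i)" unfolding P_def using closure_subset by fastforce
  qed
  moreover have "closed (\<Union>i\<in>{0..<n}. P i)" by (intro closed_UN ballI clP) auto
  ultimately have "closure E \<subseteq> (\<Union>i\<in>{0..<n}. P i)" by (rule closure_minimal)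
  then have "closure E \<subseteq> (\<Union>i\<in>{0..<n}. D i)" unfolding D_def finite_UN_disjointed_eq .
  then have "AE x in \<mu>. x \<in> (\<Union>i\<in>{0..<n}. D i)"
    using prob_measures_onD(2)[OF \<mu> closed_closure] by (auto elim!: eventually_mono)
  then have "prob (\<Union>i\<in>{0..<n}. D i) = 1" by (subst prob_eq_1) (auto simp: sets_mu)
  moreover have "prob (\<Union>i\<in>{0..<n}. D i) = (\<Sum>i\<in>{0..<n}. prob (D i))"
    by (rule finite_measure_finite_Union) (auto simp: sets_mu D_def Dm[unfolded D_def] intro: disjoint_family_on_mono[OF _ disjoint_family_disjointed])
  ultimately have sum1: "(\<Sum>i\<in>{0..<n}. prob (D i)) = 1" by simp
  let ?f = "\<lambda>x y. indicator {z. norm (orth_proj V z) \<le> (1/2)^k} (x - y) :: real"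
  have fm: "(\<lambda>(x, y). ?f x y) \<in> borel_measurable (borel \<Otimes>\<^sub>M borel)" by measurable
  have close: "norm (orth_proj V (x - y)) \<le> (1/2)^k" if "x \<in> D i" "y \<in> D i" "i < n" for x y i
  proof -
    have xy: "orth_proj V x \<in> closure (h i)" "orth_proj V y \<in> closure (h i)"
      using that disjointed_subset[of P i] by (auto simp: D_def P_def)
    have hi: "bounded (h i)" "diameter (h i) \<le> (1/2)^k" using C(3)[of "h i"] h that(3) unfolding n_def by auto
    have "dist (orth_proj V x) (orth_proj V y) \<le> diameter (closure (h i))"
      by (rule diameter_bounded_bound) (use xy hi in auto)
    then show ?thesis using hi diameter_closure[of "h i"] by (simp add: dist_norm linear_diff[OF linear_orth_proj[OF V]])
  qed
  have "0 < n" using sum1 by (cases n) auto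
  have "1 = (\<Sum>i\<in>{0..<n}. prob (D i))\<^sup>2" using sum1 by simp
  also have "\<dots> \<le> (\<Sum>i\<in>{0..<n}. (prob (D i))\<^sup>2) * card {0..<n}" by (rule sum_squared_le_sum_of_squares)
  finally have "1 / real n \<le> (\<Sum>i\<in>{0..<n}. (prob (D i))\<^sup>2)" using \<open>0 < n\<close> by (simp add: field_simps)
  moreover have "1 / N \<le> 1 / real n" using C(2) \<open>0 < n\<close> N unfolding n_def by (intro divide_left_mono) auto
  ultimately have "1 / N \<le> (\<Sum>i\<in>{0..<n}. prob (D i) * prob (D i))" by (simp add: power2_eq_square)
  also have "\<dots> = (\<integral>y. (\<Sum>i\<in>{0..<n}. prob (D i) * indicator (D i) y) \<partial>\<mu>)"
    by (subst Bochner_Integration.integral_sum) (auto simp: sets_mu emeasure_eq_measure)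
  also have "\<dots> \<le> (\<integral>y. (\<integral>x. ?f x y \<partial>\<mu>) \<partial>\<mu>)"
  proof (rule integral_mono)
    show "integrable \<mu> (\<lambda>y. \<Sum>i = 0..<n. prob (D i) * indicat_real (D i) y)"
      by (intro Bochner_Integration.integrable_sum integrable_mult_right) (auto simp: sets_mu emeasure_eq_measure)
    show "integrable \<mu> (\<lambda>y. \<integral>x. ?f x y \<partial>\<mu>)"
      by (rule integrable_outer[OF fm, of 1]) (auto simp: indicator_def)
    fix y
    have nonneg: "0 \<le> (\<integral>x. ?f x y \<partial>\<mu>)" by (rule Bochner_Integration.integral_nonneg) simp
    show "(\<Sum>i = 0..<n. prob (D i) * indicat_real (D i) y) \<le> (\<integral>x. ?f x y \<partial>\<mu>)"
    proof (cases "\<exists>i<n. y \<in> D i")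
      case True
      then obtain i where i: "i < n" "y \<in> D i" by blast
      have "y \<notin> D j" if "j \<noteq> i" for j
        using disjoint_family_disjointed[of P] i(2) that unfolding D_def disjoint_family_on_def by blast
      then have "(\<Sum>j = 0..<n. prob (D j) * indicat_real (D j) y) = (\<Sum>j = 0..<n. if j = i then prob (D i) else 0)"
        using i by (intro sum.cong) auto
      also have "\<dots> = (\<integral>x. indicat_real (D i) x \<partial>\<mu>)" using i by (simp add: sets_mu)
      also have "\<dots> \<le> (\<integral>x. ?f x y \<partial>\<mu>)"
      proof (rule integral_mono)
        show "integrable \<mu> (\<lambda>x. ?f x y)" by (rule integrable_inner[OF fm, of 1]) (auto simp: indicator_def)
        show "integrable \<mu> (indicat_real (D i))" by (auto simp: sets_mu emeasure_eq_measure)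
        show "indicat_real (D i) x \<le> ?f x y" for x using close[OF _ i(2,1)] by (auto simp: indicator_def)
      qed
      finally show ?thesis .
    next
      case False
      then have "(\<Sum>i = 0..<n. prob (D i) * indicat_real (D i) y) = 0" by (intro sum.neutral) auto
      then show ?thesis using nonneg by simp
    qed
  qed
  finally show ?thesis .
qed

text \<open>The pair estimate is summed over the point masses, and the finite sum is moved inside
  both integrals to meet the kernel. The constant is chosen before E, \<open>\<mu>\<close>, k and N,
  so it serves all levels.\<close>

lemma net_content_covered_le:
  fixes s :: real and m p :: nat
  assumes s: "0 < s" and t: "t = real (m * (CARD('n) - m - 1)) + s"
  shows "\<exists>C>0. \<forall>(E :: (real ^ 'n) set) \<mu> k N. \<mu> \<in> prob_measures_on (closure E) \<longrightarrow> 0 < N \<longrightarrow>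
       (\<forall>x\<in>closure E. \<forall>y\<in>closure E. norm (x - y) \<le> 2^p) \<longrightarrow>
       net_content grass_label t {V \<in> grassmannian m. covered_by k N (orth_proj V ` E)}
         \<le> ennreal (C * N * energy s ((1/2)^k) \<mu>)"
proof -
  obtain C where C: "0 < C"
    "\<And>k A. A \<subseteq> (grassmannian m :: (real ^ 'n) set set) \<Longrightarrow> \<exists>F \<tau>. finite F \<and> F \<subseteq> A \<and> (\<forall>V. 0 \<le> \<tau> V)
      \<and> net_content grass_label t A \<le> ennreal (\<Sum>V\<in>F. \<tau> V)
      \<and> (\<forall>z. norm z \<le> 2^p \<longrightarrow>
            (\<Sum>V\<in>{V\<in>F. norm (orth_proj V z) \<le> 1 * (1/2)^k}. \<tau> V) \<le> C * profile_kernel s ((1/2)^k) z)"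
    using grassmannian_frostman[OF s _ t, of 1 p] by blast
  show ?thesis
  proof (intro exI[of _ C] conjI allI impI C(1))
    fix E :: "(real ^ 'n) set" and \<mu> k N
    assume \<mu>: "\<mu> \<in> prob_measures_on (closure E)" and N: "0 < (N::real)"
      and D: "\<forall>x\<in>closure E. \<forall>y\<in>closure E. norm (x - y) \<le> 2^p"
    interpret profile_measure \<mu> by (rule prob_measures_onD(1)[OF \<mu>])
    let ?A = "{V \<in> grassmannian m. covered_by k N (orth_proj V ` E)}"
    let ?r = "(1/2::real)^k"
    obtain F \<tau> where F: "finite F" "F \<subseteq> ?A" "\<And>V. 0 \<le> \<tau> V" "net_content grass_label t ?A \<le> ennreal (\<Sum>V\<in>F. \<tau> V)"
      and ker: "\<And>z. norm z \<le> 2^p \<Longrightarrow> (\<Sum>V\<in>{V\<in>F. norm (orth_proj V z) \<le> ?r}. \<tau> V) \<le> C * profile_kernel s ?r z"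
      using C(2)[of ?A k] by auto
    let ?f = "\<lambda>V z. indicator {z. norm (orth_proj V z) \<le> ?r} z :: real"
    have sub: "subspace V" if "V \<in> F" for V using that F(2) subspace_grass by blast
    have fm: "(\<lambda>(x, y). ?f V (x - y)) \<in> borel_measurable (borel \<Otimes>\<^sub>M borel)" if "V \<in> F" for V
    proof -
      note [measurable] = orth_proj_measurable[OF sub[OF that]]
      show ?thesis by measurable
    qed
    have int1: "integrable \<mu> (\<lambda>x. ?f V (x - y))" if "V \<in> F" for V y
      by (rule integrable_inner[OF fm[OF that], of 1]) (simp add: indicator_def)
    have int2: "integrable \<mu> (\<lambda>y. \<integral>x. ?f V (x - y) \<partial>\<mu>)" if "V \<in> F" for V
      by (rule integrable_outer[OF fm[OF that], of 1]) (simp add: indicator_def)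
    have "(\<Sum>V\<in>F. \<tau> V) * (1 / N) = (\<Sum>V\<in>F. \<tau> V * (1 / N))" by (rule sum_distrib_right)
    also have "\<dots> \<le> (\<Sum>V\<in>F. \<tau> V * (\<integral>y. (\<integral>x. ?f V (x - y) \<partial>\<mu>) \<partial>\<mu>))"
    proof (intro sum_mono mult_left_mono F(3))
      fix V assume "V \<in> F"
      then show "1 / N \<le> (\<integral>y. (\<integral>x. ?f V (x - y) \<partial>\<mu>) \<partial>\<mu>)"
        using F(2) by (intro covered_by_pair_integral[OF \<mu> sub _ N]) auto
    qed
    also have "\<dots> = (\<integral>y. (\<Sum>V\<in>F. \<tau> V * (\<integral>x. ?f V (x - y) \<partial>\<mu>)) \<partial>\<mu>)"
    proof -
      have "(\<integral>y. (\<Sum>V\<in>F. \<tau> V * (\<integral>x. ?f V (x - y) \<partial>\<mu>)) \<partial>\<mu>)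
          = (\<Sum>V\<in>F. (\<integral>y. \<tau> V * (\<integral>x. ?f V (x - y) \<partial>\<mu>) \<partial>\<mu>))"
        by (rule Bochner_Integration.integral_sum) (intro integrable_mult_right int2)
      then show ?thesis by (simp only: integral_mult_right_zero)
    qed
    also have "\<dots> = (\<integral>y. (\<integral>x. (\<Sum>V\<in>F. \<tau> V * ?f V (x - y)) \<partial>\<mu>) \<partial>\<mu>)"
      unfolding integral_mult_right_zero[symmetric]
      by (intro Bochner_Integration.integral_cong refl Bochner_Integration.integral_sum[symmetric] integrable_mult_right int1)
    also have "\<dots> \<le> (\<integral>y. (\<integral>x. C * profile_kernel s ?r (x - y) \<partial>\<mu>) \<partial>\<mu>)"
    proof -
      \<comment> \<open>The kernel bound \<open>ker\<close> holds for |z| <= 2^p only, which is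
        guaranteed for differences of points of the closure; so the integrands are compared almost
        everywhere.\<close>
      have AEK: "AE x in \<mu>. x \<in> closure E" by (rule prob_measures_onD(2)[OF \<mu> closed_closure])
      have km: "(\<lambda>(x, y). C * profile_kernel s ?r (x - y :: real ^ 'n)) \<in> borel_measurable (borel \<Otimes>\<^sub>M borel)"
        by measurable
      have kb: "\<bar>C * profile_kernel s ?r z\<bar> \<le> C" for z :: "real ^ 'n"
        using C(1) profile_kernel_nonneg[of ?r s z] profile_kernel_le_1[of s ?r z] by (simp add: abs_mult)
      have sm: "(\<lambda>(x, y). \<Sum>V\<in>F. \<tau> V * ?f V (x - y)) \<in> borel_measurable (borel \<Otimes>\<^sub>M borel)"
        unfolding case_prod_beta by (intro borel_measurable_sum borel_measurable_times borel_measurable_const fm[unfolded case_prod_beta])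
      have sb: "\<bar>\<Sum>V\<in>F. \<tau> V * ?f V z\<bar> \<le> (\<Sum>V\<in>F. \<tau> V)" for z
        by (rule order_trans[OF sum_abs sum_mono]) (use F(3) in \<open>auto simp: abs_mult indicator_def\<close>)
      have feq: "(\<Sum>V\<in>F. \<tau> V * ?f V z) = (\<Sum>V\<in>{V\<in>F. norm (orth_proj V z) \<le> ?r}. \<tau> V)" for z
      proof -
        have "(\<Sum>V\<in>F. \<tau> V * ?f V z) = (\<Sum>V\<in>F. if norm (orth_proj V z) \<le> ?r then \<tau> V else 0)"
          by (rule sum.cong) auto
        also have "\<dots> = (\<Sum>V\<in>{V\<in>F. norm (orth_proj V z) \<le> ?r}. \<tau> V)"
          by (rule sum.inter_filter[OF F(1), symmetric])
        finally show ?thesis .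
      qed
      show ?thesis
      proof (rule integral_mono_AE)
        show "AE y in \<mu>. (\<integral>x. (\<Sum>V\<in>F. \<tau> V * ?f V (x - y)) \<partial>\<mu>) \<le> (\<integral>x. C * profile_kernel s ?r (x - y) \<partial>\<mu>)"
          using AEK
        proof eventually_elim
          fix y assume y: "y \<in> closure E"
          show "(\<integral>x. (\<Sum>V\<in>F. \<tau> V * ?f V (x - y)) \<partial>\<mu>) \<le> (\<integral>x. C * profile_kernel s ?r (x - y) \<partial>\<mu>)"
          proof (rule integral_mono_AE)
            show "AE x in \<mu>. (\<Sum>V\<in>F. \<tau> V * ?f V (x - y)) \<le> C * profile_kernel s ?r (x - y)"
              using AEK by eventually_elim (use ker D y feq in auto)
          qed (rule integrable_inner[OF sm sb] integrable_inner[OF km kb])+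
        qed
      qed (rule integrable_outer[OF sm sb] integrable_outer[OF km kb])+
    qed
    also have "\<dots> = C * energy s ?r \<mu>" by (simp add: energy_def)
    finally have "(\<Sum>V\<in>F. \<tau> V) \<le> C * N * energy s ?r \<mu>" using N by (simp add: field_simps)
    then show "net_content grass_label t ?A \<le> ennreal (C * N * energy s ?r \<mu>)"
      using F(4) by (meson ennreal_leI order_trans)
  qed
qed

section \<open>Positivity, monotonicity and near-minimisers of capacities\<close>

lemma profile_capacity_eq:
  "profile_capacity s r E = 1 / (INF \<mu>\<in>prob_measures_on (closure E). energy s r \<mu>)"
  by (simp add: profile_capacity_def energy_def)

lemma energy_ge:
  fixes E :: "'a::euclidean_space set"
  assumes \<mu>: "\<mu> \<in> prob_measures_on (closure E)" and "0 < r" "0 \<le> s"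
    and D: "\<And>x y. x \<in> closure E \<Longrightarrow> y \<in> closure E \<Longrightarrow> norm (x - y) \<le> D" "0 < D"
  shows "min 1 ((r / D) powr s) \<le> energy s r \<mu>"
proof -
  interpret profile_measure \<mu> by (rule prob_measures_onD(1)[OF \<mu>])
  let ?c = "min 1 ((r / D) powr s)"
  have AEK: "AE x in \<mu>. x \<in> closure E" by (rule prob_measures_onD(2)[OF \<mu> closed_closure])
  have kb: "\<bar>profile_kernel s r z\<bar> \<le> 1" for z :: 'a
    using \<open>0 < r\<close> profile_kernel_nonneg[of r s z] profile_kernel_le_1[of s r z] by simp
  have "(\<integral>y. (\<integral>x. ?c \<partial>\<mu>) \<partial>\<mu>) \<le> energy s r \<mu>"
    unfolding energy_def
  proof (rule integral_mono_AE)
    show "AE y in \<mu>. (\<integral>x. ?c \<partial>\<mu>) \<le> (\<integral>x. profile_kernel s r (x - y) \<partial>\<mu>)"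
      using AEK
    proof eventually_elim
      fix y assume y: "y \<in> closure E"
      show "(\<integral>x. ?c \<partial>\<mu>) \<le> (\<integral>x. profile_kernel s r (x - y) \<partial>\<mu>)"
      proof (rule integral_mono_AE)
        show "AE x in \<mu>. ?c \<le> profile_kernel s r (x - y)"
          using AEK by eventually_elim (use D y assms(2,3) in \<open>intro profile_kernel_ge; auto\<close>)
      qed (auto intro: integrable_inner[OF kernel_pair_measurable kb])
    qed
  qed (auto intro: integrable_outer[OF kernel_pair_measurable kb])
  then show ?thesis by simp
qed

context
  fixes E :: "'a::euclidean_space set" and s :: real
  assumes E: "bounded E" "E \<noteq> {}" and s: "0 \<le> s"
begin

text \<open>On a bounded set the kernel stays away from 0. A positive infimum makes the capacity a
  genuine reciprocal and not the default value 1 / 0 = 0.\<close>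

lemma energy_inf_pos:
  assumes "0 < r"
  shows "0 < (INF \<mu>\<in>prob_measures_on (closure E). energy s r \<mu>)"
    and "bdd_below (energy s r ` prob_measures_on (closure E))"
    and "prob_measures_on (closure E) \<noteq> {}"
proof -
  have "bounded (closure E)" using E(1) by (rule bounded_closure)
  then obtain B where B: "\<And>x. x \<in> closure E \<Longrightarrow> norm x \<le> B" "0 < B" by (auto simp: bounded_pos)
  have D: "norm (x - y) \<le> 2 * B" if "x \<in> closure E" "y \<in> closure E" for x y
    using norm_triangle_ineq4[of x y] B(1)[OF that(1)] B(1)[OF that(2)] by linarith
  let ?c = "min 1 ((r / (2 * B)) powr s)"
  have ge: "?c \<le> energy s r \<mu>" if "\<mu> \<in> prob_measures_on (closure E)" for \<mu>
    by (rule energy_ge[OF that assms s D]) (use B in auto)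
  show ne: "prob_measures_on (closure E) \<noteq> {}"
    using E(2) closure_subset prob_measures_on_nonempty[OF _ closed_closure] by blast
  show "bdd_below (energy s r ` prob_measures_on (closure E))" by (rule bdd_belowI2[of _ ?c]) (rule ge)
  have "0 < ?c" using assms B by simp
  also have "?c \<le> (INF \<mu>\<in>prob_measures_on (closure E). energy s r \<mu>)"
    by (rule cINF_greatest[OF ne ge])
  finally show "0 < (INF \<mu>\<in>prob_measures_on (closure E). energy s r \<mu>)" .
qed

lemma profile_capacity_pos: "0 < r \<Longrightarrow> 0 < profile_capacity s r E"
  unfolding profile_capacity_eq using energy_inf_pos by simp

lemma profile_capacity_antimono:
  assumes "0 < r" "r \<le> r'"
  shows "profile_capacity s r' E \<le> profile_capacity s r E"
proof -
  have "(INF \<mu>\<in>prob_measures_on (closure E). energy s r \<mu>) \<le> (INF \<mu>\<in>prob_measures_on (closure E). energy s r' \<mu>)"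
    using assms s profile_measure.energy_mono[OF prob_measures_onD(1), of _ "closure E" r r' s]
    by (intro cINF_mono energy_inf_pos) auto
  then show ?thesis
    unfolding profile_capacity_eq using energy_inf_pos(1)[OF assms(1)] by (intro divide_left_mono) auto
qed

text \<open>The factor 2 stands in for a minimising measure: twice a positive infimum lies strictly
  above it.\<close>

lemma exists_small_energy:
  assumes "0 < r"
  obtains \<mu> where "\<mu> \<in> prob_measures_on (closure E)" "energy s r \<mu> \<le> 2 / profile_capacity s r E"
proof -
  let ?I = "INF \<mu>\<in>prob_measures_on (closure E). energy s r \<mu>"
  have "?I < 2 * ?I" using energy_inf_pos(1)[OF assms] by simp
  then obtain \<mu> where "\<mu> \<in> prob_measures_on (closure E)" "energy s r \<mu> < 2 * ?I"
    using cINF_less_iff[OF energy_inf_pos(3,2)[OF assms], of "2 * ?I"] by blast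
  then show ?thesis using that by (simp add: profile_capacity_eq less_imp_le)
qed

end

lemma net_content_frequently_covered:
  fixes E :: "(real ^ 'n) set" and s :: real and m :: nat
  assumes E: "bounded E" "E \<noteq> {}" and s: "0 < s" and t: "t = real (m * (CARD('n) - m - 1)) + s"
    and \<epsilon>: "0 < \<epsilon>"
  shows "net_content grass_label t {V \<in> grassmannian m. \<exists>\<^sub>F k in sequentially.
     covered_by k (profile_capacity s ((1/2)^k) E * (1/2) powr (\<epsilon> * real k)) (orth_proj V ` E)} = 0"
proof -
  have "bounded (closure E)" using E(1) by (rule bounded_closure)
  then obtain B where B: "\<And>x. x \<in> closure E \<Longrightarrow> norm x \<le> B" "0 < B" by (auto simp: bounded_pos)
  obtain p where p: "2 * B < 2 ^ p" using real_arch_pow[of 2 "2 * B"] by auto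
  have D: "norm (x - y) \<le> 2 ^ p" if "x \<in> closure E" "y \<in> closure E" for x y
    using norm_triangle_ineq4[of x y] B(1)[OF that(1)] B(1)[OF that(2)] p by linarith
  obtain C where C: "0 < C" and
    Cb: "\<forall>(E :: (real ^ 'n) set) \<mu> k N. \<mu> \<in> prob_measures_on (closure E) \<longrightarrow> 0 < N \<longrightarrow>
       (\<forall>x\<in>closure E. \<forall>y\<in>closure E. norm (x - y) \<le> 2^p) \<longrightarrow>
       net_content grass_label t {V \<in> grassmannian m. covered_by k N (orth_proj V ` E)}
         \<le> ennreal (C * N * energy s ((1/2)^k) \<mu>)"
    using net_content_covered_le[OF s t, of p] by (elim exE conjE)
  define N where "N k = profile_capacity s ((1/2)^k) E * (1/2) powr (\<epsilon> * real k)" for k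
  define A where "A k = {V \<in> grassmannian m. covered_by k (N k) (orth_proj V ` E)}" for k
  have "net_content grass_label t {V. \<exists>\<^sub>F k in sequentially. V \<in> A k} = 0"
  proof (rule net_content_limsup_eq_0)
    fix k
    let ?c = "profile_capacity s ((1/2)^k) E"
    have c: "0 < ?c" using profile_capacity_pos[OF E, of s] s by simp
    then have N: "0 < N k" by (simp add: N_def)
    obtain \<mu> where \<mu>: "\<mu> \<in> prob_measures_on (closure E)" "energy s ((1/2)^k) \<mu> \<le> 2 / ?c"
      using exists_small_energy[OF E, of s "(1/2)^k"] s by auto
    have "net_content grass_label t (A k) \<le> ennreal (C * N k * energy s ((1/2)^k) \<mu>)"
      unfolding A_def by (rule Cb[rule_format, OF \<mu>(1) N]) (rule D)
    also have "\<dots> \<le> ennreal (C * N k * (2 / ?c))"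
      using C N \<mu>(2) by (intro ennreal_leI mult_left_mono) auto
    also have "C * N k * (2 / ?c) = 2 * C * ((1/2) powr \<epsilon>) ^ k"
      using c by (simp add: N_def powr_powr mult.commute flip: powr_realpow)
    finally show "net_content grass_label t (A k) \<le> ennreal (2 * C * ((1/2) powr \<epsilon>) ^ k)" .
  next
    have "(1/2::real) powr \<epsilon> < 1" using powr_less_mono2[of \<epsilon> "1/2" 1] \<epsilon> by simp
    then show "summable (\<lambda>k. 2 * C * ((1/2) powr \<epsilon>) ^ k)"
      by (intro summable_mult summable_geometric) simp
  qed (use C in simp)
  note null = this
  have "{V \<in> grassmannian m. \<exists>\<^sub>F k in sequentially.
     covered_by k (profile_capacity s ((1/2)^k) E * (1/2) powr (\<epsilon> * real k)) (orth_proj V ` E)}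
    \<subseteq> {V. \<exists>\<^sub>F k in sequentially. V \<in> A k}"
    by (auto simp: A_def N_def)
  from net_content_mono[OF this, of grass_label t] null show ?thesis by simp
qed

section \<open>Covering numbers and passage from real scales to powers of 1/2\<close>

lemma covering_number_works:
  fixes S :: "'a::euclidean_space set"
  assumes "bounded S" "0 < r"
  shows "\<exists>\<C>. finite \<C> \<and> card \<C> = covering_number r S \<and> (\<forall>U\<in>\<C>. bounded U \<and> diameter U = r) \<and> S \<subseteq> \<Union>\<C>"
proof -
  have c: "compact (closure S)" using assms(1) by simp
  obtain K where K: "K \<subseteq> closure S" "finite K" "closure S \<subseteq> (\<Union>x\<in>K. ball x (r/2))"
    by (rule compactE_image[OF c, of "closure S" "\<lambda>x. ball x (r/2)"]) (use \<open>0 < r\<close> in auto)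
  \<comment> \<open>Closed balls of radius r/2 have diameter exactly r, as
    \<open>covering_number\<close> demands.\<close>
  let ?\<C> = "(\<lambda>x. cball x (r/2)) ` K"
  have "finite ?\<C> \<and> (\<forall>U\<in>?\<C>. bounded U \<and> diameter U = r) \<and> S \<subseteq> \<Union>?\<C>"
  proof (intro conjI ballI)
    show "S \<subseteq> \<Union>?\<C>"
    proof
      fix x assume "x \<in> S"
      then obtain y where "y \<in> K" "x \<in> ball y (r/2)" using K(3) closure_subset by blast
      then show "x \<in> \<Union>?\<C>" by (auto intro: less_imp_le)
    qed
  qed (use K \<open>0 < r\<close> in auto)
  then have "finite ?\<C> \<and> card ?\<C> = card ?\<C> \<and> (\<forall>U\<in>?\<C>. bounded U \<and> diameter U = r) \<and> S \<subseteq> \<Union>?\<C>" by simp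
  then have "\<exists>k \<C>. finite \<C> \<and> card \<C> = k \<and> (\<forall>U\<in>\<C>. bounded U \<and> diameter U = r) \<and> S \<subseteq> \<Union>\<C>"
    by (intro exI)
  then show ?thesis unfolding covering_number_def by (rule LeastI_ex)
qed

lemma covering_number_le:
  assumes "finite \<C>" "\<And>U. U \<in> \<C> \<Longrightarrow> bounded U \<and> diameter U = r" "S \<subseteq> \<Union>\<C>"
  shows "covering_number r S \<le> card \<C>"
  unfolding covering_number_def by (rule Least_le, rule exI[of _ \<C>]) (simp add: assms)

lemma covering_number_ge_1:
  fixes S :: "'a::euclidean_space set"
  assumes "bounded S" "S \<noteq> {}" "0 < r"
  shows "1 \<le> covering_number r S"
proof -
  obtain \<C> where C: "finite \<C>" "card \<C> = covering_number r S" "S \<subseteq> \<Union>\<C>"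
    using covering_number_works[OF assms(1,3)] by (elim exE conjE)
  then have "\<C> \<noteq> {}" using assms(2) by auto
  then show ?thesis using C(1,2) by (metis One_nat_def Suc_leI card_gt_0_iff)
qed

text \<open>Closures of the covering sets still have diameter r, and a finite union of them is
  closed.\<close>

lemma covering_number_mono_closure:
  fixes S T :: "'a::euclidean_space set"
  assumes "S \<subseteq> closure T" "bounded T" "0 < r"
  shows "covering_number r S \<le> covering_number r T"
proof -
  obtain \<C> where C: "finite \<C>" "card \<C> = covering_number r T" "\<And>U. U \<in> \<C> \<Longrightarrow> bounded U \<and> diameter U = r" "T \<subseteq> \<Union>\<C>"
    using covering_number_works[OF assms(2,3)] by auto
  have "closure T \<subseteq> \<Union>(closure ` \<C>)"
  proof (rule closure_minimal)
    show "T \<subseteq> \<Union>(closure ` \<C>)" 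
    proof
      fix x assume "x \<in> T"
      then obtain U where "U \<in> \<C>" "x \<in> U" using C(4) by blast
      then show "x \<in> \<Union>(closure ` \<C>)" using closure_subset[of U] by auto
    qed
    show "closed (\<Union>(closure ` \<C>))" using C(1) by (intro closed_Union) auto
  qed
  then have "covering_number r S \<le> card (closure ` \<C>)"
    using C(1,3) assms(1) by (intro covering_number_le) (auto simp: diameter_closure)
  also have "\<dots> \<le> card \<C>" by (rule card_image_le[OF C(1)])
  finally show ?thesis using C(2) by simp
qed

lemma covered_by_mono: "covered_by k N S \<Longrightarrow> N \<le> N' \<Longrightarrow> covered_by k N' S"
  unfolding covered_by_def by (meson order_trans)

lemma covered_by_covering_number:
  fixes S :: "'a::euclidean_space set"
  assumes "bounded S" "0 < r" "r \<le> (1/2)^k" "real (covering_number r S) \<le> N"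
  shows "covered_by k N S"
proof -
  obtain \<C> where "finite \<C>" "card \<C> = covering_number r S" "\<forall>U\<in>\<C>. bounded U \<and> diameter U = r" "S \<subseteq> \<Union>\<C>"
    using covering_number_works[OF assms(1,2)] by (elim exE conjE)
  then show ?thesis unfolding covered_by_def using assms(3,4) by (intro exI[of _ \<C>]) simp
qed

lemma dyadic_scale_ln:
  assumes "0 < r" "r \<le> (1/2)^k" "(1/2)^k \<le> 2 * (r::real)"
  shows "real k * ln 2 \<le> - ln r" "- ln r \<le> (real k + 1) * ln 2"
proof -
  have "ln r \<le> ln ((1/2::real)^k)" using assms by simp
  then show "real k * ln 2 \<le> - ln r" by (simp add: ln_realpow ln_div)
  have "ln ((1/2::real)^k) \<le> ln (2 * r)" using assms by (subst ln_le_cancel_iff) auto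
  then show "- ln r \<le> (real k + 1) * ln 2" using assms(1) by (simp add: ln_realpow ln_div ln_mult algebra_simps)
qed

text \<open>For large k the gap q' - q outweighs both the constant factor 2^(2a) and the loss
  2^(k/(j+1)). Only losses with rate 1/(j+1) are offered, so that the exceptional sets become
  countable unions.\<close>

lemma frequently_covered_of_exponents:
  assumes ca: "\<And>k. 0 < c k" and q: "q < q'"
    and freq: "\<exists>\<^sub>F k in sequentially. covered_by k (2 powr (q * real k + a)) S \<and> 2 powr (q' * real k - a) \<le> c k"
  shows "\<exists>j. \<exists>\<^sub>F k in sequentially. covered_by k (c k * (1/2) powr (1 / real (Suc j) * real k)) S"
proof -
  obtain j where j: "1 / real (Suc j) < q' - q" using q nat_approx_posE[of "q' - q"] by auto
  define d where "d = q' - q - 1 / real (Suc j)"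
  have d: "d > 0" using j by (simp add: d_def)
  have "\<forall>\<^sub>F k in sequentially. 2 * a / d \<le> real k"
    by (rule eventually_compose_filterlim[OF eventually_ge_at_top filterlim_real_sequentially])
  then have "\<exists>\<^sub>F k in sequentially. covered_by k (c k * (1/2) powr (1 / real (Suc j) * real k)) S"
  proof (rule frequently_rev_mp[OF freq, OF eventually_mono], intro impI)
    fix k assume k: "2 * a / d \<le> real k"
      and *: "covered_by k (2 powr (q * real k + a)) S \<and> 2 powr (q' * real k - a) \<le> c k"
    have "2 * a \<le> d * real k" using k d by (simp add: field_simps)
    then have "q * real k + a \<le> (q' * real k - a) + - (1 / real (Suc j) * real k)"
      unfolding d_def by (simp add: left_diff_distrib)
    then have "2 powr (q * real k + a) \<le> 2 powr ((q' * real k - a) + - (1 / real (Suc j) * real k))" by simp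
    also have "\<dots> = 2 powr (q' * real k - a) * (1/2) powr (1 / real (Suc j) * real k)"
      by (simp add: powr_add powr_diff powr_minus powr_divide inverse_eq_divide)
    also have "\<dots> \<le> c k * (1/2) powr (1 / real (Suc j) * real k)"
      using * by (intro mult_right_mono) auto
    finally show "covered_by k (c k * (1/2) powr (1 / real (Suc j) * real k)) S"
      using * covered_by_mono by blast
  qed
  then show ?thesis by blast
qed

lemma two_powr_exp: "(2::real) powr x = exp (x * ln 2)"
  by (simp add: powr_def mult.commute)

lemma scale_times_bound:
  assumes "real k * ln 2 \<le> x" "x \<le> (real k + 1) * ln (2::real)"
  shows "q * x \<le> (q * real k + \<bar>q\<bar>) * ln 2" "(q * real k - \<bar>q\<bar>) * ln 2 \<le> q * x"
proof -
  define y where "y = x - real k * ln 2"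
  have y: "0 \<le> y" "y \<le> ln 2" using assms by (auto simp: y_def algebra_simps)
  have "\<bar>q * y\<bar> \<le> \<bar>q\<bar> * ln 2" unfolding abs_mult using y by (intro mult_left_mono) auto
  moreover have "q * x = q * real k * ln 2 + q * y" by (simp add: y_def algebra_simps)
  ultimately show "q * x \<le> (q * real k + \<bar>q\<bar>) * ln 2" "(q * real k - \<bar>q\<bar>) * ln 2 \<le> q * x"
    by (auto simp: algebra_simps abs_le_iff)
qed

lemma ln_quotient_less_iff:
  fixes N r q :: real
  assumes "0 < r" "r < 1"
  shows "ln N / - ln r < q \<longleftrightarrow> ln N < q * - ln r" "q < ln N / - ln r \<longleftrightarrow> q * - ln r < ln N"
  using assms by (intro pos_divide_less_eq pos_less_divide_eq; simp)+

text \<open>Two real scales are rounded to level k in opposite directions: a cover at scale r serves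
  for 2^-k >= r, whereas the antitone c satisfies c(2^-k) >= c(r') for r' >= 2^-k. In both uses one
  of the two scales is 2^-k itself.\<close>

lemma box_exponents_covered:
  fixes S :: "'a::euclidean_space set"
  assumes S: "bounded S" "S \<noteq> {}" and q: "q < q'"
    and cpos: "\<And>r. 0 < r \<Longrightarrow> 0 < c r" and cmono: "\<And>r r'. 0 < r \<Longrightarrow> r \<le> r' \<Longrightarrow> c r' \<le> c r"
    and r: "0 < r" "r < 1" "0 < r'" "r' < 1" "r \<le> (1/2)^k" "(1/2)^k \<le> 2 * r" "(1/2)^k \<le> r'" "r' \<le> 2 * (1/2)^k"
    and N: "ln (real (covering_number r S)) / - ln r < q" and c: "q' < ln (c r') / - ln r'"
  shows "covered_by k (2 powr (q * real k + (\<bar>q\<bar> + \<bar>q'\<bar>))) S \<and> 2 powr (q' * real k - (\<bar>q\<bar> + \<bar>q'\<bar>)) \<le> c ((1/2)^k)"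
proof
  let ?N = "real (covering_number r S)"
  have N1: "1 \<le> ?N" using covering_number_ge_1[OF S r(1)] by simp
  have "ln ?N < q * - ln r" using N ln_quotient_less_iff(1)[OF r(1,2)] by blast
  also have "\<dots> \<le> (q * real k + \<bar>q\<bar>) * ln 2"
    using scale_times_bound(1)[OF dyadic_scale_ln[OF r(1,5,6)]] .
  also have "\<dots> \<le> (q * real k + (\<bar>q\<bar> + \<bar>q'\<bar>)) * ln 2" by (intro mult_right_mono) auto
  finally have "?N \<le> 2 powr (q * real k + (\<bar>q\<bar> + \<bar>q'\<bar>))"
    unfolding two_powr_exp using N1 by (metis exp_ln exp_less_cancel_iff less_imp_le less_le_trans zero_less_one)
  then show "covered_by k (2 powr (q * real k + (\<bar>q\<bar> + \<bar>q'\<bar>))) S"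
    by (rule covered_by_covering_number[OF S(1) r(1,5)])
  have r'2: "0 < r'/2" "r'/2 \<le> (1/2)^k" "(1/2)^k \<le> 2 * (r'/2)" using r by auto
  have ln': "- ln (r'/2) = - ln r' + ln 2" using r(3) by (simp add: ln_div)
  have "real k * ln 2 - ln 2 \<le> - ln r'" "- ln r' \<le> real k * ln 2"
    using dyadic_scale_ln[OF r'2] unfolding ln' by (auto simp: algebra_simps)
  then have "\<bar>- ln r' - real k * ln 2\<bar> \<le> ln 2" by (auto simp: abs_le_iff)
  then have "\<bar>q' * (- ln r' - real k * ln 2)\<bar> \<le> \<bar>q'\<bar> * ln 2" unfolding abs_mult by (rule mult_left_mono) simp
  then have "q' * real k * ln 2 - \<bar>q'\<bar> * ln 2 \<le> q' * - ln r'"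
    by (simp add: right_diff_distrib mult.assoc abs_le_iff)
  also have "\<dots> < ln (c r')" using c ln_quotient_less_iff(2)[OF r(3,4)] by blast
  finally have *: "q' * real k * ln 2 - \<bar>q'\<bar> * ln 2 < ln (c r')" .
  have "0 \<le> \<bar>q\<bar> * ln (2::real)" by simp
  with * have "(q' * real k - (\<bar>q\<bar> + \<bar>q'\<bar>)) * ln 2 < ln (c r')"
    unfolding left_diff_distrib distrib_right by linarith
  then have "2 powr (q' * real k - (\<bar>q\<bar> + \<bar>q'\<bar>)) < c r'"
    unfolding two_powr_exp using cpos[OF r(3)] by (metis exp_ln exp_less_cancel_iff)
  also have "\<dots> \<le> c ((1/2)^k)" using r by (intro cmono) auto
  finally show "2 powr (q' * real k - (\<bar>q\<bar> + \<bar>q'\<bar>)) \<le> c ((1/2)^k)" by simp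
qed

text \<open>For lower dimensions the covers are small at arbitrarily small scales and c is large at
  all small scales; for upper dimensions it is the other way round. Either way both hold together at
  infinitely many levels.\<close>

lemma
  fixes S :: "'a::euclidean_space set" and c :: "real \<Rightarrow> real"
  assumes S: "bounded S" "S \<noteq> {}"
    and cpos: "\<And>r. 0 < r \<Longrightarrow> 0 < c r" and cmono: "\<And>r r'. 0 < r \<Longrightarrow> r \<le> r' \<Longrightarrow> c r' \<le> c r"
  shows frequently_covered_lower: "lower_box_dim S < Liminf (at_right 0) (\<lambda>r. ereal (ln (c r) / - ln r)) \<Longrightarrow>
      \<exists>j. \<exists>\<^sub>F k in sequentially. covered_by k (c ((1/2)^k) * (1/2) powr (1 / real (Suc j) * real k)) S"
    and frequently_covered_upper: "upper_box_dim S < Limsup (at_right 0) (\<lambda>r. ereal (ln (c r) / - ln r)) \<Longrightarrow>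
      \<exists>j. \<exists>\<^sub>F k in sequentially. covered_by k (c ((1/2)^k) * (1/2) powr (1 / real (Suc j) * real k)) S"
proof -
  let ?N = "\<lambda>r. ln (real (covering_number r S)) / - ln r" and ?c = "\<lambda>r. ln (c r) / - ln r"
  have ck: "0 < c ((1/2)^k)" for k by (rule cpos) simp
  have lt: "k0 < k" if "(1/2::real)^k < (1/2)^k0" for k k0
    using that by (subst (asm) power_strict_decreasing_iff) auto
  {
    assume "lower_box_dim S < Liminf (at_right 0) (\<lambda>r. ereal (?c r))"
    then obtain q' where q': "lower_box_dim S < ereal q'" "ereal q' < Liminf (at_right 0) (\<lambda>r. ereal (?c r))"
      using ereal_dense2 by blast
    then obtain q where q: "lower_box_dim S < ereal q" "q < q'" using ereal_dense2[OF q'(1)] by auto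
    obtain b where b: "b > 0" "\<And>r. 0 < r \<Longrightarrow> r < b \<Longrightarrow> q' < ?c r"
      using less_LiminfD[OF q'(2)] unfolding eventually_at_right_field by auto
    have "\<not> (\<forall>\<^sub>F r in at_right 0. ereal q \<le> ereal (?N r))"
      using q(1) Liminf_bounded[of "ereal q" "\<lambda>r. ereal (?N r)" "at_right 0"] unfolding lower_box_dim_def
      by (meson not_less)
    then have freqN: "\<exists>r>0. r < e \<and> ?N r < q" if "0 < e" for e
      using that unfolding eventually_at_right_field ereal_less_eq by (meson not_less)
    have "\<exists>\<^sub>F k in sequentially. covered_by k (2 powr (q * real k + (\<bar>q\<bar> + \<bar>q'\<bar>))) S
        \<and> 2 powr (q' * real k - (\<bar>q\<bar> + \<bar>q'\<bar>)) \<le> c ((1/2)^k)"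
      unfolding frequently_sequentially
    proof
      fix k0
      \<comment> \<open>Since 2^-k < 2r, the bound r < 2^-k0 / 4 pushes the level k beyond k0; r <
        b/2 keeps 2^-k below b.\<close>
      obtain r where r: "0 < r" "r < min (b/2) ((1/2)^k0 / 4)" "?N r < q"
        using freqN[of "min (b/2) ((1/2)^k0 / 4)"] b(1) by auto
      have "(1/2::real)^k0 \<le> 1" by (rule power_le_one) auto
      then have r1: "r < 1/2" using r by simp
      obtain k where k: "r \<le> (1/2)^k" "(1/2)^k < 2 * r" using dyadic_scale[of r] r r1 by auto
      have "k0 < k" by (rule lt) (use k r in linarith)
      moreover have "q' < ?c ((1/2)^k)" using k r by (intro b(2)) auto
      ultimately show "\<exists>k\<ge>k0. covered_by k (2 powr (q * real k + (\<bar>q\<bar> + \<bar>q'\<bar>))) S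
          \<and> 2 powr (q' * real k - (\<bar>q\<bar> + \<bar>q'\<bar>)) \<le> c ((1/2)^k)"
        using box_exponents_covered[where c=c and r=r and r'="(1/2)^k" and k=k, OF S q(2) cpos cmono] k r r1
        by (intro exI[of _ k]) (auto simp: less_imp_le)
    qed
    from frequently_covered_of_exponents[where c="\<lambda>k. c ((1/2)^k)", OF ck q(2) this]
    show "\<exists>j. \<exists>\<^sub>F k in sequentially. covered_by k (c ((1/2)^k) * (1/2) powr (1 / real (Suc j) * real k)) S" .
  next
    assume "upper_box_dim S < Limsup (at_right 0) (\<lambda>r. ereal (?c r))"
    then obtain q where q: "upper_box_dim S < ereal q" "ereal q < Limsup (at_right 0) (\<lambda>r. ereal (?c r))"
      using ereal_dense2 by blast
    then obtain q' where q': "q < q'" "ereal q' < Limsup (at_right 0) (\<lambda>r. ereal (?c r))"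
      using ereal_dense2[OF q(2)] by auto
    obtain b where b: "b > 0" "\<And>r. 0 < r \<Longrightarrow> r < b \<Longrightarrow> ?N r < q"
      using Limsup_lessD[OF q(1)[unfolded upper_box_dim_def]] unfolding eventually_at_right_field by auto
    have "\<not> (\<forall>\<^sub>F r in at_right 0. ereal (?c r) \<le> ereal q')"
      using q'(2) Limsup_bounded[of "\<lambda>r. ereal (?c r)" "ereal q'" "at_right 0"] by (meson not_less)
    then have freqc: "\<exists>r>0. r < e \<and> q' < ?c r" if "0 < e" for e
      using that unfolding eventually_at_right_field ereal_less_eq by (meson not_less)
    have "\<exists>\<^sub>F k in sequentially. covered_by k (2 powr (q * real k + (\<bar>q\<bar> + \<bar>q'\<bar>))) S
        \<and> 2 powr (q' * real k - (\<bar>q\<bar> + \<bar>q'\<bar>)) \<le> c ((1/2)^k)"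
      unfolding frequently_sequentially
    proof
      fix k0
      obtain r where r: "0 < r" "r < min b ((1/2)^k0 / 4)" "q' < ?c r"
        using freqc[of "min b ((1/2)^k0 / 4)"] b(1) by auto
      have "(1/2::real)^k0 \<le> 1" by (rule power_le_one) auto
      then have r1: "r < 1/2" using r by simp
      obtain k where k: "r / 2 \<le> (1/2)^k" "(1/2)^k < 2 * (r / 2)" using dyadic_scale[of "r/2"] r r1 by auto
      have "k0 < k" by (rule lt) (use k r in linarith)
      moreover have "?N ((1/2)^k) < q" using k r by (intro b(2)) auto
      ultimately show "\<exists>k\<ge>k0. covered_by k (2 powr (q * real k + (\<bar>q\<bar> + \<bar>q'\<bar>))) S
          \<and> 2 powr (q' * real k - (\<bar>q\<bar> + \<bar>q'\<bar>)) \<le> c ((1/2)^k)"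
        using box_exponents_covered[where c=c and r="(1/2)^k" and r'=r and k=k, OF S q'(1) cpos cmono] k r r1
        by (intro exI[of _ k]) (auto simp: less_imp_le)
    qed
    from frequently_covered_of_exponents[where c="\<lambda>k. c ((1/2)^k)", OF ck q'(1) this]
    show "\<exists>j. \<exists>\<^sub>F k in sequentially. covered_by k (c ((1/2)^k) * (1/2) powr (1 / real (Suc j) * real k)) S" .
  }
qed

lemma bounded_orth_proj_image:
  assumes "subspace V" "bounded E"
  shows "bounded (orth_proj V ` E)"
  using linear_orth_proj[OF assms(1)] assms(2) by (simp add: bounded_linear_image linear_conv_bounded_linear)

lemma
  fixes E :: "(real ^ 'n) set" and s :: real and m :: nat
  assumes E: "bounded E" "E \<noteq> {}" and s: "0 < s" and t: "t = real (m * (CARD('n) - m - 1)) + s"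
  shows lower_box_exceptional_null: "net_content grass_label t
      {V \<in> grassmannian m. lower_box_dim (orth_proj V ` E) < lower_box_profile s E} = 0" (is "?L")
    and upper_box_exceptional_null: "net_content grass_label t
      {V \<in> grassmannian m. upper_box_dim (orth_proj V ` E) < upper_box_profile s E} = 0" (is "?U")
proof -
  define A where "A j = {V \<in> grassmannian m. \<exists>\<^sub>F k in sequentially.
     covered_by k (profile_capacity s ((1/2)^k) E * (1/2) powr (1 / real (Suc j) * real k)) (orth_proj V ` E)}" for j
  have null: "net_content grass_label t (\<Union>j. A j) = 0"
  proof (rule net_content_UN_eq_0)
    fix j
    show "net_content grass_label t (A j) = 0"
      unfolding A_def by (rule net_content_frequently_covered[OF E s t]) simp
  qed simp
  have "{V \<in> grassmannian m. lower_box_dim (orth_proj V ` E) < lower_box_profile s E} \<subseteq> (\<Union>j. A j)"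
  proof
    fix V assume V: "V \<in> {V \<in> grassmannian m. lower_box_dim (orth_proj V ` E) < lower_box_profile s E}"
    then have "\<exists>j. \<exists>\<^sub>F k in sequentially. covered_by k (profile_capacity s ((1/2)^k) E * (1/2) powr (1 / real (Suc j) * real k)) (orth_proj V ` E)"
    proof (intro frequently_covered_lower[where c="\<lambda>r. profile_capacity s r E"])
      show "bounded (orth_proj V ` E)" using V E subspace_grass by (blast intro: bounded_orth_proj_image)
      show "orth_proj V ` E \<noteq> {}" using E by simp
      show "0 < profile_capacity s r E" if "0 < r" for r
        using profile_capacity_pos[OF E _ that, of s] s by simp
      show "profile_capacity s r' E \<le> profile_capacity s r E" if "0 < r" "r \<le> r'" for r r'
        using profile_capacity_antimono[OF E _ that, of s] s by simp
    qed (use V in \<open>simp add: lower_box_profile_def\<close>)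
    then show "V \<in> (\<Union>j. A j)" using V by (auto simp: A_def)
  qed
  from net_content_mono[OF this, of grass_label t] null show ?L by simp
  have "{V \<in> grassmannian m. upper_box_dim (orth_proj V ` E) < upper_box_profile s E} \<subseteq> (\<Union>j. A j)"
  proof
    fix V assume V: "V \<in> {V \<in> grassmannian m. upper_box_dim (orth_proj V ` E) < upper_box_profile s E}"
    then have "\<exists>j. \<exists>\<^sub>F k in sequentially. covered_by k (profile_capacity s ((1/2)^k) E * (1/2) powr (1 / real (Suc j) * real k)) (orth_proj V ` E)"
    proof (intro frequently_covered_upper[where c="\<lambda>r. profile_capacity s r E"])
      show "bounded (orth_proj V ` E)" using V E subspace_grass by (blast intro: bounded_orth_proj_image)
      show "orth_proj V ` E \<noteq> {}" using E by simp
      show "0 < profile_capacity s r E" if "0 < r" for r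
        using profile_capacity_pos[OF E _ that, of s] s by simp
      show "profile_capacity s r' E \<le> profile_capacity s r E" if "0 < r" "r \<le> r'" for r r'
        using profile_capacity_antimono[OF E _ that, of s] s by simp
    qed (use V in \<open>simp add: upper_box_profile_def\<close>)
    then show "V \<in> (\<Union>j. A j)" using V by (auto simp: A_def)
  qed
  from net_content_mono[OF this, of grass_label t] null show ?U by simp
qed

section \<open>Packing dimension\<close>

text \<open>This form is chosen because Baire's theorem and the selection of compact subsets are
  carried out on the closed set above A.\<close>

definition analytic_set :: "'a::topological_space set \<Rightarrow> bool" where
  "analytic_set A \<longleftrightarrow> (\<exists>C :: ('a \<times> (nat \<Rightarrow> nat)) set. closed C \<and> A = fst ` C)"

lemma closed_continuous_preimage:
  assumes "continuous_on UNIV f" "closed S"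
  shows "closed {x. f x \<in> S}"
  using closed_vimage[OF assms(2,1)] by (simp add: vimage_def)

lemma continuous_on_snd_coordinate:
  "continuous_on UNIV (\<lambda>p :: 'a::topological_space \<times> (nat \<Rightarrow> nat). snd p i)"
  by (rule continuous_on_compose2[OF continuous_on_product_coordinates continuous_on_snd[OF continuous_on_id]]) auto

lemma continuous_on_reindex:
  "continuous_on UNIV (\<lambda>p :: 'a::topological_space \<times> (nat \<Rightarrow> nat). (fst p, \<lambda>n. snd p (h n)))"
  by (intro continuous_on_Pair continuous_on_fst continuous_on_id continuous_on_coordinatewise_then_product
      continuous_on_snd_coordinate)

lemma closed_nat: "closed (S :: nat set)"
  unfolding closed_def by (rule discrete_topology_class.open_discrete)

lemma analytic_set_closed:
  assumes "closed A"
  shows "analytic_set A"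
  unfolding analytic_set_def
  by (rule exI[of _ "A \<times> UNIV"]) (use assms in \<open>auto intro: closed_Times\<close>)

lemma analytic_set_UN:
  fixes A :: "nat \<Rightarrow> 'a::topological_space set"
  assumes "\<And>i. analytic_set (A i)"
  shows "analytic_set (\<Union>i. A i)"
proof -
  obtain C :: "nat \<Rightarrow> ('a \<times> (nat \<Rightarrow> nat)) set" where C: "\<And>i. closed (C i)" "\<And>i. A i = fst ` C i"
    using assms unfolding analytic_set_def by metis
  \<comment> \<open>Coordinate 0 names the index i and the remaining sequence is a witness for A i.
    The implication is written as a union of two closed conditions.\<close>
  let ?D = "\<Inter>i. {p. snd p 0 \<in> - {i}} \<union> {p. (fst p, \<lambda>n. snd p (Suc n)) \<in> C i}"
  have "closed ?D"
    by (intro closed_INT ballI closed_Un closed_continuous_preimage continuous_on_reindex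
        continuous_on_snd_coordinate closed_nat C)
  moreover have "(\<Union>i. A i) = fst ` ?D"
  proof (intro set_eqI iffI)
    fix x assume "x \<in> (\<Union>i. A i)"
    then obtain i \<alpha> where "(x, \<alpha>) \<in> C i" by (auto simp: C(2))
    then have "(x, case_nat i \<alpha>) \<in> ?D" by auto
    then show "x \<in> fst ` ?D" by (rule image_eqI[rotated]) simp
  next
    fix x assume "x \<in> fst ` ?D"
    then obtain \<beta> where "(x, \<beta>) \<in> ?D" by auto
    then have "(x, \<lambda>n. \<beta> (Suc n)) \<in> C (\<beta> 0)" by simp
    then have "x \<in> fst ` C (\<beta> 0)" by (rule image_eqI[rotated]) simp
    then show "x \<in> (\<Union>i. A i)" unfolding C(2) by blast
  qed
  ultimately show ?thesis unfolding analytic_set_def by blast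
qed

lemma analytic_set_INT:
  fixes A :: "nat \<Rightarrow> 'a::topological_space set"
  assumes "\<And>i. analytic_set (A i)"
  shows "analytic_set (\<Inter>i. A i)"
proof -
  obtain C :: "nat \<Rightarrow> ('a \<times> (nat \<Rightarrow> nat)) set" where C: "\<And>i. closed (C i)" "\<And>i. A i = fst ` C i"
    using assms unfolding analytic_set_def by metis
  \<comment> \<open>A single sequence stores one witness per index i, interleaved by
    \<open>prod_encode\<close>.\<close>
  let ?D = "\<Inter>i. {p. (fst p, \<lambda>n. snd p (prod_encode (i, n))) \<in> C i}"
  have "closed ?D"
    by (intro closed_INT ballI closed_continuous_preimage continuous_on_reindex C)
  moreover have "(\<Inter>i. A i) = fst ` ?D"
  proof (intro set_eqI iffI)
    fix x assume x: "x \<in> (\<Inter>i. A i)"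
    have "\<exists>\<alpha>. (x, \<alpha>) \<in> C i" for i
    proof -
      have "x \<in> fst ` C i" using x C(2) by blast
      then show ?thesis by auto
    qed
    then obtain \<beta> where "\<And>i. (x, \<beta> i) \<in> C i" by metis
    then have "(x, \<lambda>k. case prod_decode k of (i, n) \<Rightarrow> \<beta> i n) \<in> ?D" by simp
    then show "x \<in> fst ` ?D" by (rule image_eqI[rotated]) simp
  next
    fix x assume "x \<in> fst ` ?D"
    then obtain \<beta> where "(x, \<beta>) \<in> ?D" by auto
    then have "(x, \<lambda>n. \<beta> (prod_encode (i, n))) \<in> C i" for i by simp
    then have "x \<in> fst ` C i" for i by (rule image_eqI[rotated]) simp
    then show "x \<in> (\<Inter>i. A i)" unfolding C(2) by blast
  qed
  ultimately show ?thesis unfolding analytic_set_def by blast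
qed

lemma analytic_set_open:
  fixes A :: "'a::euclidean_space set"
  assumes "open A"
  shows "analytic_set A"
proof -
  obtain \<D> where D: "countable \<D>" "\<And>X. X \<in> \<D> \<Longrightarrow> \<exists>a b. X = cbox a b" "\<Union>\<D> = A"
    using open_countable_Union_open_cbox[OF assms] by metis
  show ?thesis
  proof (cases "\<D> = {}")
    case True
    then show ?thesis using D(3) analytic_set_closed[of "{}"] by auto
  next
    case False
    have "A = (\<Union>i. from_nat_into \<D> i)"
      using D(1,3) False by (metis range_from_nat_into)
    moreover have "closed (from_nat_into \<D> i)" for i
      using D(2)[OF from_nat_into[OF False]] closed_cbox by metis
    ultimately show ?thesis using analytic_set_UN analytic_set_closed by metis
  qed
qed

text \<open>Analytic sets are not closed under complements in general, so the induction carries A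
  and its complement together.\<close>

lemma analytic_set_borel:
  fixes A :: "'a::euclidean_space set"
  assumes "A \<in> sets borel"
  shows "analytic_set A"
proof -
  have "A \<in> sigma_sets UNIV {S. open S}" using assms by (simp add: sets_borel)
  then have "analytic_set A \<and> analytic_set (- A)"
  proof (induction rule: sigma_sets.induct)
    case (Basic a)
    then show ?case using analytic_set_open analytic_set_closed[of "- a"] by auto
  next
    case Empty
    then show ?case using analytic_set_closed[of "{}"] analytic_set_closed[of UNIV] by auto
  next
    case (Compl a)
    then show ?case by (simp add: Compl_eq_Diff_UNIV[symmetric])
  next
    case (Union a)
    then have "analytic_set (\<Union>i. a i)" "analytic_set (\<Inter>i. - a i)"
      by (auto intro: analytic_set_UN analytic_set_INT)
    then show ?case by (simp add: Compl_UN)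
  qed
  then show ?thesis ..
qed

text \<open>T is closed in a completely metrizable space, hence completely metrizable itself. If no
  H i contained a relatively open piece of T, each T \<inter> H i would be nowhere dense in T, and T
  would be meagre in itself.\<close>

lemma Baire_closed_cover:
  fixes T :: "('a::complete_space \<times> (nat \<Rightarrow> nat)) set" and H :: "nat \<Rightarrow> ('a \<times> (nat \<Rightarrow> nat)) set"
  assumes T: "closed T" "T \<noteq> {}" and H: "\<And>i. closed (H i)" "T \<subseteq> (\<Union>i. H i)"
  shows "\<exists>i W. open W \<and> W \<inter> T \<noteq> {} \<and> W \<inter> T \<subseteq> H i"
proof (rule ccontr)
  assume contra: "\<not> ?thesis"
  let ?X = "top_of_set T"
  have nat: "(euclidean :: nat topology) = discrete_topology UNIV"
    by (simp add: topology_eq discrete_topology_class.open_discrete)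
  have "completely_metrizable_space (product_topology (\<lambda>i::nat. euclidean :: nat topology) UNIV)"
    unfolding completely_metrizable_space_product_topology nat
    by (simp add: completely_metrizable_space_discrete_topology)
  then have "completely_metrizable_space (prod_topology (euclidean :: 'a topology) (euclidean :: (nat \<Rightarrow> nat) topology))"
    unfolding completely_metrizable_space_prod_topology euclidean_product_topology
    by (simp add: completely_metrizable_space_euclidean)
  then have cm: "completely_metrizable_space ?X"
    using T(1) by (intro completely_metrizable_space_closedin) auto
  have "?X interior_of \<Union>(range (\<lambda>i. T \<inter> H i)) = {}"
  proof (rule Baire_category_alt)
    fix S assume "S \<in> range (\<lambda>i. T \<inter> H i)"
    then obtain i where S: "S = T \<inter> H i" by blast
    have "?X interior_of S = {}"
    proof (rule ccontr)
      assume "?X interior_of S \<noteq> {}"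
      then obtain x where "x \<in> ?X interior_of S" by blast
      then obtain U where U: "openin ?X U" "x \<in> U" "U \<subseteq> S" unfolding interior_of_def by blast
      then obtain W where "open W" "U = T \<inter> W" unfolding openin_open by blast
      then show False using contra U S by blast
    qed
    then show "closedin ?X S \<and> ?X interior_of S = {}"
      using H(1)[of i] S by (auto simp: closedin_closed)
  qed (use cm in auto)
  moreover have "\<Union>(range (\<lambda>i. T \<inter> H i)) = T" using H(2) by auto
  moreover have "?X interior_of T = T" using interior_of_topspace[of ?X] by simp
  ultimately show False using T(2) by simp
qed

section \<open>Small sets for the packing profile, and packing dimension of projections\<close>

lemma upper_box_profile_closure: "upper_box_profile s (closure E) = upper_box_profile s E"
  by (simp add: upper_box_profile_def profile_capacity_def)

lemma upper_box_dim_le_closure: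
  fixes S T :: "'a::euclidean_space set"
  assumes "S \<subseteq> closure T" "bounded T" "S \<noteq> {}"
  shows "upper_box_dim S \<le> upper_box_dim T"
  unfolding upper_box_dim_def
proof (rule Limsup_mono)
  have bS: "bounded S" using assms(1,2) bounded_closure bounded_subset by blast
  have "\<forall>\<^sub>F r in at_right (0::real). 0 < r \<and> r < 1"
    unfolding eventually_at_right_field by (rule exI[of _ 1]) simp
  then show "\<forall>\<^sub>F r in at_right 0. ereal (ln (real (covering_number r S)) / - ln r)
      \<le> ereal (ln (real (covering_number r T)) / - ln r)"
  proof eventually_elim
    fix r :: real assume r: "0 < r \<and> r < 1"
    have "1 \<le> covering_number r S" using covering_number_ge_1[OF bS assms(3)] r by blast
    moreover have "covering_number r S \<le> covering_number r T"
      using covering_number_mono_closure[OF assms(1,2)] r by blast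
    ultimately have "ln (real (covering_number r S)) \<le> ln (real (covering_number r T))" by simp
    then have "ln (real (covering_number r S)) / - ln r \<le> ln (real (covering_number r T)) / - ln r"
      by (rule divide_right_mono) (use r in simp)
    then show "ereal (ln (real (covering_number r S)) / - ln r) \<le> ereal (ln (real (covering_number r T)) / - ln r)"
      by simp
  qed
qed

text \<open>A sigma-ideal behind the statement that the packing profile is at most
  \<open>\<sigma>\<close>: its closure under countable unions lets a countable family of open pieces
  be removed at once. The empty family makes the empty set small.\<close>

definition profile_small :: "real \<Rightarrow> real \<Rightarrow> 'a::euclidean_space set \<Rightarrow> bool" where
  "profile_small s \<sigma> S \<longleftrightarrow> (\<exists>\<F>. countable \<F> \<and> S \<subseteq> \<Union>\<F>
     \<and> (\<forall>K\<in>\<F>. K \<noteq> {} \<and> compact K \<and> upper_box_profile s K \<le> ereal \<sigma>))"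

lemma profile_small_subset: "profile_small s \<sigma> S \<Longrightarrow> S' \<subseteq> S \<Longrightarrow> profile_small s \<sigma> S'"
  unfolding profile_small_def by (meson order_trans)

lemma profile_small_UN:
  assumes "countable I" "\<And>i. i \<in> I \<Longrightarrow> profile_small s \<sigma> (S i)"
  shows "profile_small s \<sigma> (\<Union>i\<in>I. S i)"
proof -
  have "\<forall>i\<in>I. \<exists>\<F>. countable \<F> \<and> S i \<subseteq> \<Union>\<F>
     \<and> (\<forall>K\<in>\<F>. K \<noteq> {} \<and> compact K \<and> upper_box_profile s K \<le> ereal \<sigma>)"
    using assms(2) unfolding profile_small_def by blast
  from bchoice[OF this] obtain \<F> where F: "\<forall>i\<in>I. countable (\<F> i) \<and> S i \<subseteq> \<Union>(\<F> i)
     \<and> (\<forall>K\<in>\<F> i. K \<noteq> {} \<and> compact K \<and> upper_box_profile s K \<le> ereal \<sigma>)" ..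
  show ?thesis unfolding profile_small_def
  proof (intro exI[of _ "\<Union>i\<in>I. \<F> i"] conjI)
    show "countable (\<Union>i\<in>I. \<F> i)" using assms(1) F by (intro countable_UN) auto
    show "(\<Union>i\<in>I. S i) \<subseteq> \<Union>(\<Union>i\<in>I. \<F> i)"
    proof
      fix x assume "x \<in> (\<Union>i\<in>I. S i)"
      then obtain i where i: "i \<in> I" "x \<in> S i" by blast
      then have "x \<in> \<Union>(\<F> i)" using F by blast
      then show "x \<in> \<Union>(\<Union>i\<in>I. \<F> i)" using i(1) by blast
    qed
    show "\<forall>K\<in>\<Union>i\<in>I. \<F> i. K \<noteq> {} \<and> compact K \<and> upper_box_profile s K \<le> ereal \<sigma>"
      using F by blast
  qed
qed

lemma profile_small_Un:
  assumes "profile_small s \<sigma> A" "profile_small s \<sigma> B"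
  shows "profile_small s \<sigma> (A \<union> B)"
  using profile_small_UN[of "{A, B}" s \<sigma> "\<lambda>S. S"] assms by auto

lemma packing_profile_le:
  assumes "profile_small s \<sigma> E" "E \<noteq> {}"
  shows "packing_profile s E \<le> ereal \<sigma>"
proof -
  obtain \<F> where F: "countable \<F>" "E \<subseteq> \<Union>\<F>"
      "\<And>K. K \<in> \<F> \<Longrightarrow> K \<noteq> {} \<and> compact K \<and> upper_box_profile s K \<le> ereal \<sigma>"
    using assms(1) unfolding profile_small_def by blast
  have ne: "\<F> \<noteq> {}" using F(2) assms(2) by blast
  let ?F = "from_nat_into \<F>"
  have mem: "?F i \<in> \<F>" for i by (rule from_nat_into[OF ne])
  have "packing_profile s E \<le> (SUP i. upper_box_profile s (?F i))"
    unfolding packing_profile_def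
    by (rule INF_lower) (use F mem range_from_nat_into[OF ne F(1)] in auto)
  also have "\<dots> \<le> ereal \<sigma>" by (rule SUP_least) (use F(3)[OF mem] in auto)
  finally show ?thesis .
qed

text \<open>Box-dimension results apply to one set at a time, whereas the countable cover in the
  packing dimension varies with V. Baire's theorem finds a piece on which a single covering set
  decides, and this piece can be taken from a countable list fixed in advance.\<close>

lemma packing_exceptional_null:
  fixes E :: "(real ^ 'n) set" and s :: real and m :: nat
  assumes E: "analytic_set E" "E \<noteq> {}" and s: "0 < s" and t: "t = real (m * (CARD('n) - m - 1)) + s"
  shows "net_content grass_label t
      {V \<in> grassmannian m. packing_dim (orth_proj V ` E) < packing_profile s E} = 0"
proof -
  obtain C :: "((real ^ 'n) \<times> (nat \<Rightarrow> nat)) set" where C: "closed C" "E = fst ` C"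
    using E(1) unfolding analytic_set_def by blast
  obtain \<B> :: "((real ^ 'n) \<times> (nat \<Rightarrow> nat)) set set" where B: "countable \<B>" "topological_basis \<B>"
    using ex_countable_basis by blast
  define R where "R \<sigma> = {W\<in>\<B>. profile_small s \<sigma> (fst ` (C \<inter> W))}" for \<sigma>
  define T where "T \<sigma> = C - \<Union>(R \<sigma>)" for \<sigma>
  have openB: "open W" if "W \<in> \<B>" for W using B(2) that by (rule topological_basis_open)
  have clT: "closed (T \<sigma>)" for \<sigma>
    unfolding T_def R_def using C(1) openB by (intro closed_Diff open_Union) auto
  have small: "profile_small s \<sigma> (fst ` (C - T \<sigma>))" for \<sigma>
  proof -
    have "profile_small s \<sigma> (\<Union>W\<in>R \<sigma>. fst ` (C \<inter> W))"
      using B(1) by (intro profile_small_UN) (auto simp: R_def)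
    then show ?thesis by (rule profile_small_subset) (auto simp: T_def)
  qed
  \<comment> \<open>Otherwise the closure of this image together with the small removed part would
    cover the image of C \<inter> W, and W would itself have been removed.\<close>
  have not_small: "ereal \<sigma> < upper_box_profile s (fst ` (T \<sigma> \<inter> W))"
    if W: "W \<in> \<B>" "T \<sigma> \<inter> W \<noteq> {}" "bounded (fst ` (T \<sigma> \<inter> W))" for W \<sigma>
  proof (rule ccontr)
    assume "\<not> ?thesis"
    then have "profile_small s \<sigma> (closure (fst ` (T \<sigma> \<inter> W)))"
      unfolding profile_small_def using W
      by (intro exI[of _ "{closure (fst ` (T \<sigma> \<inter> W))}"]) (auto simp: upper_box_profile_closure not_less)
    then have "profile_small s \<sigma> (closure (fst ` (T \<sigma> \<inter> W)) \<union> fst ` (C - T \<sigma>))"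
      using small by (rule profile_small_Un)
    then have "profile_small s \<sigma> (fst ` (C \<inter> W))"
      by (rule profile_small_subset) (use closure_subset[of "fst ` (T \<sigma> \<inter> W)"] in auto)
    then have "W \<in> R \<sigma>" using W(1) by (simp add: R_def)
    then show False using W(2) by (auto simp: T_def)
  qed
  \<comment> \<open>Rational thresholds and basic open sets keep the list of pieces
    countable.\<close>
  define P where "P = {(\<sigma>, W). \<sigma> \<in> \<rat> \<and> W \<in> \<B> \<and> T \<sigma> \<inter> W \<noteq> {} \<and> bounded (fst ` (T \<sigma> \<inter> W))}"
  define X where "X = (\<lambda>(\<sigma>, W). {V \<in> grassmannian m. upper_box_dim (orth_proj V ` fst ` (T \<sigma> \<inter> W))
      < upper_box_profile s (fst ` (T \<sigma> \<inter> W))})"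
  have "countable P"
    by (rule countable_subset[of _ "\<rat> \<times> \<B>"]) (use B(1) countable_rat in \<open>auto simp: P_def\<close>)
  then have null: "net_content grass_label t (\<Union>p\<in>P. X p) = 0"
  proof (rule net_content_UN_eq_0)
    fix p assume "p \<in> P"
    then show "net_content grass_label t (X p) = 0"
      unfolding P_def X_def by (auto intro!: upper_box_exceptional_null[OF _ _ s t])
  qed
  have "{V \<in> grassmannian m. packing_dim (orth_proj V ` E) < packing_profile s E} \<subseteq> (\<Union>p\<in>P. X p)"
  proof
    fix V assume "V \<in> {V \<in> grassmannian m. packing_dim (orth_proj V ` E) < packing_profile s E}"
    then have V: "V \<in> grassmannian m" "packing_dim (orth_proj V ` E) < packing_profile s E" by auto
    obtain \<sigma>' where \<sigma>': "packing_dim (orth_proj V ` E) < ereal \<sigma>'" "ereal \<sigma>' < packing_profile s E"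
      using ereal_dense2[OF V(2)] by blast
    obtain \<sigma>'' where \<sigma>'': "packing_dim (orth_proj V ` E) < ereal \<sigma>''" "\<sigma>'' < \<sigma>'"
      using ereal_dense2[OF \<sigma>'(1)] by auto
    obtain \<sigma> where \<sigma>: "\<sigma> \<in> \<rat>" "\<sigma>'' < \<sigma>" "\<sigma> < \<sigma>'" using Rats_dense_in_real[OF \<sigma>''(2)] by blast
    have 1: "packing_dim (orth_proj V ` E) < ereal \<sigma>"
      using \<sigma>''(1) \<sigma>(2) by (meson ereal_less_eq(3) less_imp_le order_less_le_trans)
    have 2: "\<not> profile_small s \<sigma> E"
    proof
      assume "profile_small s \<sigma> E"
      then have "packing_profile s E \<le> ereal \<sigma>" using E(2) by (rule packing_profile_le)
      also have "\<dots> \<le> ereal \<sigma>'" using \<sigma>(3) by simp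
      finally show False using \<sigma>'(2) by simp
    qed
    have Tne: "T \<sigma> \<noteq> {}"
    proof
      assume "T \<sigma> = {}"
      then show False using small[of \<sigma>] 2 C(2) by simp
    qed
    obtain F :: "nat \<Rightarrow> (real ^ 'n) set" where F: "orth_proj V ` E \<subseteq> (\<Union>i. F i)" "\<forall>i. F i \<noteq> {} \<and> bounded (F i)"
        "(SUP i. upper_box_dim (F i)) < ereal \<sigma>"
      using 1 unfolding packing_dim_def INF_less_iff by auto
    have cont: "continuous_on UNIV (\<lambda>z :: (real ^ 'n) \<times> (nat \<Rightarrow> nat). orth_proj V (fst z))"
      using linear_orth_proj[OF subspace_grass[OF V(1)]]
      by (intro continuous_on_compose2[OF linear_continuous_on[of "orth_proj V" UNIV] continuous_on_fst[OF continuous_on_id]])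
        (auto simp: linear_conv_bounded_linear)
    define H where "H i = {z :: (real ^ 'n) \<times> (nat \<Rightarrow> nat). orth_proj V (fst z) \<in> closure (F i)}" for i
    have TH: "T \<sigma> \<subseteq> (\<Union>i. H i)"
    proof
      fix z assume "z \<in> T \<sigma>"
      then have "fst z \<in> E" using C(2) by (auto simp: T_def)
      then obtain i where "orth_proj V (fst z) \<in> F i" using F(1) by blast
      then have "z \<in> H i" using closure_subset[of "F i"] by (auto simp: H_def)
      then show "z \<in> (\<Union>i. H i)" by blast
    qed
    have clH: "closed (H i)" for i
      unfolding H_def by (rule closed_continuous_preimage[OF cont closed_closure])
    obtain i W where W: "open W" "W \<inter> T \<sigma> \<noteq> {}" "W \<inter> T \<sigma> \<subseteq> H i"
      using Baire_closed_cover[OF clT Tne clH TH] by (elim exE conjE)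
    obtain z where z: "z \<in> W" "z \<in> T \<sigma>" using W(2) by blast
    \<comment> \<open>Intersecting with a cylinder over a ball makes the image of the piece bounded,
      as the box dimensions require.\<close>
    have "open (W \<inter> (ball (fst z) 1 \<times> UNIV))" using W(1) by (intro open_Int open_Times) auto
    moreover have "z \<in> W \<inter> (ball (fst z) 1 \<times> UNIV)" using z by (auto simp: mem_Times_iff)
    ultimately obtain W' where W': "W' \<in> \<B>" "z \<in> W'" "W' \<subseteq> W \<inter> (ball (fst z) 1 \<times> UNIV)"
      using topological_basisE[OF B(2)] by metis
    let ?S = "fst ` (T \<sigma> \<inter> W')"
    have Sb: "bounded ?S" by (rule bounded_subset[OF bounded_ball[of "fst z" 1]]) (use W' in auto)
    have Tne': "T \<sigma> \<inter> W' \<noteq> {}" using z W' by blast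
    have "upper_box_dim (orth_proj V ` ?S) \<le> upper_box_dim (F i)"
      using W'(3) W(3) Tne' F(2) by (intro upper_box_dim_le_closure) (auto simp: H_def)
    also have "\<dots> \<le> (SUP i. upper_box_dim (F i))" by (rule SUP_upper) simp
    also have "\<dots> < ereal \<sigma>" by (rule F(3))
    also have "\<dots> < upper_box_profile s ?S" by (rule not_small[OF W'(1) Tne' Sb])
    finally have "V \<in> X (\<sigma>, W')" using V(1) by (simp add: X_def)
    moreover have "(\<sigma>, W') \<in> P" using \<sigma>(1) W'(1) Tne' Sb by (simp add: P_def)
    ultimately show "V \<in> (\<Union>p\<in>P. X p)" by blast
  qed
  from net_content_mono[OF this, of grass_label t] null show ?thesis by simp
qed

section \<open>Hausdorff dimension\<close>

lemma emeasure_cell_measure_image: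
  assumes "inj_on h \<U>" "\<And>u. u \<in> \<U> \<Longrightarrow> fst (h u) = fst u"
  shows "emeasure (cell_measure t) (h ` \<U>) = emeasure (cell_measure t) \<U>"
proof -
  have "emeasure (cell_measure t) (h ` \<U>) = (\<integral>\<^sup>+u. ennreal ((1/2) powr (t * real (fst (h u)))) \<partial>count_space \<U>)"
    unfolding emeasure_cell_measure_eq
    by (rule nn_integral_bij_count_space[symmetric]) (use assms(1) in \<open>auto simp: bij_betw_def\<close>)
  also have "\<dots> = emeasure (cell_measure t) \<U>"
    unfolding emeasure_cell_measure_eq by (rule nn_integral_cong) (simp add: assms(2))
  finally show ?thesis .
qed

text \<open>Dyadic cubes are half-open. This open box of side 4 * 2^-k around the cube u turns
  covers by cubes into open covers.\<close>

definition dyadic_nbhd :: "nat \<times> ('n::finite \<Rightarrow> int) \<Rightarrow> (real ^ 'n) set" where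
  "dyadic_nbhd u = {x. \<forall>i. \<bar>2 ^ fst u * x $ i - real_of_int (snd u i)\<bar> < 2}"

lemma open_dyadic_nbhd: "open (dyadic_nbhd u)"
proof -
  have "dyadic_nbhd u = (\<Inter>i\<in>UNIV. {x. \<bar>2 ^ fst u * x $ i - real_of_int (snd u i)\<bar> < 2})"
    by (auto simp: dyadic_nbhd_def)
  also have "open \<dots>"
    by (intro open_INT finite ballI open_Collect_less continuous_intros)
  finally show ?thesis .
qed

lemma cell_subset_dyadic_nbhd: "cell dyadic u \<subseteq> dyadic_nbhd u"
proof
  fix x assume "x \<in> cell dyadic u"
  then have "dyadic (fst u) x i = snd u i" for i by (simp add: mem_cell_iff)
  then have *: "\<lfloor>2 ^ fst u * x $ i\<rfloor> = snd u i" for i by (simp add: dyadic_def)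
  have "\<bar>2 ^ fst u * x $ i - real_of_int (snd u i)\<bar> < 2" for i
    unfolding *[symmetric] by linarith
  then show "x \<in> dyadic_nbhd u" by (simp add: dyadic_nbhd_def)
qed

text \<open>The floor at a point of the box differs from the label by -2, -1, 0 or 1 in each
  coordinate, so 4^n shifted copies of the family cover all boxes, each at the original
  cost.\<close>

lemma net_content_dyadic_nbhds:
  fixes \<U> :: "(nat \<times> ('n::finite \<Rightarrow> int)) set"
  shows "net_content dyadic t (\<Union>u\<in>\<U>. dyadic_nbhd u) \<le> of_nat (4 ^ CARD('n)) * emeasure (cell_measure t) \<U>"
proof -
  let ?D = "PiE (UNIV :: 'n set) (\<lambda>_. {-2..1::int})"
  define h where "h d u = (fst u, \<lambda>i. snd u i + d i)" for d :: "'n \<Rightarrow> int" and u :: "nat \<times> ('n \<Rightarrow> int)"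
  have fin: "finite ?D" by (intro finite_PiE) auto
  have "(\<Union>u\<in>\<U>. dyadic_nbhd u) \<subseteq> (\<Union>u\<in>(\<Union>d\<in>?D. h d ` \<U>). cell dyadic u)"
  proof
    fix x assume "x \<in> (\<Union>u\<in>\<U>. dyadic_nbhd u)"
    then obtain u where u: "u \<in> \<U>" "\<And>i. \<bar>2 ^ fst u * x $ i - real_of_int (snd u i)\<bar> < 2"
      by (auto simp: dyadic_nbhd_def)
    define d where "d i = dyadic (fst u) x i - snd u i" for i
    have "d i \<in> {-2..1}" for i
      using u(2)[of i] unfolding d_def dyadic_def by (auto; linarith)
    then have "d \<in> ?D" by auto
    moreover have "x \<in> cell dyadic (h d u)" by (simp add: mem_cell_iff h_def d_def)
    ultimately show "x \<in> (\<Union>u\<in>(\<Union>d\<in>?D. h d ` \<U>). cell dyadic u)" using u(1) by blast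
  qed
  then have "net_content dyadic t (\<Union>u\<in>\<U>. dyadic_nbhd u) \<le> emeasure (cell_measure t) (\<Union>d\<in>?D. h d ` \<U>)"
    by (rule net_content_le)
  also have "\<dots> \<le> (\<Sum>d\<in>?D. emeasure (cell_measure t) (h d ` \<U>))"
    by (rule emeasure_subadditive_finite) (use fin in auto)
  also have "\<dots> = (\<Sum>d\<in>?D. emeasure (cell_measure t) \<U>)"
    by (intro sum.cong refl emeasure_cell_measure_image) (auto simp: h_def inj_on_def fun_eq_iff prod_eq_iff)
  also have "\<dots> = of_nat (card ?D) * emeasure (cell_measure t) \<U>" by simp
  also have "card ?D = 4 ^ CARD('n)" by (subst card_PiE) auto
  finally show ?thesis .
qed

section \<open>Compact subsets of positive content\<close>

lemma compact_Pi_atMost: "compact {\<alpha> :: nat \<Rightarrow> nat. \<forall>i. \<alpha> i \<le> b i}"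
proof -
  have "compactin (product_topology (\<lambda>i. euclidean :: nat topology) UNIV) (PiE UNIV (\<lambda>i. {..b i}))"
    unfolding compactin_PiE by (auto simp: finite_imp_compact)
  then show ?thesis
    unfolding euclidean_product_topology by (auto simp: PiE_def Pi_def)
qed

text \<open>The sets A j need not be compact, because only their first j coordinates are bounded.
  Still, if each A j had a point over the complement of U, these points would lie in one compact
  set, and a limit of a subsequence would lie in all A j.\<close>

lemma nested_bounded_coordinates:
  fixes A :: "nat \<Rightarrow> ('a::euclidean_space \<times> (nat \<Rightarrow> nat)) set"
  assumes cl: "\<And>j. closed (A j)" and dec: "\<And>j. A (Suc j) \<subseteq> A j \<inter> {p. snd p j \<le> k j}"
    and bdd: "bounded (fst ` A 0)"
  shows "compact (fst ` (\<Inter>j. A j))"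
    and "open U \<Longrightarrow> fst ` (\<Inter>j. A j) \<subseteq> U \<Longrightarrow> \<exists>j. fst ` A j \<subseteq> U"
proof -
  obtain B where B: "fst ` A 0 \<subseteq> cball 0 B" 
  proof -
    obtain B where "\<forall>x\<in>fst ` A 0. norm x \<le> B" using bdd unfolding bounded_iff by blast
    then have "fst ` A 0 \<subseteq> cball 0 B" by auto
    then show ?thesis by (rule that)
  qed
  have anti: "A j \<subseteq> A i" if "i \<le> j" for i j
    using lift_Suc_antimono_le[of A i j] dec that by auto
  have coord: "snd p i \<le> k i" if "p \<in> A j" "i < j" for p i j
    using anti[of "Suc i" j] dec[of i] that by auto
  have fstB: "fst p \<in> cball 0 B" if "p \<in> A j" for p j
    using subsetD[OF B imageI[OF subsetD[OF anti[of 0 j] that]]] by simp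
  have "compact (cball (0::'a) B \<times> {\<alpha> :: nat \<Rightarrow> nat. \<forall>i. \<alpha> i \<le> k i})"
    by (intro compact_Times compact_cball compact_Pi_atMost)
  moreover have "(\<Inter>j. A j) \<subseteq> cball 0 B \<times> {\<alpha>. \<forall>i. \<alpha> i \<le> k i}"
  proof
    fix p assume p: "p \<in> (\<Inter>j. A j)"
    then have "fst p \<in> cball 0 B" "\<forall>i. snd p i \<le> k i" using fstB[of p 0] coord[of p "Suc i" i for i] by auto
    then show "p \<in> cball 0 B \<times> {\<alpha>. \<forall>i. \<alpha> i \<le> k i}" by (simp add: mem_Times_iff)
  qed
  ultimately have "compact (\<Inter>j. A j)"
    using cl by (metis (no_types, lifting) Int_absorb1 closed_INT compact_Int_closed)
  then show "compact (fst ` (\<Inter>j. A j))"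
    by (intro compact_continuous_image continuous_on_fst continuous_on_id)
  show "\<exists>j. fst ` A j \<subseteq> U" if U: "open U" "fst ` (\<Inter>j. A j) \<subseteq> U"
  proof (rule ccontr)
    assume "\<not> ?thesis"
    then have "\<forall>j. \<exists>p. p \<in> A j \<and> fst p \<notin> U" by blast
    then obtain p where p: "\<And>j. p j \<in> A j" "\<And>j. fst (p j) \<notin> U" by metis
    \<comment> \<open>Coordinate i is at most k i for all points p j with j > i; the finitely many
      earlier points are absorbed by a maximum.\<close>
    define b where "b i = max (k i) (Max ((\<lambda>j. snd (p j) i) ` {..i}))" for i
    have "snd (p j) i \<le> b i" for i j
    proof (cases "j \<le> i")
      case True
      then show ?thesis unfolding b_def by (intro max.coboundedI2 Max_ge) auto
    next
      case False
      then show ?thesis using coord[OF p(1)[of j], of i] unfolding b_def by auto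
    qed
    then have mem: "p j \<in> cball 0 B \<times> {\<alpha>. \<forall>i. \<alpha> i \<le> b i}" for j
      using fstB[OF p(1)] by (simp add: mem_Times_iff)
    have "compact (cball (0::'a) B \<times> {\<alpha> :: nat \<Rightarrow> nat. \<forall>i. \<alpha> i \<le> b i})"
      by (intro compact_Times compact_cball compact_Pi_atMost)
    then have "seq_compact (cball (0::'a) B \<times> {\<alpha> :: nat \<Rightarrow> nat. \<forall>i. \<alpha> i \<le> b i})"
      by (rule compact_imp_seq_compact)
    then obtain l r where l: "strict_mono r" "(p \<circ> r) \<longlonglongrightarrow> l"
      using mem unfolding seq_compact_def by blast
    have "l \<in> A i" for i
    proof (rule Lim_in_closed_set[OF cl _ _ l(2)])
      have "r j \<ge> i" if "j \<ge> i" for j using seq_suble[OF l(1), of j] that by linarith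
      then have "(p \<circ> r) j \<in> A i" if "j \<ge> i" for j
        using subsetD[OF anti p(1)[of "r j"], of i] that by simp
      then show "\<forall>\<^sub>F j in sequentially. (p \<circ> r) j \<in> A i"
        by (rule eventually_sequentiallyI)
    qed simp
    then have "fst l \<in> U" using U(2) by auto
    moreover have "(\<lambda>j. fst ((p \<circ> r) j)) \<longlonglongrightarrow> fst l" by (rule tendsto_fst[OF l(2)])
    ultimately have "\<forall>\<^sub>F j in sequentially. fst ((p \<circ> r) j) \<in> U"
      using U(1) by (auto simp: tendsto_def)
    then show False using p(2) by (auto simp: eventually_sequentially)
  qed
qed

text \<open>Only the increasing sets lemma for net contents is needed, not Frostman's lemma for Borel sets.\<close>

lemma analytic_compact_subset_positive:
  fixes E :: "(real ^ 'n) set"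
  assumes E: "analytic_set E" and pos: "0 < net_content dyadic t E"
  obtains K where "compact K" "K \<subseteq> E" "0 < net_content dyadic t K"
proof -
  let ?M = "net_content dyadic t :: (real ^ 'n) set \<Rightarrow> ennreal"
  obtain C :: "((real ^ 'n) \<times> (nat \<Rightarrow> nat)) set" where C: "closed C" "E = fst ` C"
    using E unfolding analytic_set_def by blast
  obtain c where c: "0 < c" "c < ?M E" using dense[OF pos] by blast
  \<comment> \<open>The increasing sets lemma read backwards: content above c is reached at a finite
    stage. It is applied first to a bound on the point, then to a bound on each coordinate of the
    sequence in turn.\<close>
  have step: "\<exists>n. c < ?M (fst ` B n)" if "incseq B" "c < ?M (fst ` (\<Union>n. B n))" for B :: "nat \<Rightarrow> ((real ^ 'n) \<times> (nat \<Rightarrow> nat)) set"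
  proof (rule ccontr)
    assume contra: "\<not> ?thesis"
    have "?M (\<Union>n. fst ` B n) \<le> c"
    proof (intro dyadic.net_content_incseq_le)
      show "incseq (\<lambda>n. fst ` B n)" using that(1) by (meson image_mono monoD monoI)
      show "?M (fst ` B n) \<le> c" for n using contra by (simp add: not_less)
    qed
    then show False using that(2) by (simp add: image_UN not_less)
  qed
  have "\<exists>n. c < ?M (fst ` (C \<inter> (cball 0 (real n) \<times> UNIV)))"
  proof (rule step)
    show "incseq (\<lambda>n. C \<inter> (cball 0 (real n) \<times> UNIV))" by (auto simp: incseq_def)
    have "(\<Union>n. C \<inter> (cball 0 (real n) \<times> UNIV)) = C"
      using real_arch_simple by (auto simp: mem_Times_iff)
    then show "c < ?M (fst ` (\<Union>n. C \<inter> (cball 0 (real n) \<times> UNIV)))" using c C by simp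
  qed
  then obtain n0 where n0: "c < ?M (fst ` (C \<inter> (cball 0 (real n0) \<times> UNIV)))" ..
  define D where "D = C \<inter> (cball 0 (real n0) \<times> UNIV)"
  define P where "P j A \<longleftrightarrow> closed A \<and> c < ?M (fst ` A) \<and> (j = 0 \<longrightarrow> A = D)" for j :: nat and A
  define Q where "Q j A A' \<longleftrightarrow> (\<exists>k. A' = A \<inter> {p. snd p j \<le> k})" for j and A A' :: "((real ^ 'n) \<times> (nat \<Rightarrow> nat)) set"
  have clD: "closed D" unfolding D_def using C(1) by (intro closed_Int closed_Times) auto
  have ex0: "\<exists>A. P 0 A" using n0 clD by (intro exI[of _ D]) (simp add: P_def D_def)
  have exS: "\<exists>A'. P (Suc j) A' \<and> Q j A A'" if "P j A" for A j
  proof -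
    have "\<exists>k. c < ?M (fst ` (A \<inter> {p. snd p j \<le> k}))"
    proof (rule step)
      show "incseq (\<lambda>k. A \<inter> {p. snd p j \<le> k})" by (auto simp: incseq_def)
      have "(\<Union>k. A \<inter> {p. snd p j \<le> k}) = A" by auto
      then show "c < ?M (fst ` (\<Union>k. A \<inter> {p. snd p j \<le> k}))" using that by (simp add: P_def)
    qed
    then obtain k where k: "c < ?M (fst ` (A \<inter> {p. snd p j \<le> k}))" ..
    have "closed {p :: (real ^ 'n) \<times> (nat \<Rightarrow> nat). snd p j \<in> {..k}}"
      by (rule closed_continuous_preimage[OF continuous_on_snd_coordinate closed_nat])
    then have "closed (A \<inter> {p. snd p j \<le> k})" using that by (simp add: P_def closed_Int)
    then show ?thesis using k by (intro exI[of _ "A \<inter> {p. snd p j \<le> k}"]) (auto simp: P_def Q_def)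
  qed
  obtain A where A: "\<And>j. P j (A j)" "\<And>j. Q j (A j) (A (Suc j))"
    using dependent_nat_choice[of P Q, OF ex0 exS] by blast
  obtain k where k: "\<And>j. A (Suc j) = A j \<inter> {p. snd p j \<le> k j}" using A(2) unfolding Q_def by metis
  have cl: "closed (A j)" for j using A(1) by (simp add: P_def)
  have A0: "A 0 = D" using A(1)[of 0] by (simp add: P_def)
  have b0: "bounded (fst ` A 0)" unfolding A0 D_def by (rule bounded_subset[OF bounded_cball[of 0 "real n0"]]) auto
  let ?K = "fst ` (\<Inter>j. A j)"
  have dec: "A (Suc j) \<subseteq> A j \<inter> {p. snd p j \<le> k j}" for j by (simp add: k)
  show ?thesis
  proof (rule that[of ?K])
    show "compact ?K" by (rule nested_bounded_coordinates(1)[OF cl dec b0])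
    show "?K \<subseteq> E" using A0 C(2) by (auto simp: D_def)
    show "0 < ?M ?K"
    proof (rule ccontr)
      assume "\<not> 0 < ?M ?K"
      then have "?M ?K = 0" by (simp add: not_less)
      let ?N = "of_nat (4 ^ CARD('n)) :: ennreal"
      have N: "?N \<noteq> 0" by simp
      have N': "?N \<noteq> top" using of_nat_less_top[of "4 ^ CARD('n)"] by (metis less_irrefl)
      have "0 < c / ?N" using c(1) of_nat_less_top[of "4 ^ CARD('n)"] unfolding ennreal_zero_less_divide by (rule conjI)
      \<comment> \<open>A cover of K costing less than c / 4^n, thickened to open boxes, would
        contain the image of some A j; that image would then have content at most c.\<close>
      then have "?M ?K < c / ?N" using \<open>?M ?K = 0\<close> by simp
      then obtain \<U> where U: "?K \<subseteq> (\<Union>u\<in>\<U>. cell dyadic u)" "emeasure (cell_measure t) \<U> < c / ?N"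
        by (rule net_content_lessE)
      let ?U = "\<Union>u\<in>\<U>. dyadic_nbhd u"
      have KU: "?K \<subseteq> ?U" using U(1) UN_mono[OF subset_refl cell_subset_dyadic_nbhd] by (rule subset_trans)
      have oU: "open ?U" by (intro open_UN ballI open_dyadic_nbhd)
      obtain j where j: "fst ` A j \<subseteq> ?U"
        using nested_bounded_coordinates(2)[OF cl dec b0 oU KU] by (rule exE)
      have "c < ?M (fst ` A j)" using A(1) by (simp add: P_def)
      also have "\<dots> \<le> ?M ?U" by (rule net_content_mono[OF j])
      also have "\<dots> \<le> ?N * emeasure (cell_measure t) \<U>" by (rule net_content_dyadic_nbhds)
      also have "\<dots> \<le> ?N * (c / ?N)" using U(2) by (intro mult_left_mono) auto
      also have "\<dots> = c" by (simp only: ennreal_times_divide mult.commute[of _ c] ennreal_mult_divide_eq[OF N N'])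
      finally show False by simp
    qed
  qed
qed

section \<open>Energy of the masses on dyadic cubes\<close>

lemma sum_UN_le:
  fixes f :: "'a \<Rightarrow> real"
  assumes "finite I" "\<And>i. i \<in> I \<Longrightarrow> finite (A i)" "\<And>x. 0 \<le> f x"
  shows "sum f (\<Union>i\<in>I. A i) \<le> (\<Sum>i\<in>I. sum f (A i))"
  using assms(1,2)
proof (induction I rule: finite_induct)
  case (insert i I)
  have "sum f (A i \<union> (\<Union>i\<in>I. A i)) \<le> sum f (A i) + sum f (\<Union>i\<in>I. A i)"
    using insert.hyps insert.prems assms(3)
    by (subst sum_Un) (auto intro!: sum_nonneg)
  then show ?case using insert by simp
qed simp

declare dyadic.mass.simps [simp del]

definition dyadic_point :: "(real ^ 'n) set \<Rightarrow> nat \<Rightarrow> ('n \<Rightarrow> int) \<Rightarrow> real ^ 'n" where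
  "dyadic_point K k l = (SOME x. x \<in> K \<and> dyadic k x = l)"

lemma dyadic_point:
  assumes "l \<in> dyadic k ` K"
  shows "dyadic_point K k l \<in> K" "dyadic k (dyadic_point K k l) = l"
  using someI_ex[of "\<lambda>x. x \<in> K \<and> dyadic k x = l"] assms unfolding dyadic_point_def by auto

lemma dyadic_same_cell_dist:
  fixes x y :: "real ^ 'n"
  assumes "dyadic k x = dyadic k y"
  shows "norm (x - y) \<le> real CARD('n) * (1/2)^k"
proof -
  have "\<bar>2^k * x $ i - 2^k * y $ i\<bar> \<le> 1" for i
    using fun_cong[OF assms, of i] unfolding dyadic_def by linarith
  from dyadic_eq_dist[OF this] show ?thesis by simp
qed

text \<open>For 2^-k < |z| <= 1 take j with 2^-j within a factor 2 of |z|: the kernel is at most (2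
  * 2^-(k-j))^s, a single term of the sum. Shorter z use the term j = k, and |z| > 1 uses the
  isolated term.\<close>

lemma profile_kernel_annuli:
  fixes z :: "'a::euclidean_space"
  assumes s: "0 < s"
  shows "profile_kernel s ((1/2)^k) z
    \<le> ((1/2)^k) powr s + (\<Sum>j\<le>k. of_bool (norm z \<le> (1/2)^j) * (2 * (1/2)^(k-j)) powr s)"
proof -
  let ?S = "\<Sum>j\<le>k. of_bool (norm z \<le> (1/2)^j) * (2 * (1/2)^(k-j)) powr s"
  have S0: "0 \<le> ?S" by (rule sum_nonneg) simp
  have summand: "(2 * (1/2)^(k-j)) powr s \<le> ?S" if "j \<le> k" "norm z \<le> (1/2)^j" for j
    using member_le_sum[of j "{..k}" "\<lambda>j. of_bool (norm z \<le> (1/2)^j) * (2 * (1/2)^(k-j)) powr s"] that by simp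
  consider "norm z \<le> (1/2)^k" | "(1/2)^k < norm z" "norm z \<le> 1" | "1 < norm z" by linarith
  then show ?thesis
  proof cases
    case 1
    have "1 \<le> (2::real) powr s" using s by (simp add: ge_one_powr_ge_zero)
    then have "1 \<le> ?S" using summand[of k] 1 by simp
    moreover have "0 \<le> ((1/2::real)^k) powr s" by simp
    ultimately show ?thesis using profile_kernel_le_1[of s "(1/2)^k" z] by linarith
  next
    case 2
    have "0 < norm z" by (rule le_less_trans[OF _ 2(1)]) simp
    then obtain j where j: "norm z \<le> (1/2)^j" "(1/2)^j < 2 * norm z"
      using dyadic_scale[of "norm z"] 2(2) by blast
    have "(1/2::real)^k < (1/2)^j" using 2(1) j(1) by linarith
    then have jk: "j \<le> k" by (subst (asm) power_strict_decreasing_iff) auto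
    have e: "(1/2::real)^k = (1/2)^j * (1/2)^(k-j)" using jk by (simp flip: power_add)
    have "(1/2)^k / norm z \<le> 2 * (1/2)^(k-j)"
    proof -
      have "(1/2)^j * (1/2)^(k-j) \<le> 2 * norm z * (1/2)^(k-j)" using j(2) by (intro mult_right_mono) auto
      then show ?thesis unfolding e using \<open>0 < norm z\<close> by (simp add: divide_le_eq mult_ac)
    qed
    then have "((1/2)^k / norm z) powr s \<le> (2 * (1/2)^(k-j)) powr s" using s by (intro powr_mono2) auto
    also have "\<dots> \<le> ?S" by (rule summand[OF jk j(1)])
    finally have "((1/2)^k / norm z) powr s \<le> ?S" .
    moreover have "profile_kernel s ((1/2)^k) z \<le> ((1/2)^k / norm z) powr s"
      using \<open>0 < norm z\<close> s by (auto simp: profile_kernel_def)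
    moreover have "0 \<le> ((1/2::real)^k) powr s" by simp
    ultimately show ?thesis by linarith
  next
    case 3
    then have "((1/2)^k / norm z) powr s \<le> ((1/2)^k) powr s"
      using s by (intro powr_mono2) (auto simp: divide_le_eq)
    moreover have "profile_kernel s ((1/2)^k) z \<le> ((1/2)^k / norm z) powr s"
      using 3 s by (auto simp: profile_kernel_def)
    ultimately show ?thesis using S0 by linarith
  qed
qed

context
  fixes K :: "(real ^ 'n) set" and q' :: real
  assumes bdd: "bounded K"
begin

abbreviation "K_mass \<equiv> dyadic.mass q' K"
abbreviation "K_lab k \<equiv> dyadic k ` K"

lemma fin_lab: "finite (K_lab k)"
  by (rule finite_dyadic_bounded[OF bdd])

lemma mass_total_level: "(\<Sum>l\<in>K_lab k. K_mass k l) = (\<Sum>l\<in>K_lab 0. K_mass 0 l)"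
  using dyadic.mass_descendants[OF fin_lab, of 0 k q' UNIV] by simp

text \<open>Points within 2^-j of y lie in the 3^n cubes of level j around y, each of mass at most
  2^(-q'j).\<close>

lemma mass_near_le:
  assumes "j \<le> k"
  shows "(\<Sum>l\<in>{l\<in>K_lab k. norm (dyadic_point K k l - y) \<le> (1/2)^j}. K_mass k l)
    \<le> 3 ^ CARD('n) * (1/2) powr (q' * real j)"
proof -
  let ?P = "PiE UNIV (\<lambda>i. {dyadic j y i - 1..dyadic j y i + 1})"
  let ?par = "\<lambda>(l :: 'n \<Rightarrow> int) i. l i div 2"
  have finP: "finite ?P" by (intro finite_PiE) auto
  have "(\<Sum>l\<in>{l\<in>K_lab k. norm (dyadic_point K k l - y) \<le> (1/2)^j}. K_mass k l)
      \<le> (\<Sum>l\<in>{l\<in>K_lab k. (?par ^^ (k - j)) l \<in> ?P}. K_mass k l)"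
  proof (rule sum_mono2)
    show "finite {l \<in> K_lab k. (?par ^^ (k - j)) l \<in> ?P}" using fin_lab by simp
    show "{l \<in> K_lab k. norm (dyadic_point K k l - y) \<le> (1/2)^j} \<subseteq> {l \<in> K_lab k. (?par ^^ (k - j)) l \<in> ?P}"
    proof
      fix l assume l: "l \<in> {l \<in> K_lab k. norm (dyadic_point K k l - y) \<le> (1/2)^j}"
      let ?x = "dyadic_point K k l"
      have "(?par ^^ (k - j)) l = dyadic j ?x"
        using dyadic.lab_funpow[OF assms, of ?x] dyadic_point(2)[of l k K] l by simp
      moreover have "\<bar>dyadic j ?x i - dyadic j y i\<bar> \<le> 1" for i
        using l by (intro dyadic_close) (simp add: dist_norm)
      then have "dyadic j ?x i \<in> {dyadic j y i - 1..dyadic j y i + 1}" for i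
        by (metis abs_le_iff atLeastAtMost_iff diff_le_eq add.commute le_diff_eq minus_diff_eq diff_diff_eq2)
      ultimately show "l \<in> {l \<in> K_lab k. (?par ^^ (k - j)) l \<in> ?P}" using l by auto
    qed
  qed (simp add: dyadic.mass_nonneg)
  also have "\<dots> = (\<Sum>l\<in>?P \<inter> K_lab j. K_mass j l)"
    by (rule dyadic.mass_descendants[OF fin_lab assms])
  also have "\<dots> \<le> (\<Sum>l\<in>?P. K_mass j l)"
    by (rule sum_mono2) (use finP in \<open>auto simp: dyadic.mass_nonneg\<close>)
  also have "\<dots> \<le> (\<Sum>l\<in>?P. (1/2) powr (q' * real j))"
    by (rule sum_mono) (rule dyadic.mass_le[OF fin_lab])
  also have "\<dots> = real (card ?P) * (1/2) powr (q' * real j)" by simp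
  also have "card ?P = 3 ^ CARD('n)" by (subst card_PiE) (auto simp: nat_add_distrib)
  finally show ?thesis by simp
qed

text \<open>Ball masses 2^(-q'j) against kernel values of order 2^(-s(k-j)) give 2^(-q'k) times a
  geometric series in k - j of ratio 2^-(s-q'), which converges because q' < s.\<close>

lemma mass_kernel_le:
  assumes q': "0 < q'" "q' < s"
  shows "(\<Sum>l\<in>K_lab k. K_mass k l * profile_kernel s ((1/2)^k) (dyadic_point K k l - y))
    \<le> ((\<Sum>l\<in>K_lab 0. K_mass 0 l) + 2 powr s * 3 ^ CARD('n) / (1 - (1/2) powr (s - q'))) * (1/2) powr (q' * real k)"
proof -
  let ?W = "\<Sum>l\<in>K_lab 0. K_mass 0 l"
  let ?z = "\<lambda>l. dyadic_point K k l - y"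
  define \<rho> where "\<rho> = (1/2::real) powr (s - q')"
  have \<rho>: "0 < \<rho>" "\<rho> < 1" using powr_less_mono2[of "s - q'" "1/2" 1] q' by (auto simp: \<rho>_def)
  have s: "0 < s" using q' by simp
  have "(\<Sum>l\<in>K_lab k. K_mass k l * profile_kernel s ((1/2)^k) (?z l))
    \<le> (\<Sum>l\<in>K_lab k. K_mass k l * (((1/2)^k) powr s
        + (\<Sum>j\<le>k. of_bool (norm (?z l) \<le> (1/2)^j) * (2 * (1/2)^(k-j)) powr s)))"
    by (intro sum_mono mult_left_mono profile_kernel_annuli s dyadic.mass_nonneg)
  also have "\<dots> = (\<Sum>l\<in>K_lab k. K_mass k l) * ((1/2)^k) powr s
      + (\<Sum>l\<in>K_lab k. \<Sum>j\<le>k. K_mass k l * (of_bool (norm (?z l) \<le> (1/2)^j) * (2 * (1/2)^(k-j)) powr s))"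
    unfolding distrib_left sum.distrib sum_distrib_left sum_distrib_right ..
  also have "(\<Sum>l\<in>K_lab k. \<Sum>j\<le>k. K_mass k l * (of_bool (norm (?z l) \<le> (1/2)^j) * (2 * (1/2)^(k-j)) powr s))
      = (\<Sum>j\<le>k. (2 * (1/2)^(k-j)) powr s * (\<Sum>l\<in>{l\<in>K_lab k. norm (?z l) \<le> (1/2)^j}. K_mass k l))"
  proof (subst sum.swap, rule sum.cong)
    fix j
    have "(\<Sum>l\<in>K_lab k. K_mass k l * (of_bool (norm (?z l) \<le> (1/2)^j) * (2 * (1/2)^(k-j)) powr s))
        = (\<Sum>l\<in>K_lab k. if norm (?z l) \<le> (1/2)^j then (2 * (1/2)^(k-j)) powr s * K_mass k l else 0)"
      by (rule sum.cong) auto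
    also have "\<dots> = (\<Sum>l\<in>{l\<in>K_lab k. norm (?z l) \<le> (1/2)^j}. (2 * (1/2)^(k-j)) powr s * K_mass k l)"
      by (rule sum.inter_filter[OF fin_lab, symmetric])
    finally show "(\<Sum>l\<in>K_lab k. K_mass k l * (of_bool (norm (?z l) \<le> (1/2)^j) * (2 * (1/2)^(k-j)) powr s))
        = (2 * (1/2)^(k-j)) powr s * (\<Sum>l\<in>{l\<in>K_lab k. norm (?z l) \<le> (1/2)^j}. K_mass k l)"
      by (simp only: sum_distrib_left)
  qed simp
  also have "\<dots> \<le> (\<Sum>j\<le>k. (2 * (1/2)^(k-j)) powr s * (3 ^ CARD('n) * (1/2) powr (q' * real j)))"
    by (intro sum_mono mult_left_mono mass_near_le) auto
  also have "\<dots> = (\<Sum>j\<le>k. 2 powr s * 3 ^ CARD('n) * (1/2) powr (q' * real k) * \<rho> ^ (k - j))"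
  proof (rule sum.cong)
    fix j assume "j \<in> {..k}"
    then have k: "real k = real j + real (k - j)" by simp
    have "q' * real j = q' * real k + (- q') * real (k - j)" unfolding k by (simp add: algebra_simps)
    then have "(1/2::real) powr (q' * real j) = (1/2) powr (q' * real k) * (1/2) powr (- q' * real (k - j))"
      by (simp only: powr_add)
    moreover have "(2 * (1/2)^(k-j)) powr s = 2 powr s * (1/2::real) powr (s * real (k - j))"
      by (simp add: powr_mult half_powr_eq)
    moreover have "(1/2::real) powr (s * real (k - j)) * (1/2) powr (- q' * real (k - j)) = \<rho> ^ (k - j)"
      unfolding powr_add[symmetric] \<rho>_def by (simp add: powr_powr algebra_simps flip: powr_realpow)
    ultimately show "(2 * (1/2)^(k-j)) powr s * (3 ^ CARD('n) * (1/2) powr (q' * real j))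
        = 2 powr s * 3 ^ CARD('n) * (1/2) powr (q' * real k) * \<rho> ^ (k - j)"
      by (simp only: mult_ac)
  qed simp
  also have "\<dots> = 2 powr s * 3 ^ CARD('n) * (1/2) powr (q' * real k) * (\<Sum>j\<le>k. \<rho> ^ (k - j))"
    by (simp only: sum_distrib_left)
  also have "(\<Sum>j\<le>k. \<rho> ^ (k - j)) = (\<Sum>j\<le>k. \<rho> ^ j)"
    using sum.atLeastAtMost_rev[of "\<lambda>j. \<rho> ^ j" 0 k] by (simp add: atLeast0AtMost)
  also have "\<dots> \<le> 1 / (1 - \<rho>)"
    using sum_le_suminf[of "\<lambda>j. \<rho> ^ j" "{..k}"] \<rho> by (simp add: suminf_geometric summable_geometric)
  finally have 1: "(\<Sum>l\<in>K_lab k. K_mass k l * profile_kernel s ((1/2)^k) (?z l))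
      \<le> (\<Sum>l\<in>K_lab k. K_mass k l) * ((1/2)^k) powr s
        + 2 powr s * 3 ^ CARD('n) * (1/2) powr (q' * real k) * (1 / (1 - \<rho>))"
    by (simp add: mult_left_mono)
  have W0: "0 \<le> ?W" by (intro sum_nonneg dyadic.mass_nonneg)
  have "((1/2::real)^k) powr s \<le> (1/2) powr (q' * real k)"
    unfolding half_powr_eq[symmetric] using q' by (intro powr_mono') (auto simp: mult_right_mono)
  then have "(\<Sum>l\<in>K_lab k. K_mass k l) * ((1/2)^k) powr s \<le> ?W * (1/2) powr (q' * real k)"
    unfolding mass_total_level[of k] using W0 by (rule mult_left_mono)
  moreover have "(?W + 2 powr s * 3 ^ CARD('n) / (1 - \<rho>)) * (1/2) powr (q' * real k)
      = ?W * (1/2) powr (q' * real k) + 2 powr s * 3 ^ CARD('n) * (1/2) powr (q' * real k) * (1 / (1 - \<rho>))"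
    by (simp add: distrib_right)
  ultimately show ?thesis using 1 unfolding \<rho>_def[symmetric] by linarith
qed

text \<open>Put \<open>\<rho>\<close> = 2^-eps with eps the given exponent. The weights (1 -
  \<open>\<rho>\<close>) \<open>\<rho>\<close>^k for k <= k1 sum to less than 1, so the levels
  cannot all capture less than their share of the total mass.\<close>

lemma mass_pigeonhole:
  assumes cov: "\<And>x. x \<in> K \<Longrightarrow> \<exists>k\<le>k1. dyadic k x \<in> Q k" and \<epsilon>: "0 < \<epsilon>"
    and W: "0 < (\<Sum>l\<in>K_lab 0. K_mass 0 l)"
  shows "\<exists>k\<le>k1. (\<Sum>l\<in>K_lab 0. K_mass 0 l) * (1 - (1/2) powr \<epsilon>) * ((1/2) powr \<epsilon>) ^ k \<le> (\<Sum>l\<in>Q k \<inter> K_lab k. K_mass k l)"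
proof (rule ccontr)
  assume contra: "\<not> ?thesis"
  let ?W = "\<Sum>l\<in>K_lab 0. K_mass 0 l"
  let ?par = "\<lambda>(l :: 'n \<Rightarrow> int) i. l i div 2"
  define \<rho> where "\<rho> = (1/2::real) powr \<epsilon>"
  have \<rho>: "0 < \<rho>" "\<rho> < 1" using powr_less_mono2[of \<epsilon> "1/2" 1] \<epsilon> by (auto simp: \<rho>_def)
  have "?W = (\<Sum>l\<in>K_lab k1. K_mass k1 l)" by (rule mass_total_level[symmetric])
  also have "\<dots> \<le> (\<Sum>l\<in>(\<Union>k\<in>{..k1}. {l\<in>K_lab k1. (?par ^^ (k1 - k)) l \<in> Q k}). K_mass k1 l)"
  proof (rule sum_mono2)
    show "finite (\<Union>k\<in>{..k1}. {l\<in>K_lab k1. (?par ^^ (k1 - k)) l \<in> Q k})" using fin_lab by simp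
    show "K_lab k1 \<subseteq> (\<Union>k\<in>{..k1}. {l\<in>K_lab k1. (?par ^^ (k1 - k)) l \<in> Q k})"
    proof
      fix l assume "l \<in> K_lab k1"
      then obtain x where x: "x \<in> K" "l = dyadic k1 x" by blast
      then obtain k where k: "k \<le> k1" "dyadic k x \<in> Q k" using cov by blast
      then have "(?par ^^ (k1 - k)) l \<in> Q k" using dyadic.lab_funpow[OF k(1), of x] x(2) by simp
      then show "l \<in> (\<Union>k\<in>{..k1}. {l\<in>K_lab k1. (?par ^^ (k1 - k)) l \<in> Q k})" using k(1) x by auto
    qed
  qed (simp add: dyadic.mass_nonneg)
  also have "\<dots> \<le> (\<Sum>k\<in>{..k1}. \<Sum>l\<in>{l\<in>K_lab k1. (?par ^^ (k1 - k)) l \<in> Q k}. K_mass k1 l)"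
    by (rule sum_UN_le) (auto simp: fin_lab dyadic.mass_nonneg)
  also have "\<dots> = (\<Sum>k\<in>{..k1}. \<Sum>l\<in>Q k \<inter> K_lab k. K_mass k l)"
    by (rule sum.cong) (auto intro: dyadic.mass_descendants[OF fin_lab])
  also have "\<dots> \<le> (\<Sum>k\<in>{..k1}. ?W * (1 - \<rho>) * \<rho> ^ k)"
  proof (rule sum_mono)
    fix k assume "k \<in> {..k1}"
    then show "(\<Sum>l\<in>Q k \<inter> K_lab k. K_mass k l) \<le> ?W * (1 - \<rho>) * \<rho> ^ k"
      using contra unfolding \<rho>_def by (meson atMost_iff linear)
  qed
  also have "\<dots> = ?W * ((1 - \<rho>) * (\<Sum>k\<le>k1. \<rho> ^ k))" by (simp add: sum_distrib_left mult.assoc)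
  also have "(1 - \<rho>) * (\<Sum>k\<le>k1. \<rho> ^ k) = 1 - \<rho> ^ Suc k1"
    using one_diff_power_eq[of \<rho> "Suc k1"] by (simp only: lessThan_Suc_atMost)
  also have "?W * (1 - \<rho> ^ Suc k1) < ?W * 1"
    using W \<rho> by (intro mult_strict_left_mono) auto
  finally show False by simp
qed

end

section \<open>Pairs of cubes with close projections, and the Hausdorff estimate\<close>

lemma dyadic_nbhd_dist:
  fixes x y :: "real ^ 'n"
  assumes "x \<in> dyadic_nbhd u" "y \<in> dyadic_nbhd u"
  shows "norm (x - y) \<le> real CARD('n) * 4 * (1/2)^fst u"
proof (rule dyadic_eq_dist)
  fix i
  have "\<bar>2 ^ fst u * x $ i - real_of_int (snd u i)\<bar> < 2" "\<bar>2 ^ fst u * y $ i - real_of_int (snd u i)\<bar> < 2"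
    using assms by (auto simp: dyadic_nbhd_def)
  then show "\<bar>2 ^ fst u * x $ i - 2 ^ fst u * y $ i\<bar> \<le> 4" by linarith
qed

text \<open>The constant is 6 = 1 + 4 + 1: each representative is within one cube of x or y, and the
  box u has side 4 * 2^-k.\<close>

lemma norm_orth_proj_dyadic_points:
  fixes K :: "(real ^ 'n) set"
  assumes V: "subspace V" and x: "x \<in> K" "dyadic k x = l" and y: "y \<in> K" "dyadic k y = l'"
    and u: "orth_proj V x \<in> dyadic_nbhd u" "orth_proj V y \<in> dyadic_nbhd u" "fst u = k"
  shows "norm (orth_proj V (dyadic_point K k l - dyadic_point K k l')) \<le> 6 * real CARD('n) * (1/2)^k"
proof -
  let ?c = "real CARD('n) * (1/2)^k"
  let ?p = "dyadic_point K k"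
  have p: "norm (orth_proj V (?p (dyadic k z) - z)) \<le> ?c" if "z \<in> K" for z
  proof -
    have "dyadic k (?p (dyadic k z)) = dyadic k z" by (rule dyadic_point(2)) (use that in blast)
    from dyadic_same_cell_dist[OF this] norm_orth_proj_le[OF V, of "?p (dyadic k z) - z"]
    show ?thesis by linarith
  qed
  have 1: "norm (orth_proj V (?p l - x)) \<le> ?c" using p[OF x(1)] x(2) by simp
  have 2: "norm (orth_proj V (?p l' - y)) \<le> ?c" using p[OF y(1)] y(2) by simp
  have 3: "norm (orth_proj V x - orth_proj V y) \<le> 4 * ?c" using dyadic_nbhd_dist[OF u(1,2)] u(3) by simp
  have "orth_proj V (?p l - ?p l')
      = orth_proj V (?p l - x) + (orth_proj V x - orth_proj V y) - orth_proj V (?p l' - y)"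
    by (simp add: linear_diff[OF linear_orth_proj[OF V]])
  also have "norm \<dots> \<le> norm (orth_proj V (?p l - x) + (orth_proj V x - orth_proj V y)) + norm (orth_proj V (?p l' - y))"
    by (rule norm_triangle_ineq4)
  also have "\<dots> \<le> norm (orth_proj V (?p l - x)) + norm (orth_proj V x - orth_proj V y) + norm (orth_proj V (?p l' - y))"
    by (intro add_right_mono norm_triangle_ineq)
  also have "\<dots> \<le> ?c + 4 * ?c + ?c" by (intro add_mono 1 2 3)
  finally show ?thesis by simp
qed

text \<open>Cauchy-Schwarz for the sums of f over the fibres of h; the squared fibre sums count
  exactly the pairs in a common fibre.\<close>

lemma sum_group_square_le:
  fixes f :: "'a \<Rightarrow> real"
  assumes "finite R" "finite U" "h ` R \<subseteq> U"
  shows "(\<Sum>l\<in>R. f l)\<^sup>2 \<le> real (card U) * (\<Sum>l\<in>R. \<Sum>l'\<in>R. f l * f l' * of_bool (h l = h l'))"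
proof -
  define b where "b u = (\<Sum>l\<in>{l\<in>R. h l = u}. f l)" for u
  have "(\<Sum>l\<in>R. f l) = (\<Sum>u\<in>U. b u)"
    unfolding b_def by (rule sum.group[symmetric]) (use assms in auto)
  then have "(\<Sum>l\<in>R. f l)\<^sup>2 \<le> (\<Sum>u\<in>U. (b u)\<^sup>2) * real (card U)"
    using sum_squared_le_sum_of_squares[of b U] by simp
  also have "(\<Sum>u\<in>U. (b u)\<^sup>2) = (\<Sum>u\<in>U. \<Sum>l\<in>{l\<in>R. h l = u}. f l * b (h l))"
    by (rule sum.cong) (auto simp: power2_eq_square b_def sum_distrib_right intro!: sum.cong)
  also have "\<dots> = (\<Sum>l\<in>R. f l * b (h l))"
    by (rule sum.group) (use assms in auto)
  also have "\<dots> = (\<Sum>l\<in>R. \<Sum>l'\<in>R. f l * f l' * of_bool (h l = h l'))"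
  proof (rule sum.cong[OF refl])
    fix l
    have "b (h l) = (\<Sum>l'\<in>R. if h l' = h l then f l' else 0)"
      unfolding b_def by (rule sum.inter_filter[OF assms(1)])
    also have "\<dots> = (\<Sum>l'\<in>R. f l' * of_bool (h l = h l'))" by (rule sum.cong) auto
    finally show "f l * b (h l) = (\<Sum>l'\<in>R. f l * f l' * of_bool (h l = h l'))"
      by (simp add: sum_distrib_left mult.assoc)
  qed
  finally show ?thesis by (simp add: mult.commute)
qed

text \<open>Compactness of \<open>K\<close> reduces a cover of the projection by cells of small total content to a finite
  one, and then some level \<open>k\<close> of the cover carries a definite part of the mass of \<open>K\<close>.\<close>

lemma frequently_large_pair_sum:
  fixes K :: "(real ^ 'n) set" and q' :: real
  defines "W \<equiv> (\<Sum>l\<in>dyadic 0 ` K. dyadic.mass q' K 0 l)"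
  assumes K: "compact K" and V: "V \<in> grassmannian m" and q: "0 < q"
    and null: "net_content dyadic q (orth_proj V ` K) = 0" and \<epsilon>: "0 < \<epsilon>" and W: "0 < W"
  shows "\<exists>\<^sub>F k in sequentially. (W * (1 - (1/2) powr \<epsilon>))\<^sup>2 * (1/2) powr ((q + 2 * \<epsilon>) * real k)
    \<le> (\<Sum>l\<in>dyadic k ` K. \<Sum>l'\<in>dyadic k ` K. dyadic.mass q' K k l * dyadic.mass q' K k l'
        * of_bool (norm (orth_proj V (dyadic_point K k l - dyadic_point K k l')) \<le> 6 * real CARD('n) * (1/2)^k))"
  unfolding frequently_sequentially
proof
  fix k0
  let ?M = "dyadic.mass q' K" and ?\<nu> = "emeasure (cell_measure q :: (nat \<times> ('n \<Rightarrow> int)) measure)"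
  have bdd: "bounded K" using K by (rule compact_imp_bounded)
  have sub: "subspace V" by (rule subspace_grass[OF V])
  \<comment> \<open>A total cost below 2^(-q k0) excludes every cell of level at most k0 from the
    cover.\<close>
  have "0 < (1/2::real) powr (q * real k0)" by simp
  then have "net_content dyadic q (orth_proj V ` K) < ennreal ((1/2) powr (q * real k0))" using null by simp
  then obtain \<U> where U: "orth_proj V ` K \<subseteq> (\<Union>u\<in>\<U>. cell dyadic u)" "?\<nu> \<U> < ennreal ((1/2) powr (q * real k0))"
    by (rule net_content_lessE)
  have lev: "k0 < fst u" if "u \<in> \<U>" for u
  proof (rule ccontr)
    assume "\<not> k0 < fst u"
    then have "q * real (fst u) \<le> q * real k0" using q by simp
    then have "(1/2::real) powr (q * real k0) \<le> (1/2) powr (q * real (fst u))"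
      by (intro powr_mono') auto
    then have "ennreal ((1/2) powr (q * real k0)) \<le> ennreal ((1/2) powr (q * real (fst u)))" by (rule ennreal_leI)
    also have "\<dots> \<le> ?\<nu> \<U>" by (rule emeasure_cell_measure_ge[OF that])
    finally show False using U(2) by simp
  qed
  define G where "G u = orth_proj V -` dyadic_nbhd u" for u :: "nat \<times> ('n \<Rightarrow> int)"
  have "open (G u)" for u
    unfolding G_def using linear_orth_proj[OF sub]
    by (intro open_vimage open_dyadic_nbhd linear_continuous_on) (simp add: linear_conv_bounded_linear)
  moreover have "K \<subseteq> (\<Union>u\<in>\<U>. G u)"
  proof
    fix x assume "x \<in> K"
    then obtain u where "u \<in> \<U>" "orth_proj V x \<in> cell dyadic u" using U(1) by blast
    then show "x \<in> (\<Union>u\<in>\<U>. G u)" using cell_subset_dyadic_nbhd[of u] by (auto simp: G_def)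
  qed
  ultimately obtain \<U>' where U': "\<U>' \<subseteq> \<U>" "finite \<U>'" "K \<subseteq> (\<Union>u\<in>\<U>'. G u)"
    using compactE_image[OF K, of \<U> G] by metis
  define k1 where "k1 = Max (fst ` \<U>')"
  \<comment> \<open>The cubes of level k that contain a point of K whose projection is handled by a
    box of level k of the finite cover.\<close>
  define Q where "Q k = {l. \<exists>x\<in>K. \<exists>u\<in>\<U>'. fst u = k \<and> dyadic k x = l \<and> x \<in> G u}" for k
  have "\<exists>k\<le>k1. W * (1 - (1/2) powr \<epsilon>) * ((1/2) powr \<epsilon>) ^ k \<le> (\<Sum>l\<in>Q k \<inter> dyadic k ` K. ?M k l)"
    unfolding W_def
  proof (rule mass_pigeonhole[OF bdd _ \<epsilon>])
    fix x assume x: "x \<in> K"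
    then obtain u where u: "u \<in> \<U>'" "x \<in> G u" using U'(3) by blast
    have "fst u \<le> k1" unfolding k1_def using U'(2) u(1) by (intro Max_ge) auto
    moreover have "dyadic (fst u) x \<in> Q (fst u)" using x u unfolding Q_def by blast
    ultimately show "\<exists>k\<le>k1. dyadic k x \<in> Q k" by blast
  next
    show "0 < (\<Sum>l\<in>dyadic 0 ` K. ?M 0 l)" using W by (simp only: W_def)
  qed
  then obtain k where k: "W * (1 - (1/2) powr \<epsilon>) * ((1/2) powr \<epsilon>) ^ k \<le> (\<Sum>l\<in>Q k \<inter> dyadic k ` K. ?M k l)" by blast
  have "Q k \<inter> dyadic k ` K = Q k" by (auto simp: Q_def)
  with k have kQ: "W * (1 - (1/2) powr \<epsilon>) * ((1/2) powr \<epsilon>) ^ k \<le> (\<Sum>l\<in>Q k. ?M k l)" by simp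
  have \<rho>: "(1/2::real) powr \<epsilon> < 1" using powr_less_mono2[of \<epsilon> "1/2" 1] \<epsilon> by simp
  then have pos: "0 < W * (1 - (1/2) powr \<epsilon>) * ((1/2) powr \<epsilon>) ^ k" using W by simp
  then have "Q k \<noteq> {}" using kQ by auto
  \<comment> \<open>Level k captures positive mass, so it actually occurs in the cover; hence k >
    k0.\<close>
  then obtain u0 where "u0 \<in> \<U>'" "fst u0 = k" unfolding Q_def by blast
  then have "k0 < k" using lev U'(1) by blast
  have finQ: "finite (Q k)" by (rule finite_subset[OF _ fin_lab[OF bdd, of k]]) (auto simp: Q_def)
  define Uk where "Uk = {u\<in>\<U>'. fst u = k}"
  have finUk: "finite Uk" using U'(2) by (simp add: Uk_def)
  have "\<forall>l\<in>Q k. \<exists>u. u \<in> Uk \<and> (\<exists>x\<in>K. dyadic k x = l \<and> x \<in> G u)" unfolding Q_def Uk_def by blast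
  \<comment> \<open>Each captured cube is assigned one box of level k; cubes with the same box have
    close projections.\<close>
  from bchoice[OF this] obtain h where h: "\<And>l. l \<in> Q k \<Longrightarrow> h l \<in> Uk \<and> (\<exists>x\<in>K. dyadic k x = l \<and> x \<in> G (h l))" by blast
  let ?a = "(1/2::real) powr (q * real k)"
  \<comment> \<open>The cover costs at most 1 in total, so it has at most 2^(qk) cells of level k.
    This is the number of groups in the Cauchy-Schwarz step.\<close>
  have "real (card Uk) * ?a \<le> 1"
  proof -
    have "ennreal (real (card Uk) * ?a) = ennreal (\<Sum>u\<in>Uk. (1/2) powr (q * real (fst u)))"
      by (simp add: Uk_def)
    also have "\<dots> = ?\<nu> Uk" by (rule emeasure_cell_measure_finite[OF finUk, symmetric])
    also have "\<dots> \<le> ?\<nu> \<U>" by (rule emeasure_mono) (use U'(1) in \<open>auto simp: Uk_def\<close>)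
    also have "\<dots> \<le> ennreal 1"
    proof -
      have "(1/2::real) powr (q * real k0) \<le> 1" using q by (intro powr_le1) auto
      then show ?thesis using U(2) by (meson ennreal_leI less_imp_le order_trans)
    qed
    finally show ?thesis by (simp add: ennreal_le_1)
  qed
  let ?D = "\<lambda>l l'. norm (orth_proj V (dyadic_point K k l - dyadic_point K k l')) \<le> 6 * real CARD('n) * (1/2)^k"
  have close: "?D l l'" if ll: "l \<in> Q k" "l' \<in> Q k" "h l = h l'" for l l'
  proof -
    obtain x where x: "x \<in> K" "dyadic k x = l" "x \<in> G (h l)" using h[OF ll(1)] by blast
    obtain y where y: "y \<in> K" "dyadic k y = l'" "y \<in> G (h l')" using h[OF ll(2)] by blast
    have "fst (h l) = k" using h[OF ll(1)] by (simp add: Uk_def)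
    then show ?thesis
      using x y ll(3) by (intro norm_orth_proj_dyadic_points[OF sub x(1,2) y(1,2), of "h l"]) (auto simp: G_def)
  qed
  let ?PS = "\<Sum>l\<in>dyadic k ` K. \<Sum>l'\<in>dyadic k ` K. ?M k l * ?M k l' * of_bool (?D l l')"
  have "(W * (1 - (1/2) powr \<epsilon>))\<^sup>2 * (1/2) powr ((q + 2 * \<epsilon>) * real k)
      = (W * (1 - (1/2) powr \<epsilon>) * ((1/2) powr \<epsilon>) ^ k)\<^sup>2 * ?a"
  proof -
    have "(1/2::real) powr ((q + 2 * \<epsilon>) * real k) = (1/2) powr (\<epsilon> * real k) * (1/2) powr (\<epsilon> * real k) * ?a"
      by (simp add: powr_add[symmetric] algebra_simps)
    moreover have "((1/2::real) powr \<epsilon>) ^ k = (1/2) powr (\<epsilon> * real k)"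
      by (simp add: powr_powr flip: powr_realpow)
    ultimately show ?thesis by (simp add: power2_eq_square mult_ac)
  qed
  also have "\<dots> \<le> (\<Sum>l\<in>Q k. ?M k l)\<^sup>2 * ?a"
    using kQ pos by (intro mult_right_mono power_mono) auto
  also have "\<dots> \<le> (real (card Uk) * (\<Sum>l\<in>Q k. \<Sum>l'\<in>Q k. ?M k l * ?M k l' * of_bool (h l = h l'))) * ?a"
    using h by (intro mult_right_mono sum_group_square_le finQ finUk) auto
  also have "\<dots> = (real (card Uk) * ?a) * (\<Sum>l\<in>Q k. \<Sum>l'\<in>Q k. ?M k l * ?M k l' * of_bool (h l = h l'))"
    by (simp only: mult_ac)
  also have "\<dots> \<le> 1 * (\<Sum>l\<in>Q k. \<Sum>l'\<in>Q k. ?M k l * ?M k l' * of_bool (h l = h l'))"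
    by (intro mult_right_mono sum_nonneg \<open>real (card Uk) * ?a \<le> 1\<close>) (simp add: dyadic.mass_nonneg)
  also have "\<dots> \<le> (\<Sum>l\<in>Q k. \<Sum>l'\<in>Q k. ?M k l * ?M k l' * of_bool (?D l l'))"
    unfolding mult_1 using close by (intro sum_mono mult_left_mono) (auto simp: dyadic.mass_nonneg)
  also have "\<dots> \<le> (\<Sum>l\<in>Q k. \<Sum>l'\<in>dyadic k ` K. ?M k l * ?M k l' * of_bool (?D l l'))"
    by (intro sum_mono sum_mono2 fin_lab[OF bdd]) (auto simp: dyadic.mass_nonneg Q_def)
  also have "\<dots> \<le> ?PS"
    by (intro sum_mono2 fin_lab[OF bdd] sum_nonneg) (auto simp: dyadic.mass_nonneg Q_def)
  finally show "\<exists>k\<ge>k0. (W * (1 - (1/2) powr \<epsilon>))\<^sup>2 * (1/2) powr ((q + 2 * \<epsilon>) * real k)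
    \<le> (\<Sum>l\<in>dyadic k ` K. \<Sum>l'\<in>dyadic k ` K. ?M k l * ?M k l' * of_bool (norm (orth_proj V (dyadic_point K k l - dyadic_point K k l')) \<le> 6 * real CARD('n) * (1/2)^k))"
    using \<open>k0 < k\<close> by (intro exI[of _ k]) simp
qed

text \<open>Chebyshev's inequality over the point masses: the sum of the pair sums is O(2^(-q'k)),
  but every V in A k has pair sum at least c 2^(-(q + 2 eps)k). Since q + 2 eps < q', the contents
  of the sets A k are summable.\<close>

lemma hausdorff_scale_null:
  fixes E :: "(real ^ 'n) set" and s :: real and m :: nat
  assumes E: "analytic_set E" and q: "0 < q" "q < q'" "q' < s"
    and t: "t = real (m * (CARD('n) - m - 1)) + s" and pos: "0 < net_content dyadic q' E"
  shows "net_content grass_label t {V \<in> grassmannian m. net_content dyadic q (orth_proj V ` E) = 0} = 0"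
proof -
  obtain K where K: "compact K" "K \<subseteq> E" "0 < net_content dyadic q' K"
    by (rule analytic_compact_subset_positive[OF E pos])
  have bdd: "bounded K" using K(1) by (rule compact_imp_bounded)
  let ?M = "dyadic.mass q' K" and ?L = "6 * real CARD('n)" and ?p = "dyadic_point K"
  define W where "W = (\<Sum>l\<in>dyadic 0 ` K. ?M 0 l)"
  have "net_content dyadic q' K \<le> ennreal W"
    unfolding W_def by (rule dyadic.mass_total[OF fin_lab[OF bdd]])
  with K(3) have W: "0 < W" by (metis ennreal_eq_0_iff le_zero_eq less_irrefl not_le)
  obtain B where B: "\<And>x. x \<in> K \<Longrightarrow> norm x \<le> B" "0 < B" using bdd by (auto simp: bounded_pos)
  obtain p where p: "2 * B < 2 ^ p" using real_arch_pow[of 2 "2 * B"] by auto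
  have D: "norm (x - y) \<le> 2 ^ p" if "x \<in> K" "y \<in> K" for x y
    using norm_triangle_ineq4[of x y] B(1)[OF that(1)] B(1)[OF that(2)] p by linarith
  have s: "0 < s" using q by simp
  have L1: "1 \<le> ?L" using zero_less_card_finite[where 'a='n] by linarith
  obtain C where C: "0 < C"
    "\<And>k A. A \<subseteq> (grassmannian m :: (real ^ 'n) set set) \<Longrightarrow> \<exists>F \<tau>. finite F \<and> F \<subseteq> A \<and> (\<forall>V. 0 \<le> \<tau> V)
      \<and> net_content grass_label t A \<le> ennreal (\<Sum>V\<in>F. \<tau> V)
      \<and> (\<forall>z. norm z \<le> 2^p \<longrightarrow>
            (\<Sum>V\<in>{V\<in>F. norm (orth_proj V z) \<le> ?L * (1/2)^k}. \<tau> V) \<le> C * profile_kernel s ((1/2)^k) z)"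
    using grassmannian_frostman[OF s L1 t, of p] by blast
  \<comment> \<open>This puts q + 2 eps at the midpoint of q and q'.\<close>
  define \<epsilon> where "\<epsilon> = (q' - q) / 4"
  have \<epsilon>: "0 < \<epsilon>" "q + 2 * \<epsilon> < q'" using q by (auto simp: \<epsilon>_def field_simps)
  define c where "c = (W * (1 - (1/2) powr \<epsilon>))\<^sup>2"
  have "(1/2::real) powr \<epsilon> < 1" using powr_less_mono2[of \<epsilon> "1/2" 1] \<epsilon> by simp
  then have c: "0 < c" using W \<epsilon> by (simp add: c_def)
  define B' where "B' = W + 2 powr s * 3 ^ CARD('n) / (1 - (1/2) powr (s - q'))"
  have "(1/2::real) powr (s - q') < 1" using powr_less_mono2[of "s - q'" "1/2" 1] q by simp
  then have B': "0 \<le> B'" using W by (simp add: B'_def)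
  define PS where "PS V k = (\<Sum>l\<in>dyadic k ` K. \<Sum>l'\<in>dyadic k ` K. ?M k l * ?M k l'
        * of_bool (norm (orth_proj V (?p k l - ?p k l')) \<le> ?L * (1/2)^k))" for V :: "(real ^ 'n) set" and k
  define A where "A k = {V \<in> grassmannian m. c * (1/2) powr ((q + 2 * \<epsilon>) * real k) \<le> PS V k}" for k
  define \<rho> where "\<rho> = (1/2::real) powr (q' - (q + 2 * \<epsilon>))"
  have \<rho>: "0 < \<rho>" "\<rho> < 1" using powr_less_mono2[of "q' - (q + 2 * \<epsilon>)" "1/2" 1] \<epsilon> by (auto simp: \<rho>_def)
  have null: "net_content grass_label t {V. \<exists>\<^sub>F k in sequentially. V \<in> A k} = 0"
  proof (rule net_content_limsup_eq_0)
    fix k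
    let ?\<theta> = "c * (1/2) powr ((q + 2 * \<epsilon>) * real k)"
    have \<theta>: "0 < ?\<theta>" using c by simp
    have "A k \<subseteq> grassmannian m" by (auto simp: A_def)
    from C(2)[OF this, of k] obtain F \<tau> where F: "finite F" "F \<subseteq> A k" "\<And>V. 0 \<le> \<tau> V"
        "net_content grass_label t (A k) \<le> ennreal (\<Sum>V\<in>F. \<tau> V)"
      and ker: "\<And>z. norm z \<le> 2^p \<Longrightarrow>
        (\<Sum>V\<in>{V\<in>F. norm (orth_proj V z) \<le> ?L * (1/2)^k}. \<tau> V) \<le> C * profile_kernel s ((1/2)^k) z"
      by (elim exE conjE) (rule that, auto)
    have "(\<Sum>V\<in>F. \<tau> V) * ?\<theta> = (\<Sum>V\<in>F. \<tau> V * ?\<theta>)" by (rule sum_distrib_right)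
    also have "\<dots> \<le> (\<Sum>V\<in>F. \<tau> V * PS V k)"
      using F(2) by (intro sum_mono mult_left_mono F(3)) (auto simp: A_def)
    also have "\<dots> = (\<Sum>V\<in>F. \<Sum>l\<in>dyadic k ` K. \<Sum>l'\<in>dyadic k ` K. ?M k l * ?M k l'
        * (\<tau> V * of_bool (norm (orth_proj V (?p k l - ?p k l')) \<le> ?L * (1/2)^k)))"
      unfolding PS_def by (simp add: sum_distrib_left mult_ac)
    also have "\<dots> = (\<Sum>l\<in>dyadic k ` K. \<Sum>l'\<in>dyadic k ` K. \<Sum>V\<in>F. ?M k l * ?M k l'
        * (\<tau> V * of_bool (norm (orth_proj V (?p k l - ?p k l')) \<le> ?L * (1/2)^k)))"
      by (subst sum.swap, rule sum.cong[OF refl], rule sum.swap)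
    also have "\<dots> \<le> (\<Sum>l\<in>dyadic k ` K. \<Sum>l'\<in>dyadic k ` K. ?M k l * ?M k l' * (C * profile_kernel s ((1/2)^k) (?p k l - ?p k l')))"
    proof (intro sum_mono)
      fix l l' assume l: "l \<in> dyadic k ` K" "l' \<in> dyadic k ` K"
      let ?z = "?p k l - ?p k l'"
      have "(\<Sum>V\<in>F. \<tau> V * of_bool (norm (orth_proj V ?z) \<le> ?L * (1/2)^k))
          = (\<Sum>V\<in>F. if norm (orth_proj V ?z) \<le> ?L * (1/2)^k then \<tau> V else 0)"
        by (rule sum.cong) auto
      also have "\<dots> = (\<Sum>V\<in>{V\<in>F. norm (orth_proj V ?z) \<le> ?L * (1/2)^k}. \<tau> V)"
        by (rule sum.inter_filter[OF F(1), symmetric])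
      also have "\<dots> \<le> C * profile_kernel s ((1/2)^k) ?z"
        by (rule ker[OF D]) (use dyadic_point(1) l in auto)
      finally show "(\<Sum>V\<in>F. ?M k l * ?M k l' * (\<tau> V * of_bool (norm (orth_proj V ?z) \<le> ?L * (1/2)^k)))
          \<le> ?M k l * ?M k l' * (C * profile_kernel s ((1/2)^k) ?z)"
        unfolding sum_distrib_left[symmetric] by (rule mult_left_mono) (simp add: dyadic.mass_nonneg)
    qed
    also have "\<dots> = (\<Sum>l'\<in>dyadic k ` K. \<Sum>l\<in>dyadic k ` K. ?M k l * ?M k l' * (C * profile_kernel s ((1/2)^k) (?p k l - ?p k l')))"
      by (rule sum.swap)
    also have "\<dots> = (\<Sum>l'\<in>dyadic k ` K. C * ?M k l' * (\<Sum>l\<in>dyadic k ` K. ?M k l * profile_kernel s ((1/2)^k) (?p k l - ?p k l')))"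
      by (simp add: sum_distrib_left mult_ac)
    also have "\<dots> \<le> (\<Sum>l'\<in>dyadic k ` K. C * ?M k l' * (B' * (1/2) powr (q' * real k)))"
      unfolding B'_def W_def using q C(1)
      by (intro sum_mono mult_left_mono mass_kernel_le[OF bdd]) (auto simp: dyadic.mass_nonneg)
    also have "\<dots> = C * W * B' * (1/2) powr (q' * real k)"
      unfolding W_def mass_total_level[OF bdd, of q' k, symmetric] by (simp add: sum_distrib_left sum_distrib_right mult_ac)
    finally have "(\<Sum>V\<in>F. \<tau> V) \<le> C * W * B' * (1/2) powr (q' * real k) / ?\<theta>"
      unfolding pos_le_divide_eq[OF \<theta>] .
    also have "\<dots> = C * W * B' / c * \<rho> ^ k"
    proof -
      have "(1/2::real) powr (q' * real k) = \<rho> ^ k * (1/2) powr ((q + 2 * \<epsilon>) * real k)"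
        unfolding \<rho>_def by (simp add: powr_powr powr_add[symmetric] left_diff_distrib flip: powr_realpow)
      then show ?thesis by simp
    qed
    finally show "net_content grass_label t (A k) \<le> ennreal (C * W * B' / c * \<rho> ^ k)"
      using F(4) by (meson ennreal_leI order_trans)
  next
    show "summable (\<lambda>k. C * W * B' / c * \<rho> ^ k)" using \<rho> by (intro summable_mult summable_geometric) simp
  next
    fix k show "0 \<le> C * W * B' / c * \<rho> ^ k" using C(1) W B' c \<rho> by simp
  qed
  have "{V \<in> grassmannian m. net_content dyadic q (orth_proj V ` E) = 0} \<subseteq> {V. \<exists>\<^sub>F k in sequentially. V \<in> A k}"
  proof
    fix V assume "V \<in> {V \<in> grassmannian m. net_content dyadic q (orth_proj V ` E) = 0}"
    then have V: "V \<in> grassmannian m" "net_content dyadic q (orth_proj V ` E) = 0" by auto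
    have "net_content dyadic q (orth_proj V ` K) = 0"
      using net_content_mono[OF image_mono[OF K(2)], of dyadic q "orth_proj V"] V(2) by simp
    from frequently_large_pair_sum[OF K(1) V(1) q(1) this \<epsilon>(1) W[unfolded W_def]]
    have "\<exists>\<^sub>F k in sequentially. c * (1/2) powr ((q + 2 * \<epsilon>) * real k) \<le> PS V k"
      unfolding W_def[symmetric] c_def[symmetric] PS_def[symmetric] .
    then show "V \<in> {V. \<exists>\<^sub>F k in sequentially. V \<in> A k}" using V(1) by (simp add: A_def)
  qed
  from net_content_mono[OF this, of grass_label t] null show ?thesis by simp
qed

section \<open>From null contents to dimensions\<close>

lemma net_content_antimono_exponent:
  assumes "t \<le> t'"
  shows "net_content lab t' A \<le> net_content lab t A"
proof (rule net_content_geI)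
  fix \<U> assume "A \<subseteq> (\<Union>u\<in>\<U>. cell lab u)"
  then have "net_content lab t' A \<le> emeasure (cell_measure t') \<U>" by (rule net_content_le)
  also have "\<dots> \<le> emeasure (cell_measure t) \<U>"
    unfolding emeasure_cell_measure_eq
    using assms by (intro nn_integral_mono ennreal_leI powr_mono') (auto intro: mult_right_mono)
  finally show "net_content lab t' A \<le> emeasure (cell_measure t) \<U>" .
qed

lemma hausdorff_dim_nonneg: "0 \<le> hausdorff_dim d A"
  unfolding hausdorff_dim_def by (rule INF_greatest) auto

lemma net_content_dyadic_eq_0_above_dim:
  fixes S :: "(real ^ 'n) set"
  assumes "hausdorff_dim dist S < ereal q"
  shows "net_content dyadic q S = 0"
proof -
  obtain t where t: "0 \<le> t" "hausdorff_measure dist t S = 0" "t < q"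
    using assms unfolding hausdorff_dim_def INF_less_iff by auto
  have "net_content dyadic t S = 0"
    by (rule net_content_dyadic_eq_0_of_hausdorff_measure[OF t(2,1)])
  then show ?thesis using net_content_antimono_exponent[of t q dyadic S] t(3) by simp
qed

lemma net_content_dyadic_pos_below_dim:
  fixes S :: "(real ^ 'n) set"
  assumes "ereal q < hausdorff_dim dist S" "0 < q"
  shows "0 < net_content dyadic q S"
proof (rule ccontr)
  assume "\<not> ?thesis"
  then have "net_content dyadic q S = 0" by (simp add: not_less)
  then have "hausdorff_measure dist q S = 0"
    by (rule hausdorff_measure_eq_0_of_net_content[where C = "real CARD('n)", OF _ assms(2)])
      (simp add: dist_norm dyadic_same_cell_dist)
  then have "hausdorff_dim dist S \<le> ereal q" using assms(2) by (intro hausdorff_dim_le) auto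
  then show False using assms(1) by simp
qed

lemma ereal_rat_between:
  assumes "x < ereal y"
  obtains r where "r \<in> \<rat>" "x < ereal r" "r < y"
proof -
  obtain z where z: "x < ereal z" "z < y" using ereal_dense2[OF assms] by auto
  obtain r where r: "r \<in> \<rat>" "z < r" "r < y" using Rats_dense_in_real[OF z(2)] by blast
  have "x < ereal r" using z(1) r(2) by (meson ereal_less_eq(3) less_imp_le order_less_le_trans)
  then show ?thesis using that r by blast
qed

text \<open>An exceptional V admits rationals q < q' with q above the dimension of the projection
  and q' below both s and the dimension of E. So the projection has null q-content while E has
  positive q'-content, and there are countably many such pairs.\<close>

lemma hausdorff_exceptional_null:
  fixes E :: "(real ^ 'n) set" and s :: real and m :: nat
  assumes E: "analytic_set E" and s: "0 < s" and t: "t = real (m * (CARD('n) - m - 1)) + s"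
  shows "net_content grass_label t
      {V \<in> grassmannian m. hausdorff_dim dist (orth_proj V ` E) < hausdorff_profile s E} = 0"
proof -
  define P where "P = {(q, q'). q \<in> \<rat> \<and> q' \<in> \<rat> \<and> 0 < q \<and> q < q' \<and> q' < s \<and> 0 < net_content dyadic q' E}"
  define X where "X = (\<lambda>(q, q' :: real). {V \<in> grassmannian m. net_content dyadic q (orth_proj V ` E) = 0})"
  have "countable P"
    by (rule countable_subset[of _ "\<rat> \<times> \<rat>"]) (use countable_rat in \<open>auto simp: P_def\<close>)
  then have null: "net_content grass_label t (\<Union>p\<in>P. X p) = 0"
  proof (rule net_content_UN_eq_0)
    fix p assume "p \<in> P"
    then show "net_content grass_label t (X p) = 0"
      unfolding P_def X_def by (auto intro: hausdorff_scale_null[OF E _ _ _ t])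
  qed
  have "{V \<in> grassmannian m. hausdorff_dim dist (orth_proj V ` E) < hausdorff_profile s E} \<subseteq> (\<Union>p\<in>P. X p)"
  proof
    fix V assume "V \<in> {V \<in> grassmannian m. hausdorff_dim dist (orth_proj V ` E) < hausdorff_profile s E}"
    then have V: "V \<in> grassmannian m" "hausdorff_dim dist (orth_proj V ` E) < hausdorff_profile s E" by auto
    obtain y where y: "hausdorff_dim dist (orth_proj V ` E) < ereal y" "ereal y < hausdorff_profile s E"
      using ereal_dense2[OF V(2)] by blast
    obtain q' where q': "q' \<in> \<rat>" "hausdorff_dim dist (orth_proj V ` E) < ereal q'" "q' < y"
      by (rule ereal_rat_between[OF y(1)])
    obtain q where q: "q \<in> \<rat>" "hausdorff_dim dist (orth_proj V ` E) < ereal q" "q < q'"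
      by (rule ereal_rat_between[OF q'(2)])
    have "0 < ereal q" using hausdorff_dim_nonneg q(2) by (rule le_less_trans)
    then have q0: "0 < q" by simp
    have "ereal q' < hausdorff_profile s E" using q'(3) y(2) by (meson ereal_less_eq(3) less_imp_le order_le_less_trans)
    then have "q' < s" "ereal q' < hausdorff_dim dist E" by (auto simp: hausdorff_profile_def)
    then have "(q, q') \<in> P"
      using net_content_dyadic_pos_below_dim[of q' E] q q' q0 by (simp add: P_def)
    moreover have "V \<in> X (q, q')" using V(1) net_content_dyadic_eq_0_above_dim[OF q(2)] by (simp add: X_def)
    ultimately show "V \<in> (\<Union>p\<in>P. X p)" by blast
  qed
  from net_content_mono[OF this, of grass_label t] null show ?thesis by simp
qed

lemma hausdorff_dim_le_of_net_content_grass: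
  fixes X :: "(real ^ 'n) set set"
  assumes "net_content grass_label t X = 0" "0 < t" "X \<subseteq> grassmannian m"
  shows "hausdorff_dim grassmann_dist X \<le> ereal t"
proof -
  have "hausdorff_measure grassmann_dist t X = 0"
    by (rule hausdorff_measure_eq_0_of_net_content[where C = "2 * (real CARD('n))\<^sup>2", OF assms(1,2)])
      (use assms(3) in \<open>blast intro: grass_label_eq_dist\<close>)
  then show ?thesis using assms(2) by (intro hausdorff_dim_le) auto
qed

section \<open>The case s = 0, and the assembly of the four estimates\<close>

lemma hausdorff_dim_empty: "hausdorff_dim d {} \<le> ereal 0"
proof (rule hausdorff_dim_le)
  have "hausdorff_premeasure d 0 \<delta> {} \<le> (\<Sum>i::nat. diam_powr d 0 {})" for \<delta>
    unfolding hausdorff_premeasure_def by (rule INF_lower) simp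
  then have "hausdorff_premeasure d 0 \<delta> {} = 0" for \<delta> by (simp add: diam_powr_def)
  then show "hausdorff_measure d 0 {} = 0" by (simp add: hausdorff_measure_def)
qed simp

lemma profile_capacity_0:
  fixes E :: "'a::euclidean_space set"
  assumes "E \<noteq> {}"
  shows "profile_capacity 0 r E = 1"
proof -
  have ne: "prob_measures_on (closure E) \<noteq> {}"
    using assms closure_subset prob_measures_on_nonempty[OF _ closed_closure] by blast
  have "energy 0 r \<mu> = 1" if "\<mu> \<in> prob_measures_on (closure E)" for \<mu>
  proof -
    interpret profile_measure \<mu> by (rule prob_measures_onD(1)[OF that])
    show ?thesis by (simp add: energy_def profile_kernel_def)
  qed
  then have "energy 0 r ` prob_measures_on (closure E) = {1}" using ne by auto
  then show ?thesis by (simp add: profile_capacity_eq)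
qed

lemma box_dims_nonneg:
  fixes S :: "'a::euclidean_space set"
  assumes "bounded S" "S \<noteq> {}"
  shows "0 \<le> lower_box_dim S" "0 \<le> upper_box_dim S"
proof -
  have "\<forall>\<^sub>F r in at_right (0::real). 0 < r \<and> r < 1"
    unfolding eventually_at_right_field by (rule exI[of _ 1]) simp
  then have "\<forall>\<^sub>F r in at_right 0. 0 \<le> ereal (ln (real (covering_number r S)) / - ln r)"
  proof eventually_elim
    fix r :: real assume r: "0 < r \<and> r < 1"
    then have "0 \<le> ln (real (covering_number r S))" using covering_number_ge_1[OF assms, of r] by simp
    then have "0 \<le> ln (real (covering_number r S)) / - ln r" by (rule divide_nonneg_nonneg) (use r in simp)
    then show "0 \<le> ereal (ln (real (covering_number r S)) / - ln r)" by simp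
  qed
  then show l: "0 \<le> lower_box_dim S" unfolding lower_box_dim_def by (rule Liminf_bounded)
  have "lower_box_dim S \<le> upper_box_dim S"
    unfolding lower_box_dim_def upper_box_dim_def by (rule Liminf_le_Limsup) simp
  with l show "0 \<le> upper_box_dim S" by order
qed

lemma box_profiles_0:
  fixes E :: "'a::euclidean_space set"
  assumes "E \<noteq> {}"
  shows "lower_box_profile 0 E = 0" "upper_box_profile 0 E = 0"
  unfolding lower_box_profile_def upper_box_profile_def profile_capacity_0[OF assms]
  by (simp_all add: Liminf_const Limsup_const)

lemma packing_dim_nonneg: "0 \<le> packing_dim E"
  unfolding packing_dim_def
proof (rule INF_greatest)
  fix F :: "nat \<Rightarrow> 'a set"
  assume "F \<in> {F. E \<subseteq> (\<Union>i. F i) \<and> (\<forall>i. F i \<noteq> {} \<and> bounded (F i))}"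
  then have "0 \<le> upper_box_dim (F 0)" by (intro box_dims_nonneg(2)) auto
  also have "\<dots> \<le> (SUP i. upper_box_dim (F i))" by (rule SUP_upper) simp
  finally show "0 \<le> (SUP i. upper_box_dim (F i))" .
qed

lemma packing_profile_0_le:
  assumes "(E :: 'a::euclidean_space set) \<noteq> {}"
  shows "packing_profile 0 E \<le> 0"
proof -
  have "profile_small 0 0 E"
    unfolding profile_small_def
  proof (intro exI[of _ "range (\<lambda>n. cball 0 (real n))"] conjI ballI)
    show "E \<subseteq> \<Union>(range (\<lambda>n. cball 0 (real n)))" using real_arch_simple by auto
  qed (auto simp: box_profiles_0)
  from packing_profile_le[OF this assms] show ?thesis by (simp add: zero_ereal_def)
qed

theorem theorem1p2:
  fixes E :: "(real ^ 'n) set" and m :: nat and s :: real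
  assumes "1 \<le> m" and "m \<le> CARD('n) - 1"
    and "E \<in> sets borel" and "E \<noteq> {}"
    and "0 \<le> s" and "s \<le> real m"
  shows
    "hausdorff_dim grassmann_dist
       {V \<in> grassmannian m. hausdorff_dim dist (orth_proj V ` E) < hausdorff_profile s E}
     \<le> ereal (real m * (real CARD('n) - real m) - (real m - s))
   \<and> (bounded E \<longrightarrow> hausdorff_dim grassmann_dist
       {V \<in> grassmannian m. lower_box_dim (orth_proj V ` E) < lower_box_profile s E}
     \<le> ereal (real m * (real CARD('n) - real m) - (real m - s)))
   \<and> (bounded E \<longrightarrow> hausdorff_dim grassmann_dist
       {V \<in> grassmannian m. upper_box_dim (orth_proj V ` E) < upper_box_profile s E}
     \<le> ereal (real m * (real CARD('n) - real m) - (real m - s)))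
   \<and> hausdorff_dim grassmann_dist
       {V \<in> grassmannian m. packing_dim (orth_proj V ` E) < packing_profile s E}
     \<le> ereal (real m * (real CARD('n) - real m) - (real m - s))"
proof -
  \<comment> \<open>m(n-m) - (m-s) in the form produced by the label count; m <= n - 1 makes the
    natural-number subtraction exact.\<close>
  define t where "t = real (m * (CARD('n) - m - 1)) + s"
  have "m + 1 \<le> CARD('n)" using assms(1,2) by linarith
  then have teq: "real m * (real CARD('n) - real m) - (real m - s) = t"
  proof -
    have "real (CARD('n) - m - 1) = real CARD('n) - real m - 1" using \<open>m + 1 \<le> CARD('n)\<close> by linarith
    then show ?thesis unfolding t_def of_nat_mult by (simp only:) (simp add: algebra_simps)
  qed
  have an: "analytic_set E" by (rule analytic_set_borel[OF assms(3)])
  show ?thesis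
  \<comment> \<open>At s = 0 the exponent t may itself be 0, outside the reach of the content
    criterion. All profiles are then at most 0 and all dimensions at least 0, so the exceptional
    sets are empty.\<close>
  proof (cases "s = 0")
    case False
    then have s: "0 < s" using assms(5) by simp
    then have t: "0 < t" by (simp add: t_def add_nonneg_pos)
    note H = hausdorff_dim_le_of_net_content_grass[where m = m and t = t, OF _ t]
    show ?thesis
      unfolding teq
    proof (intro conjI impI)
      show "hausdorff_dim grassmann_dist
          {V \<in> grassmannian m. hausdorff_dim dist (orth_proj V ` E) < hausdorff_profile s E} \<le> ereal t"
        by (rule H[OF hausdorff_exceptional_null[OF an s t_def]]) blast
      show "hausdorff_dim grassmann_dist
          {V \<in> grassmannian m. lower_box_dim (orth_proj V ` E) < lower_box_profile s E} \<le> ereal t" if "bounded E"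
        by (rule H[OF lower_box_exceptional_null[OF that assms(4) s t_def]]) blast
      show "hausdorff_dim grassmann_dist
          {V \<in> grassmannian m. upper_box_dim (orth_proj V ` E) < upper_box_profile s E} \<le> ereal t" if "bounded E"
        by (rule H[OF upper_box_exceptional_null[OF that assms(4) s t_def]]) blast
      show "hausdorff_dim grassmann_dist
          {V \<in> grassmannian m. packing_dim (orth_proj V ` E) < packing_profile s E} \<le> ereal t"
        by (rule H[OF packing_exceptional_null[OF an assms(4) s t_def]]) blast
    qed
  next
    case True
    have "ereal 0 \<le> ereal t" by (simp add: t_def True)
    then have empty: "hausdorff_dim grassmann_dist X \<le> ereal t" if "X = {}" for X :: "(real ^ 'n) set set"
      unfolding that using hausdorff_dim_empty order_trans by blast
    have ne: "orth_proj V ` E \<noteq> {}" for V using assms(4) by simp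
    have bdd: "bounded (orth_proj V ` E)" if "bounded E" "V \<in> grassmannian m" for V
      by (rule bounded_orth_proj_image[OF subspace_grass[OF that(2)] that(1)])
    have "hausdorff_profile s E \<le> hausdorff_dim dist (orth_proj V ` E)" for V
      using hausdorff_dim_nonneg[of dist "orth_proj V ` E"] True
      by (auto simp: hausdorff_profile_def zero_ereal_def min_le_iff_disj)
    moreover have "lower_box_profile s E \<le> lower_box_dim (orth_proj V ` E)"
        "upper_box_profile s E \<le> upper_box_dim (orth_proj V ` E)" if "bounded E" "V \<in> grassmannian m" for V
      using box_dims_nonneg[OF bdd[OF that] ne] box_profiles_0[OF assms(4)] True by auto
    moreover have "packing_profile s E \<le> packing_dim (orth_proj V ` E)" for V
      using packing_dim_nonneg[of "orth_proj V ` E"] packing_profile_0_le[OF assms(4)] True by auto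
    ultimately show ?thesis
      unfolding teq by (intro conjI impI empty) (auto simp: not_less)
  qed
qed

end
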